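(* Let $U$ be a neighborhood of a point $o\in\mathbb{R}^2$ and let $g:U\to\mathbb{L}^3$ be a $C^\infty$ space-like immersion such that $o$ is an isolated umbilic of $g$ and the Gaussian curvature of $g$ is positive on $U\setminus\{o\}$. Then the index of the umbilic $o$ is non-positive.
   Context: $\mathbb{L}^3$ is the Lorentz-Minkowski 3-space, i.e. $\mathbb{R}^3$ with the inner product $x_1y_1+x_2y_2-x_3y_3$ (signature $(++-)$). An immersion is space-like if its induced metric is positive definite. The Gaussian curvature is that of the induced Riemannian metric; for surfaces in $\mathbb{L}^3$ its sign is opposite to that of the Gaussian curvature of the same surface regarded in Euclidean 3-space. With $\nu$ a unit normal field ($|\nu\cdot\nu|=1$), the shape operator $A_g$ is defined by $d\nu=-dg\circ A_g$; an umbilic is a point where $A_g$ is a scalar multiple of the identity. Around an isolated umbilic $o$, the two eigen-directions (principal directions) of $A_g$ define two direction fields on a punctured neighborhood of $o$, which generate the two curvature line flows. The index of a flow at $o$ is the total variation of the angle of the direction along a small counterclockwise circle around $o$, divided by $2\pi$, an element of $\frac12\mathbb{Z}$. For a space-like surface the two flows have the same index at $o$, and this common value is the index of the umbilic. *)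

theory Defs
  imports "HOL-Analysis.Analysis"
begin

definition lorentz :: "real^3 \<Rightarrow> real^3 \<Rightarrow> real" where
  "lorentz x y = x $ 1 * y $ 1 + x $ 2 * y $ 2 - x $ 3 * y $ 3"

definition partial_deriv :: "'n::finite \<Rightarrow> (real^'n \<Rightarrow> 'b::real_normed_vector) \<Rightarrow> real^'n \<Rightarrow> 'b" where
  "partial_deriv i f p = frechet_derivative f (at p) (axis i 1)"

text \<open>The derivatives are two-sided (\<^term>\<open>at p\<close>), so the next two notions are meant for open \<open>U\<close>.\<close>

primrec Ck_on :: "nat \<Rightarrow> (real^'n::finite) set \<Rightarrow> (real^'n \<Rightarrow> 'b::real_normed_vector) \<Rightarrow> bool" where
  "Ck_on 0 U f \<longleftrightarrow> continuous_on U f"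
| "Ck_on (Suc k) U f \<longleftrightarrow>
     (\<forall>p\<in>U. f differentiable (at p)) \<and> (\<forall>i. Ck_on k U (partial_deriv i f))"

definition smooth_on :: "(real^'n::finite) set \<Rightarrow> (real^'n \<Rightarrow> 'b::real_normed_vector) \<Rightarrow> bool" where
  "smooth_on U f \<longleftrightarrow> (\<forall>k. Ck_on k U f)"

definition spacelike_immersion_on :: "(real^2) set \<Rightarrow> (real^2 \<Rightarrow> real^3) \<Rightarrow> bool" where
  "spacelike_immersion_on U g \<longleftrightarrow> smooth_on U g \<and>
     (\<forall>p\<in>U. inj (frechet_derivative g (at p)) \<and>
       (\<forall>v. v \<noteq> 0 \<longrightarrow>
          lorentz (frechet_derivative g (at p) v) (frechet_derivative g (at p) v) > 0))"


subsection \<open>Gaussian curvature of a Riemannian metric on a planar domain\<close>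

definition induced_metric :: "(real^2 \<Rightarrow> real^3) \<Rightarrow> real^2 \<Rightarrow> real^2^2" where
  "induced_metric g p = (\<chi> i j. lorentz (partial_deriv i g p) (partial_deriv j g p))"

text \<open>\<open>christoffel G l i j\<close> is the symbol \<open>\<Gamma>\<^sup>l\<^sub>i\<^sub>j\<close> of the Levi-Civita connection of \<open>G\<close>.\<close>

definition christoffel :: "(real^2 \<Rightarrow> real^2^2) \<Rightarrow> 2 \<Rightarrow> 2 \<Rightarrow> 2 \<Rightarrow> real^2 \<Rightarrow> real" where
  "christoffel G l i j p = (1/2) * (\<Sum>m\<in>UNIV. matrix_inv (G p) $ l $ m *
     (partial_deriv i (\<lambda>q. G q $ j $ m) p + partial_deriv j (\<lambda>q. G q $ i $ m) p
      - partial_deriv m (\<lambda>q. G q $ i $ j) p))"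

text \<open>\<open>riemann_curvature G l k i j\<close> is the component of \<open>R(\<partial>\<^sub>i, \<partial>\<^sub>j) \<partial>\<^sub>k\<close> along \<open>\<partial>\<^sub>l\<close>, with the sign
  convention \<open>R(X, Y) Z = \<nabla>\<^sub>X \<nabla>\<^sub>Y Z - \<nabla>\<^sub>Y \<nabla>\<^sub>X Z - \<nabla>\<^bsub>[X, Y]\<^esub> Z\<close>.\<close>

definition riemann_curvature :: "(real^2 \<Rightarrow> real^2^2) \<Rightarrow> 2 \<Rightarrow> 2 \<Rightarrow> 2 \<Rightarrow> 2 \<Rightarrow> real^2 \<Rightarrow> real" where
  "riemann_curvature G l k i j p =
     partial_deriv i (christoffel G l j k) p - partial_deriv j (christoffel G l i k) p
     + (\<Sum>m\<in>UNIV. christoffel G l i m p * christoffel G m j k p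
               - christoffel G l j m p * christoffel G m i k p)"

text \<open>The sectional curvature \<open>\<langle>R(\<partial>\<^sub>1, \<partial>\<^sub>2) \<partial>\<^sub>2, \<partial>\<^sub>1\<rangle> / det G\<close>; round spheres have positive curvature.\<close>

definition metric_gaussian_curvature :: "(real^2 \<Rightarrow> real^2^2) \<Rightarrow> real^2 \<Rightarrow> real" where
  "metric_gaussian_curvature G p =
     (\<Sum>l\<in>UNIV. riemann_curvature G l 2 1 2 p * G p $ l $ 1) / det (G p)"

definition gaussian_curvature :: "(real^2 \<Rightarrow> real^3) \<Rightarrow> real^2 \<Rightarrow> real" where
  "gaussian_curvature g = metric_gaussian_curvature (induced_metric g)"


subsection \<open>Shape operator and umbilics\<close>

definition unit_normal_field :: "(real^2) set \<Rightarrow> (real^2 \<Rightarrow> real^3) \<Rightarrow> (real^2 \<Rightarrow> real^3) \<Rightarrow> bool" where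
  "unit_normal_field U g \<nu> \<longleftrightarrow> smooth_on U \<nu> \<and>
     (\<forall>p\<in>U. \<bar>lorentz (\<nu> p) (\<nu> p)\<bar> = 1 \<and>
       (\<forall>v. lorentz (\<nu> p) (frechet_derivative g (at p) v) = 0))"

text \<open>For an immersion the tangential derivative of \<open>\<nu>\<close> has a unique preimage under \<open>dg\<close>, so the
  description below is proper.\<close>

definition shape_operator ::
    "(real^2 \<Rightarrow> real^3) \<Rightarrow> (real^2 \<Rightarrow> real^3) \<Rightarrow> real^2 \<Rightarrow> real^2 \<Rightarrow> real^2" where
  "shape_operator g \<nu> p = (THE A. linear A \<and>
     (\<forall>v. frechet_derivative \<nu> (at p) v = - frechet_derivative g (at p) (A v)))"

definition umbilic :: "(real^2 \<Rightarrow> real^3) \<Rightarrow> (real^2 \<Rightarrow> real^3) \<Rightarrow> real^2 \<Rightarrow> bool" where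
  "umbilic g \<nu> p \<longleftrightarrow> (\<exists>k. \<forall>v. shape_operator g \<nu> p v = k *\<^sub>R v)"

definition isolated_umbilic :: "(real^2 \<Rightarrow> real^3) \<Rightarrow> (real^2 \<Rightarrow> real^3) \<Rightarrow> real^2 \<Rightarrow> bool" where
  "isolated_umbilic g \<nu> p \<longleftrightarrow> umbilic g \<nu> p \<and> (\<forall>\<^sub>F q in at p. \<not> umbilic g \<nu> q)"


subsection \<open>Curvature line flows and the index\<close>

definition principal_curvatures :: "(real^2 \<Rightarrow> real^3) \<Rightarrow> (real^2 \<Rightarrow> real^3) \<Rightarrow> real^2 \<Rightarrow> real set" where
  "principal_curvatures g \<nu> p = {k. \<exists>v. v \<noteq> 0 \<and> shape_operator g \<nu> p v = k *\<^sub>R v}"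

text \<open>Away from umbilics of a space-like immersion the shape operator has exactly two real
  eigenvalues; the two direction fields are the eigenlines of the larger and of the smaller one.\<close>

definition max_curvature_flow ::
    "(real^2 \<Rightarrow> real^3) \<Rightarrow> (real^2 \<Rightarrow> real^3) \<Rightarrow> real^2 \<Rightarrow> (real^2) set" where
  "max_curvature_flow g \<nu> p =
     {v. shape_operator g \<nu> p v = Max (principal_curvatures g \<nu> p) *\<^sub>R v}"

definition min_curvature_flow ::
    "(real^2 \<Rightarrow> real^3) \<Rightarrow> (real^2 \<Rightarrow> real^3) \<Rightarrow> real^2 \<Rightarrow> (real^2) set" where
  "min_curvature_flow g \<nu> p =
     {v. shape_operator g \<nu> p v = Min (principal_curvatures g \<nu> p) *\<^sub>R v}"

definition polar_vec :: "real \<Rightarrow> real^2" where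
  "polar_vec t = vector [cos t, sin t]"

text \<open>For a direction field \<open>L\<close> (a line \<open>L q\<close> through \<open>0\<close> for each \<open>q\<close> near \<open>p\<close>, \<open>q \<noteq> p\<close>):
  \<open>\<theta>\<close> is a continuous choice of the angle of the direction along the circle of radius \<open>r\<close>, traversed
  counterclockwise. Only the line closes up, so \<open>\<theta> (2 * pi) - \<theta> 0\<close> is a multiple of \<open>pi\<close> and the
  index a half-integer.\<close>

definition has_flow_index :: "(real^2 \<Rightarrow> (real^2) set) \<Rightarrow> real^2 \<Rightarrow> real \<Rightarrow> bool" where
  "has_flow_index L p i \<longleftrightarrow>
     (\<forall>\<^sub>F r in at_right 0. \<exists>\<theta>. continuous_on {0..2 * pi} \<theta> \<and>
        (\<forall>t\<in>{0..2 * pi}. polar_vec (\<theta> t) \<in> L (p + r *\<^sub>R polar_vec t)) \<and>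
        i = (\<theta> (2 * pi) - \<theta> 0) / (2 * pi))"

text \<open>The common index of the two flows.\<close>

definition umbilic_index :: "(real^2 \<Rightarrow> real^3) \<Rightarrow> (real^2 \<Rightarrow> real^3) \<Rightarrow> real^2 \<Rightarrow> real" where
  "umbilic_index g \<nu> p = (THE i. has_flow_index (max_curvature_flow g \<nu>) p i \<and>
                                 has_flow_index (min_curvature_flow g \<nu>) p i)"

end

theory Submission
  imports Defs
begin

text \<open>By the Gauss equation \<open>K > 0\<close> says that the second fundamental form \<open>h\<close> is indefinite off the
  umbilic. The eigenline of \<open>h\<close> for the positive (negative) principal curvature is then never
  orthogonal to the corresponding Euclidean eigenline in the parameter plane, so the index is half
  the turning number of \<open>D = h\<^sub>1\<^sub>1 - h\<^sub>2\<^sub>2 + 2 \<i> h\<^sub>1\<^sub>2\<close>.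

  Writing \<open>X\<close> for the horizontal part of \<open>g\<close> and \<open>F = (\<nu>\<^sub>1 / \<nu>\<^sub>3, \<nu>\<^sub>2 / \<nu>\<^sub>3)\<close>, the matrix
  \<open>B = DX\<^sup>T DF\<close> is symmetric and proportional to \<open>h\<close>. Put \<open>f = F - F p\<^sub>0\<close>, let \<open>v\<close> be the adjugate of
  \<open>DX\<close> applied to \<open>f\<close>, and \<open>w\<close> the same with \<open>DX\<close> frozen at \<open>p\<^sub>0\<close>. Since \<open>w\<close> reverses orientation
  off \<open>p\<^sub>0\<close>, its zero \<open>p\<^sub>0\<close> is isolated, and \<open>w\<close>, hence also \<open>v\<close>, has turning number at most \<open>- 1\<close>.
  The function \<open>\<bar>f\<bar>\<^sup>2 / 2\<close> has a strict minimum at \<open>p\<^sub>0\<close>, so its gradient \<open>DF\<^sup>T f\<close> has turning number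
  \<open>1\<close>. This gradient is a multiple of \<open>B v\<close>, which turns like \<open>D\<close> times the conjugate of \<open>v\<close>. Hence
  \<open>D\<close> has turning number at most \<open>1 - 1 = 0\<close>.\<close>

subsection \<open>Calculus of partial derivatives\<close>

text \<open>Where the surface is a graph \<open>x\<^sub>3 = u (x\<^sub>1, x\<^sub>2)\<close>,
  orthogonality of \<open>\<nu>\<close> to the tangent vectors says that \<open>F\<close> is the
  gradient of \<open>u\<close>. So \<open>B\<close> is the Hessian of \<open>u\<close> pulled back
  by \<open>X\<close>, which explains its symmetry, and \<open>det B = det DX * det DF\<close> turns
  indefiniteness into opposite orientations of \<open>X\<close> and \<open>F\<close>. Degeneration
  at \<open>p\<^sub>0\<close> shapes the proof. There \<open>DF\<close> may vanish to any order, so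
  neither the inverse function theorem for \<open>w\<close> nor a nondegenerate Hessian of the
  squared length of \<open>f\<close> is available. The bound for \<open>w\<close> therefore comes
  from an integral that is monotone in the radius, and the turning number of the gradient from
  iterated gradient steps. The detour from \<open>v\<close> to \<open>w\<close> is needed because
  the Jacobian of \<open>v\<close> contains second derivatives of \<open>X\<close> and has no
  definite sign, whereas that of \<open>w\<close> is \<open>det DX\<close> at
  \<open>p\<^sub>0\<close> times \<open>det DF\<close>. Near \<open>p\<^sub>0\<close> the two fields
  are never antipodal. Lines rather than vectors make up the flows; they are coded by
  \<open>cis (2 * \<theta>)\<close>, which closes up along a circle, and the index is half of its
  turning number.\<close>

lemma partial_deriv_eqI:
  "(f has_derivative f') (at p) \<Longrightarrow> partial_deriv i f p = f' (axis i 1)"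
  unfolding partial_deriv_def using frechet_derivative_at by metis

lemma partial_deriv_cong:
  assumes "open U" "p \<in> U" "\<And>x. x \<in> U \<Longrightarrow> f x = g x"
  shows "partial_deriv i f p = partial_deriv i g p"
proof -
  have "(f has_derivative f') (at p) \<longleftrightarrow> (g has_derivative f') (at p)" for f'
    using assms by (metis has_derivative_transform_within_open)
  then show ?thesis
    unfolding partial_deriv_def frechet_derivative_def by simp
qed

lemma has_derivative_partials:
  fixes f :: "real^'n::finite \<Rightarrow> 'b::real_normed_vector"
  assumes "f differentiable (at p)"
  shows "(f has_derivative (\<lambda>v. \<Sum>i\<in>UNIV. v $ i *\<^sub>R partial_deriv i f p)) (at p)"
proof -
  let ?D = "frechet_derivative f (at p)"
  have D: "(f has_derivative ?D) (at p)" using assms frechet_derivative_works by blast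
  then have l: "linear ?D" by (rule has_derivative_linear)
  have "?D v = (\<Sum>i\<in>UNIV. v $ i *\<^sub>R partial_deriv i f p)" for v
  proof -
    have "v = (\<Sum>i\<in>UNIV. v $ i *\<^sub>R axis i 1)"
      by (simp add: basis_expansion flip: scalar_mult_eq_scaleR)
    then have "?D v = ?D (\<Sum>i\<in>UNIV. v $ i *\<^sub>R axis i 1)" by simp
    also have "\<dots> = (\<Sum>i\<in>UNIV. v $ i *\<^sub>R ?D (axis i 1))"
      by (simp add: linear_sum[OF l] linear_scale[OF l])
    finally show ?thesis by (simp add: partial_deriv_def)
  qed
  then have "?D = (\<lambda>v. \<Sum>i\<in>UNIV. v $ i *\<^sub>R partial_deriv i f p)" by (rule ext)
  then show ?thesis using D by simp
qed

lemma has_derivative_partials2: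
  fixes f :: "real^2 \<Rightarrow> 'b::real_normed_vector"
  assumes "f differentiable (at p)"
  shows "(f has_derivative (\<lambda>v. v $ 1 *\<^sub>R partial_deriv 1 f p + v $ 2 *\<^sub>R partial_deriv 2 f p)) (at p)"
  using has_derivative_partials[OF assms] by (simp add: sum_2)

lemma frechet_derivative_partials2:
  fixes f :: "real^2 \<Rightarrow> 'b::real_normed_vector"
  assumes "f differentiable (at p)"
  shows "frechet_derivative f (at p) v = v $ 1 *\<^sub>R partial_deriv 1 f p + v $ 2 *\<^sub>R partial_deriv 2 f p"
  by (simp flip: frechet_derivative_at[OF has_derivative_partials2[OF assms]])

lemma partial_deriv_add:
  assumes "f differentiable (at p)" "g differentiable (at p)"
  shows "partial_deriv i (\<lambda>x. f x + g x) p = partial_deriv i f p + partial_deriv i g p"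
  unfolding partial_deriv_def
  using partial_deriv_eqI[OF has_derivative_add[OF assms[unfolded frechet_derivative_works]]]
  by (simp add: partial_deriv_def)

lemma partial_deriv_diff:
  assumes "f differentiable (at p)" "g differentiable (at p)"
  shows "partial_deriv i (\<lambda>x. f x - g x) p = partial_deriv i f p - partial_deriv i g p"
  unfolding partial_deriv_def
  using partial_deriv_eqI[OF has_derivative_diff[OF assms[unfolded frechet_derivative_works]]]
  by (simp add: partial_deriv_def)

lemma partial_deriv_const [simp]: "partial_deriv i (\<lambda>x. c) p = 0"
  using partial_deriv_eqI[OF has_derivative_const] by metis

lemma partial_deriv_mult:
  fixes f g :: "real^'n::finite \<Rightarrow> real"
  assumes "f differentiable (at p)" "g differentiable (at p)"
  shows "partial_deriv i (\<lambda>x. f x * g x) p = f p * partial_deriv i g p + partial_deriv i f p * g p"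
  using partial_deriv_eqI[OF has_derivative_mult[OF assms[unfolded frechet_derivative_works]]]
  by (simp add: partial_deriv_def)

lemma partial_deriv_inverse:
  fixes f :: "real^'n::finite \<Rightarrow> real"
  assumes "f differentiable (at p)" "f p \<noteq> 0"
  shows "partial_deriv i (\<lambda>x. inverse (f x)) p = - (inverse (f p) * inverse (f p) * partial_deriv i f p)"
  using partial_deriv_eqI[OF Deriv.has_derivative_inverse[OF assms(2) assms(1)[unfolded frechet_derivative_works]]]
  by (simp add: partial_deriv_def)

text \<open>\<open>Ck_on\<close> recurses through functions on the whole space, while rules such as
  the product rule give \<open>partial_deriv\<close> only on \<open>U\<close>. Since
  \<open>U\<close> is open, agreement on \<open>U\<close> passes to the partial derivatives; this is
  what makes the inductions below work.\<close>

lemma Ck_on_cong: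
  assumes "open U" "\<And>x. x \<in> U \<Longrightarrow> f x = g x"
  shows "Ck_on k U f \<longleftrightarrow> Ck_on k U g"
  using assms(2)
proof (induction k arbitrary: f g)
  case 0
  then show ?case by (simp cong: continuous_on_cong)
next
  case (Suc k)
  have "f differentiable (at p) \<longleftrightarrow> g differentiable (at p)" if "p \<in> U" for p
    unfolding differentiable_def
    by (metis Suc.prems has_derivative_transform_within_open assms(1) that)
  moreover have "Ck_on k U (partial_deriv i f) \<longleftrightarrow> Ck_on k U (partial_deriv i g)" for i
    by (rule Suc.IH) (metis Suc.prems assms(1) partial_deriv_cong)
  ultimately show ?case by simp
qed

lemma Ck_on_SucD: "Ck_on (Suc k) U f \<Longrightarrow> Ck_on k U f"
proof (induction k arbitrary: f)
  case 0
  then show ?case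
    by (auto intro!: continuous_at_imp_continuous_on differentiable_imp_continuous_within)
next
  case (Suc k)
  then show ?case by (metis Ck_on.simps(2))
qed

lemma Ck_on_const: "Ck_on k U (\<lambda>x::real^'n::finite. c)"
proof (induction k arbitrary: c)
  case (Suc k)
  have "partial_deriv i (\<lambda>x. c) = (\<lambda>x. 0)" for i :: 'n
    by (rule ext) simp
  then show ?case using Suc by simp
qed simp

lemma Ck_on_add:
  assumes "open U"
  shows "Ck_on k U f \<Longrightarrow> Ck_on k U g \<Longrightarrow> Ck_on k U (\<lambda>x. f x + g x)"
proof (induction k arbitrary: f g)
  case 0
  then show ?case by (simp add: continuous_on_add)
next
  case (Suc k)
  have "Ck_on k U (partial_deriv i (\<lambda>x. f x + g x))" for i
  proof -
    have "Ck_on k U (\<lambda>x. partial_deriv i f x + partial_deriv i g x)"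
      using Suc by simp
    moreover have "Ck_on k U (\<lambda>x. partial_deriv i f x + partial_deriv i g x) \<longleftrightarrow>
        Ck_on k U (partial_deriv i (\<lambda>x. f x + g x))"
      by (rule Ck_on_cong[OF assms]) (use Suc.prems in \<open>simp add: partial_deriv_add\<close>)
    ultimately show ?thesis by simp
  qed
  then show ?case using Suc.prems by simp
qed

lemma Ck_on_mult:
  fixes f g :: "real^'n::finite \<Rightarrow> real"
  assumes "open U"
  shows "Ck_on k U f \<Longrightarrow> Ck_on k U g \<Longrightarrow> Ck_on k U (\<lambda>x. f x * g x)"
proof (induction k arbitrary: f g)
  case 0
  then show ?case by (simp add: continuous_on_mult)
next
  case (Suc k)
  have "Ck_on k U (partial_deriv i (\<lambda>x. f x * g x))" for i
  proof -
    have "Ck_on k U (\<lambda>x. f x * partial_deriv i g x + partial_deriv i f x * g x)"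
      using Suc.prems Ck_on_SucD[of k U f] Ck_on_SucD[of k U g]
      by (intro Ck_on_add[OF assms] Suc.IH) auto
    moreover have "Ck_on k U (\<lambda>x. f x * partial_deriv i g x + partial_deriv i f x * g x) \<longleftrightarrow>
        Ck_on k U (partial_deriv i (\<lambda>x. f x * g x))"
      by (rule Ck_on_cong[OF assms]) (use Suc.prems in \<open>simp add: partial_deriv_mult\<close>)
    ultimately show ?thesis by simp
  qed
  then show ?case using Suc.prems by simp
qed

lemma Ck_on_inverse:
  fixes f :: "real^'n::finite \<Rightarrow> real"
  assumes "open U" "\<And>x. x \<in> U \<Longrightarrow> f x \<noteq> 0"
  shows "Ck_on k U f \<Longrightarrow> Ck_on k U (\<lambda>x. inverse (f x))"
proof (induction k)
  case 0
  then show ?case using assms by (simp add: continuous_on_inverse)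
next
  case (Suc k)
  have I: "Ck_on k U (\<lambda>x. inverse (f x))" using Suc Ck_on_SucD by blast
  have "Ck_on k U (partial_deriv i (\<lambda>x. inverse (f x)))" for i
  proof -
    have "Ck_on k U (\<lambda>x. (- 1) * (inverse (f x) * inverse (f x) * partial_deriv i f x))"
      using Suc.prems I by (intro Ck_on_mult[OF assms(1)] Ck_on_const) auto
    moreover have "Ck_on k U (\<lambda>x. (- 1) * (inverse (f x) * inverse (f x) * partial_deriv i f x)) \<longleftrightarrow>
        Ck_on k U (partial_deriv i (\<lambda>x. inverse (f x)))"
      by (rule Ck_on_cong[OF assms(1)]) (use Suc.prems assms(2) in \<open>simp add: partial_deriv_inverse\<close>)
    ultimately show ?thesis by simp
  qed
  then show ?case using Suc.prems assms(2) by simp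
qed

lemma smooth_on_cong:
  "open U \<Longrightarrow> (\<And>x. x \<in> U \<Longrightarrow> f x = g x) \<Longrightarrow> smooth_on U f \<longleftrightarrow> smooth_on U g"
  unfolding smooth_on_def using Ck_on_cong by blast

lemma smooth_on_const [intro, simp]: "smooth_on U (\<lambda>x. c)"
  unfolding smooth_on_def using Ck_on_const by blast

lemma smooth_on_add: "open U \<Longrightarrow> smooth_on U f \<Longrightarrow> smooth_on U g \<Longrightarrow> smooth_on U (\<lambda>x. f x + g x)"
  unfolding smooth_on_def using Ck_on_add by blast

lemma smooth_on_mult:
  fixes f g :: "real^'n::finite \<Rightarrow> real"
  shows "open U \<Longrightarrow> smooth_on U f \<Longrightarrow> smooth_on U g \<Longrightarrow> smooth_on U (\<lambda>x. f x * g x)"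
  unfolding smooth_on_def using Ck_on_mult by blast

lemma smooth_on_uminus:
  fixes f :: "real^'n::finite \<Rightarrow> real"
  shows "open U \<Longrightarrow> smooth_on U f \<Longrightarrow> smooth_on U (\<lambda>x. - f x)"
  using smooth_on_mult[of U "\<lambda>x. - 1" f] by simp

lemma smooth_on_diff:
  fixes f g :: "real^'n::finite \<Rightarrow> real"
  shows "open U \<Longrightarrow> smooth_on U f \<Longrightarrow> smooth_on U g \<Longrightarrow> smooth_on U (\<lambda>x. f x - g x)"
  using smooth_on_add[of U f "\<lambda>x. - g x"] smooth_on_uminus[of U g] by simp

lemma smooth_on_divide:
  fixes f g :: "real^'n::finite \<Rightarrow> real"
  shows "open U \<Longrightarrow> smooth_on U f \<Longrightarrow> smooth_on U g \<Longrightarrow> (\<And>x. x \<in> U \<Longrightarrow> g x \<noteq> 0) \<Longrightarrow>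
    smooth_on U (\<lambda>x. f x / g x)"
  using smooth_on_mult[of U f "\<lambda>x. inverse (g x)"] Ck_on_inverse[of U g]
  by (simp add: smooth_on_def divide_inverse)

lemma smooth_on_partial_deriv: "smooth_on U f \<Longrightarrow> smooth_on U (partial_deriv i f)"
  unfolding smooth_on_def by (metis Ck_on.simps(2))

lemma smooth_on_differentiable: "smooth_on U f \<Longrightarrow> p \<in> U \<Longrightarrow> f differentiable (at p)"
  unfolding smooth_on_def by (metis Ck_on.simps(2))

lemma smooth_on_continuous: "smooth_on U f \<Longrightarrow> continuous_on U f"
  unfolding smooth_on_def by (metis Ck_on.simps(1))

lemma partial_deriv_component:
  fixes f :: "real^'n::finite \<Rightarrow> real^'m::finite"
  assumes "f differentiable (at p)"
  shows "partial_deriv i (\<lambda>q. f q $ k) p = partial_deriv i f p $ k"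
proof -
  have "((\<lambda>q. f q $ k) has_derivative (\<lambda>v. frechet_derivative f (at p) v $ k)) (at p)"
    using assms frechet_derivative_works bounded_linear.has_derivative[OF bounded_linear_vec_nth] by blast
  then show ?thesis using partial_deriv_eqI by (fastforce simp: partial_deriv_def)
qed

lemma Ck_on_component:
  fixes f :: "real^'n::finite \<Rightarrow> real^'m::finite"
  assumes "open U"
  shows "Ck_on k U f \<Longrightarrow> Ck_on k U (\<lambda>q. f q $ j)"
proof (induction k arbitrary: f)
  case 0
  then show ?case by (simp add: continuous_on_component)
next
  case (Suc k)
  have "(\<lambda>q. f q $ j) differentiable (at p)" if "p \<in> U" for p
    using Suc.prems that bounded_linear.has_derivative[OF bounded_linear_vec_nth]
    unfolding Ck_on.simps differentiable_def by blast
  moreover have "Ck_on k U (partial_deriv i (\<lambda>q. f q $ j))" for i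
  proof -
    have "Ck_on k U (\<lambda>q. partial_deriv i f q $ j)" using Suc by simp
    moreover have "Ck_on k U (\<lambda>q. partial_deriv i f q $ j) \<longleftrightarrow>
        Ck_on k U (partial_deriv i (\<lambda>q. f q $ j))"
      by (rule Ck_on_cong[OF assms(1)]) (use Suc.prems in \<open>simp add: partial_deriv_component\<close>)
    ultimately show ?thesis by simp
  qed
  ultimately show ?case by simp
qed

lemma smooth_on_component:
  fixes f :: "real^'n::finite \<Rightarrow> real^'m::finite"
  shows "open U \<Longrightarrow> smooth_on U f \<Longrightarrow> smooth_on U (\<lambda>q. f q $ j)"
  unfolding smooth_on_def using Ck_on_component by blast

section \<open>Symmetry of second derivatives and a Lipschitz bound\<close>

lemma has_real_derivative_along_axis:
  fixes f :: "real^'n::finite \<Rightarrow> real"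
  assumes "f differentiable (at (q + x *\<^sub>R axis i 1))"
  shows "((\<lambda>x. f (q + x *\<^sub>R axis i 1)) has_real_derivative
    partial_deriv i f (q + x *\<^sub>R axis i 1)) (at x)"
proof -
  let ?D = "frechet_derivative f (at (q + x *\<^sub>R axis i 1))"
  have D: "(f has_derivative ?D) (at (q + x *\<^sub>R axis i 1))"
    using assms frechet_derivative_works by blast
  have "((\<lambda>x. q + x *\<^sub>R axis i 1) has_derivative (\<lambda>h. h *\<^sub>R axis i 1)) (at x)"
    by (auto intro!: derivative_eq_intros)
  from has_derivative_compose[OF this D]
  have "((\<lambda>x. f (q + x *\<^sub>R axis i 1)) has_derivative (\<lambda>h. ?D (h *\<^sub>R axis i 1))) (at x)" .
  moreover have "?D (h *\<^sub>R axis i 1) = partial_deriv i f (q + x *\<^sub>R axis i 1) * h" for h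
    using linear_scale[OF has_derivative_linear[OF D], of h "axis i 1"]
    by (simp add: partial_deriv_def)
  ultimately show ?thesis by (simp add: has_field_derivative_def)
qed

text \<open>Both iterated partial derivatives are values, at nearby points, of the same second
  difference quotient, by the mean value theorem applied once in each variable.\<close>

lemma second_difference_mean_value:
  fixes f :: "real^'n::finite \<Rightarrow> real"
  assumes f: "\<And>q. q \<in> ball p r \<Longrightarrow> f differentiable (at q)"
    and fi: "\<And>q. q \<in> ball p r \<Longrightarrow> partial_deriv i f differentiable (at q)"
    and s: "0 < s" "2 * s < r"
  shows "\<exists>q\<in>ball p (2 * s). f (p + s *\<^sub>R axis i 1 + s *\<^sub>R axis j 1) - f (p + s *\<^sub>R axis i 1)
     - f (p + s *\<^sub>R axis j 1) + f p = s * s * partial_deriv j (partial_deriv i f) q"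
proof -
  have inb: "p + x *\<^sub>R axis i 1 + y *\<^sub>R axis j 1 \<in> ball p r"
    if "0 \<le> x" "x \<le> s" "0 \<le> y" "y \<le> s" for x y
  proof -
    have "norm (x *\<^sub>R axis i 1 + y *\<^sub>R axis j 1 :: real^'n) \<le> x + y"
      using norm_triangle_ineq[of "x *\<^sub>R axis i 1 :: real^'n" "y *\<^sub>R axis j 1"] that by simp
    moreover have "dist p (p + v) = norm v" for v :: "real^'n" by (simp add: dist_norm)
    ultimately show ?thesis using that s by (simp add: add.assoc)
  qed
  define \<phi> where "\<phi> x = f (p + s *\<^sub>R axis j 1 + x *\<^sub>R axis i 1) - f (p + x *\<^sub>R axis i 1)" for x
  have "(\<phi> has_real_derivative (partial_deriv i f (p + s *\<^sub>R axis j 1 + x *\<^sub>R axis i 1)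
      - partial_deriv i f (p + x *\<^sub>R axis i 1))) (at x)" if "0 \<le> x" "x \<le> s" for x
    unfolding \<phi>_def using inb[OF that, of s] inb[OF that, of 0] s
    by (intro DERIV_diff has_real_derivative_along_axis f) (auto simp: ac_simps)
  from MVT2[OF s(1) this] obtain x where x: "0 < x" "x < s"
    "\<phi> s - \<phi> 0 = s * (partial_deriv i f (p + s *\<^sub>R axis j 1 + x *\<^sub>R axis i 1)
      - partial_deriv i f (p + x *\<^sub>R axis i 1))" by auto
  have "((\<lambda>y. partial_deriv i f (p + x *\<^sub>R axis i 1 + y *\<^sub>R axis j 1)) has_real_derivative
     partial_deriv j (partial_deriv i f) (p + x *\<^sub>R axis i 1 + y *\<^sub>R axis j 1)) (at y)"
    if "0 \<le> y" "y \<le> s" for y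
    using inb[OF _ _ that, of x] x by (intro has_real_derivative_along_axis fi) auto
  from MVT2[OF s(1) this] obtain y where y: "0 < y" "y < s"
    "partial_deriv i f (p + x *\<^sub>R axis i 1 + s *\<^sub>R axis j 1)
      - partial_deriv i f (p + x *\<^sub>R axis i 1 + 0 *\<^sub>R axis j 1)
     = s * partial_deriv j (partial_deriv i f) (p + x *\<^sub>R axis i 1 + y *\<^sub>R axis j 1)" by auto
  let ?q = "p + x *\<^sub>R axis i 1 + y *\<^sub>R axis j 1"
  have "norm (x *\<^sub>R axis i 1 + y *\<^sub>R axis j 1 :: real^'n) \<le> x + y"
    using norm_triangle_ineq[of "x *\<^sub>R axis i 1 :: real^'n" "y *\<^sub>R axis j 1"] x y by simp
  moreover have "dist p (p + v) = norm v" for v :: "real^'n" by (simp add: dist_norm)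
  ultimately have "?q \<in> ball p (2 * s)" using x y by (simp add: add.assoc)
  moreover have "f (p + s *\<^sub>R axis i 1 + s *\<^sub>R axis j 1) - f (p + s *\<^sub>R axis i 1)
     - f (p + s *\<^sub>R axis j 1) + f p = \<phi> s - \<phi> 0" by (simp add: \<phi>_def ac_simps)
  ultimately show ?thesis using x(3) y(3) by (intro bexI[of _ ?q]) (auto simp: ac_simps)
qed

lemma partial_deriv_commute_real:
  fixes f :: "real^'n::finite \<Rightarrow> real"
  assumes "open U" "smooth_on U f" "p \<in> U"
  shows "partial_deriv i (partial_deriv j f) p = partial_deriv j (partial_deriv i f) p"
proof (rule ccontr)
  let ?a = "partial_deriv i (partial_deriv j f)" and ?b = "partial_deriv j (partial_deriv i f)"
  assume ne: "?a p \<noteq> ?b p"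
  define e where "e = dist (?a p) (?b p) / 2"
  have e: "e > 0" using ne by (simp add: e_def)
  have "continuous (at p) ?a" "continuous (at p) ?b"
    using assms smooth_on_partial_deriv smooth_on_continuous continuous_on_eq_continuous_at by blast+
  then obtain d1 d2 where d: "d1 > 0" "\<And>q. dist q p < d1 \<Longrightarrow> dist (?a q) (?a p) < e"
    "d2 > 0" "\<And>q. dist q p < d2 \<Longrightarrow> dist (?b q) (?b p) < e"
    unfolding continuous_at_eps_delta using e by metis
  obtain r where r: "r > 0" "ball p r \<subseteq> U" using assms openE by blast
  \<comment> \<open>The mean value points lie within \<open>2 * s\<close> of \<open>p\<close>; a
    third of the minimum keeps \<open>2 * s\<close> below all three radii.\<close>
  define s where "s = min r (min d1 d2) / 3"
  have s: "0 < s" "2 * s < r" "2 * s < d1" "2 * s < d2" using r d by (auto simp: s_def)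
  have df: "f differentiable (at q)" "partial_deriv k f differentiable (at q)"
    if "q \<in> ball p r" for k q
    using smooth_on_differentiable smooth_on_partial_deriv assms r that by blast+
  obtain q1 where q1: "q1 \<in> ball p (2 * s)" "f (p + s *\<^sub>R axis i 1 + s *\<^sub>R axis j 1) - f (p + s *\<^sub>R axis i 1)
     - f (p + s *\<^sub>R axis j 1) + f p = s * s * ?b q1"
    using second_difference_mean_value[OF df s(1,2)] by blast
  obtain q2 where q2: "q2 \<in> ball p (2 * s)" "f (p + s *\<^sub>R axis j 1 + s *\<^sub>R axis i 1) - f (p + s *\<^sub>R axis j 1)
     - f (p + s *\<^sub>R axis i 1) + f p = s * s * ?a q2"
    using second_difference_mean_value[OF df s(1,2)] by blast
  have "s * s * ?b q1 = s * s * ?a q2"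
    using q1 q2 by (simp add: algebra_simps)
  then have "?b q1 = ?a q2" using s by simp
  moreover have d: "dist (?b q1) (?b p) < e" "dist (?a q2) (?a p) < e"
    using q1(1) q2(1) s d(2)[of q2] d(4)[of q1] by (simp_all add: dist_commute)
  moreover have "dist (?a p) (?b p) \<le> dist (?a q2) (?a p) + dist (?a q2) (?b p)"
    by (rule dist_triangle3)
  ultimately show False by (simp add: e_def)
qed

lemma partial_deriv_commute:
  fixes f :: "real^'n::finite \<Rightarrow> real^'m::finite"
  assumes "open U" "smooth_on U f" "p \<in> U"
  shows "partial_deriv i (partial_deriv j f) p = partial_deriv j (partial_deriv i f) p"
proof -
  have c: "partial_deriv i (partial_deriv j f) p $ k =
     partial_deriv i (partial_deriv j (\<lambda>q. f q $ k)) p" for i j k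
  proof -
    have "partial_deriv i (partial_deriv j f) p $ k = partial_deriv i (\<lambda>q. partial_deriv j f q $ k) p"
      using assms partial_deriv_component smooth_on_differentiable smooth_on_partial_deriv by metis
    also have "\<dots> = partial_deriv i (partial_deriv j (\<lambda>q. f q $ k)) p"
      by (rule partial_deriv_cong[OF assms(1,3)])
        (metis assms(2) partial_deriv_component smooth_on_differentiable)
    finally show ?thesis .
  qed
  show ?thesis unfolding vec_eq_iff c
    using partial_deriv_commute_real[OF assms(1) smooth_on_component[OF assms(1,2)] assms(3)] by blast
qed

text \<open>The gradient iteration needs a Lipschitz constant: continuous partial derivatives are
  bounded on the compact ball, and the ball is convex.\<close>

lemma smooth_on_lipschitz:
  fixes f :: "real^'n::finite \<Rightarrow> real"
  assumes "smooth_on U f" "cball p R \<subseteq> U"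
  shows "\<exists>L. L-lipschitz_on (cball p R) f"
proof -
  have "\<exists>M. \<forall>q\<in>cball p R. \<bar>partial_deriv i f q\<bar> \<le> M" for i
  proof -
    have "continuous_on (cball p R) (partial_deriv i f)"
      using assms smooth_on_continuous smooth_on_partial_deriv continuous_on_subset by blast
    then have "compact (partial_deriv i f ` cball p R)" by (simp add: compact_continuous_image)
    then show ?thesis by (metis bounded_real compact_imp_bounded imageI)
  qed
  then obtain M where M: "\<And>i q. q \<in> cball p R \<Longrightarrow> \<bar>partial_deriv i f q\<bar> \<le> M i" by metis
  let ?L = "\<Sum>i\<in>UNIV. \<bar>M i\<bar>"
  have "?L-lipschitz_on (cball p R) f"
  proof (rule bounded_derivative_imp_lipschitz)
    fix q assume q: "q \<in> cball p R"
    show "(f has_derivative (\<lambda>v. \<Sum>i\<in>UNIV. v $ i *\<^sub>R partial_deriv i f q)) (at q within cball p R)"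
      using has_derivative_partials[OF smooth_on_differentiable[OF assms(1)]] q assms(2)
      by (meson has_derivative_at_withinI subsetD)
    have "norm (\<Sum>i\<in>UNIV. v $ i *\<^sub>R partial_deriv i f q) \<le> ?L * norm v" for v
    proof -
      have "norm (\<Sum>i\<in>UNIV. v $ i *\<^sub>R partial_deriv i f q) \<le> (\<Sum>i\<in>UNIV. \<bar>M i\<bar> * norm v)"
      proof (rule sum_norm_le)
        fix i
        have "\<bar>partial_deriv i f q\<bar> \<le> \<bar>M i\<bar>" using M[OF q, of i] by linarith
        then show "norm (v $ i *\<^sub>R partial_deriv i f q) \<le> \<bar>M i\<bar> * norm v"
          using component_le_norm_cart[of v i] by (simp add: abs_mult mult.commute mult_mono)
      qed
      then show ?thesis by (simp add: sum_distrib_right)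
    qed
    then show "onorm (\<lambda>v. \<Sum>i\<in>UNIV. v $ i *\<^sub>R partial_deriv i f q) \<le> ?L"
      by (intro onorm_le)
  qed (auto simp: sum_nonneg)
  then show ?thesis by blast
qed

subsection \<open>Turning numbers of loops\<close>

text \<open>The winding number around 0, read off from a continuous logarithm so that no
  differentiability is asked of the loop. The choice behind \<open>SOME\<close> is harmless by
  \<open>turning_eqI\<close>.\<close>

definition turning :: "(real \<Rightarrow> complex) \<Rightarrow> real" where
  "turning c = (SOME w. \<exists>q. continuous_on {0..2 * pi} q \<and> (\<forall>t\<in>{0..2 * pi}. c t = exp (q t)) \<and>
     w = (Im (q (2 * pi)) - Im (q 0)) / (2 * pi))"

definition loop :: "(real \<Rightarrow> complex) \<Rightarrow> bool" where
  "loop c \<longleftrightarrow> continuous_on {0..2 * pi} c \<and> (\<forall>t\<in>{0..2 * pi}. c t \<noteq> 0) \<and> c (2 * pi) = c 0"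

text \<open>The values lie in the discrete set of multiples of \<open>2 * pi * \<i>\<close>. This
  makes turning numbers independent of the logarithm and of a homotopy parameter.\<close>

lemma exp_eq_1_imp_constant:
  fixes f :: "'a::topological_space \<Rightarrow> complex"
  assumes "connected S" "continuous_on S f" "\<And>x. x \<in> S \<Longrightarrow> exp (f x) = 1"
  shows "f constant_on S"
proof (rule continuous_discrete_range_constant[OF assms(1,2)])
  fix x assume x: "x \<in> S"
  have "2 * pi \<le> norm (f y - f x)" if y: "y \<in> S" "f y \<noteq> f x" for y
  proof -
    have "\<exists>n::int. f z = of_real (2 * n * pi) * \<i>" if "z \<in> S" for z
      using assms(3)[OF that] unfolding exp_eq_1 by (auto simp: complex_eq_iff)
    then obtain m n :: int where "f x = of_real (2 * of_int m * pi) * \<i>" "f y = of_real (2 * of_int n * pi) * \<i>"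
      using x y(1) by meson
    moreover from this y have "m \<noteq> n" by auto
    ultimately have "f y - f x = of_real (2 * pi * of_int (n - m)) * \<i>" "\<bar>n - m\<bar> \<ge> 1"
      by (auto simp: algebra_simps)
    then have "norm (f y - f x) = 2 * pi * real_of_int \<bar>n - m\<bar>"
      by (simp only: norm_mult norm_of_real) (simp add: abs_mult)
    moreover have "1 \<le> real_of_int \<bar>n - m\<bar>" using \<open>\<bar>n - m\<bar> \<ge> 1\<close> by linarith
    ultimately show ?thesis by simp
  qed
  then show "\<exists>e>0. \<forall>y. y \<in> S \<and> f y \<noteq> f x \<longrightarrow> e \<le> norm (f y - f x)"
    by (intro exI[of _ "2 * pi"]) auto
qed

lemma turning_eqI:
  assumes "continuous_on {0..2 * pi} q" "\<And>t. t \<in> {0..2 * pi} \<Longrightarrow> c t = exp (q t)"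
  shows "turning c = (Im (q (2 * pi)) - Im (q 0)) / (2 * pi)"
  unfolding turning_def
proof (rule some_equality)
  fix w assume "\<exists>q. continuous_on {0..2 * pi} q \<and> (\<forall>t\<in>{0..2 * pi}. c t = exp (q t)) \<and>
    w = (Im (q (2 * pi)) - Im (q 0)) / (2 * pi)"
  then obtain r where r: "continuous_on {0..2 * pi} r" "\<And>t. t \<in> {0..2 * pi} \<Longrightarrow> c t = exp (r t)"
    "w = (Im (r (2 * pi)) - Im (r 0)) / (2 * pi)" by blast
  have "(\<lambda>t. q t - r t) constant_on {0..2 * pi}"
  proof (rule exp_eq_1_imp_constant)
    show "continuous_on {0..2 * pi} (\<lambda>t. q t - r t)" using assms r by (intro continuous_intros)
    show "exp (q t - r t) = 1" if "t \<in> {0..2 * pi}" for t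
      using assms(2)[OF that] r(2)[OF that] by (simp add: exp_diff)
  qed auto
  then have "q (2 * pi) - r (2 * pi) = q 0 - r 0" unfolding constant_on_def by force
  then have "q (2 * pi) - q 0 = r (2 * pi) - r 0" by (simp add: algebra_simps)
  then show "w = (Im (q (2 * pi)) - Im (q 0)) / (2 * pi)"
    unfolding r(3) by (metis minus_complex.simps(2))
qed (use assms in blast)

lemma loop_log:
  assumes "loop c"
  obtains q where "continuous_on {0..2 * pi} q" "\<And>t. t \<in> {0..2 * pi} \<Longrightarrow> c t = exp (q t)"
proof (rule continuous_logarithm_on_contractible[of "{0..2 * pi}" c])
  show "contractible {0..2 * pi}" by (intro convex_imp_contractible) simp
qed (use assms in \<open>auto simp: loop_def\<close>)

lemma loop_mult: "loop c \<Longrightarrow> loop d \<Longrightarrow> loop (\<lambda>t. c t * d t)"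
  by (auto simp: loop_def intro!: continuous_intros)

lemma loop_cnj: "loop c \<Longrightarrow> loop (\<lambda>t. cnj (c t))"
  by (auto simp: loop_def intro!: continuous_intros)

lemma turning_mult:
  assumes "loop c" "loop d"
  shows "turning (\<lambda>t. c t * d t) = turning c + turning d"
proof -
  obtain q where q: "continuous_on {0..2 * pi} q" "\<And>t. t \<in> {0..2 * pi} \<Longrightarrow> c t = exp (q t)"
    using loop_log[OF assms(1)] by blast
  obtain r where r: "continuous_on {0..2 * pi} r" "\<And>t. t \<in> {0..2 * pi} \<Longrightarrow> d t = exp (r t)"
    using loop_log[OF assms(2)] by blast
  have "turning (\<lambda>t. c t * d t) = (Im (q (2 * pi) + r (2 * pi)) - Im (q 0 + r 0)) / (2 * pi)"
    by (rule turning_eqI) (use q r in \<open>auto intro!: continuous_intros simp: exp_add\<close>)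
  moreover have "turning c = (Im (q (2 * pi)) - Im (q 0)) / (2 * pi)"
    "turning d = (Im (r (2 * pi)) - Im (r 0)) / (2 * pi)"
    using turning_eqI[OF q] turning_eqI[OF r] by auto
  ultimately show ?thesis by (simp add: diff_divide_distrib add_divide_distrib)
qed

lemma turning_cnj:
  assumes "loop c"
  shows "turning (\<lambda>t. cnj (c t)) = - turning c"
proof -
  obtain q where q: "continuous_on {0..2 * pi} q" "\<And>t. t \<in> {0..2 * pi} \<Longrightarrow> c t = exp (q t)"
    using loop_log[OF assms(1)] by blast
  have "turning (\<lambda>t. cnj (c t)) = (Im (cnj (q (2 * pi))) - Im (cnj (q 0))) / (2 * pi)"
    by (rule turning_eqI) (use q in \<open>auto intro!: continuous_intros simp: exp_cnj\<close>)
  moreover have "turning c = (Im (q (2 * pi)) - Im (q 0)) / (2 * pi)"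
    using turning_eqI[OF q] by auto
  ultimately show ?thesis by (simp add: diff_divide_distrib add_divide_distrib)
qed

lemma turning_const: "k \<noteq> 0 \<Longrightarrow> turning (\<lambda>t. k) = 0"
  using turning_eqI[of "\<lambda>t. Ln k" "\<lambda>t. k"] by simp

lemma turning_cong:
  "(\<And>t. t \<in> {0..2 * pi} \<Longrightarrow> c t = d t) \<Longrightarrow> turning c = turning d"
  unfolding turning_def by simp

lemma turning_cis: "turning cis = 1"
  using turning_eqI[of "\<lambda>t. \<i> * of_real t" cis] by (simp add: cis_conv_exp continuous_intros)

lemma loop_cis: "loop cis"
  by (auto simp: loop_def intro!: continuous_intros)

text \<open>The quotient \<open>c / d\<close> avoids 0 and the negative real axis, so its principal
  logarithm is continuous and closes up. This is the comparison principle for the vector fields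
  below.\<close>

lemma turning_nonantipodal:
  assumes c: "loop c" and d: "loop d"
    and na: "\<And>t s. t \<in> {0..2 * pi} \<Longrightarrow> s > 0 \<Longrightarrow> c t \<noteq> - (of_real s * d t)"
  shows "turning c = turning d"
proof -
  let ?e = "\<lambda>t. c t / d t"
  have nz: "c t \<noteq> 0" "d t \<noteq> 0" if "t \<in> {0..2 * pi}" for t
    using c d that by (auto simp: loop_def)
  have np: "?e t \<notin> \<real>\<^sub>\<le>\<^sub>0" if t: "t \<in> {0..2 * pi}" for t
  proof
    assume "?e t \<in> \<real>\<^sub>\<le>\<^sub>0"
    then obtain s where s: "?e t = - of_real s" "s \<ge> 0"
      by (metis minus_minus neg_0_le_iff_le nonpos_Reals_cases of_real_minus)
    then have "c t = - (of_real s * d t)" using nz[OF t] by (simp add: field_simps)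
    moreover have "s \<noteq> 0" using s nz[OF t] by auto
    ultimately show False using na[OF t, of s] s by simp
  qed
  have e: "loop ?e" using c d nz by (auto simp: loop_def intro!: continuous_intros)
  have "turning ?e = (Im (Ln (?e (2 * pi))) - Im (Ln (?e 0))) / (2 * pi)"
  proof (rule turning_eqI)
    show "continuous_on {0..2 * pi} (\<lambda>t. Ln (?e t))"
      using e np by (intro continuous_on_Ln') (auto simp: loop_def)
  qed (use nz in auto)
  then have "turning ?e = 0" using e by (simp add: loop_def)
  moreover have "turning (\<lambda>t. ?e t * d t) = turning c"
    by (rule turning_cong) (use nz in auto)
  ultimately show ?thesis using turning_mult[OF e d] by simp
qed

lemma turning_Ints:
  assumes "loop c"
  shows "turning c \<in> \<int>"
proof -
  obtain q where q: "continuous_on {0..2 * pi} q" "\<And>t. t \<in> {0..2 * pi} \<Longrightarrow> c t = exp (q t)"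
    using loop_log[OF assms(1)] by blast
  have "exp (q (2 * pi)) = exp (q 0)" using assms q(2)[of 0] q(2)[of "2 * pi"] by (simp add: loop_def)
  then have "exp (q (2 * pi) - q 0) = 1" by (simp add: exp_diff)
  then obtain n :: int where "Im (q (2 * pi)) - Im (q 0) = of_int (2 * n) * pi"
    by (auto simp: exp_eq_1)
  moreover have "turning c = (Im (q (2 * pi)) - Im (q 0)) / (2 * pi)"
    using turning_eqI[OF q] by auto
  ultimately have "turning c = of_int n" by simp
  then show ?thesis by simp
qed

lemma turning_real_mult:
  assumes "continuous_on {0..2 * pi} \<rho>" "\<And>t. t \<in> {0..2 * pi} \<Longrightarrow> \<rho> t \<noteq> (0::real)"
    "\<rho> (2 * pi) = \<rho> 0" "loop c"
  shows "turning (\<lambda>t. of_real (\<rho> t) * c t) = turning c" "loop (\<lambda>t. of_real (\<rho> t) * c t)"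
proof -
  have l: "loop (\<lambda>t. of_real (\<rho> t))" using assms by (auto simp: loop_def intro!: continuous_intros)
  show "loop (\<lambda>t. of_real (\<rho> t) * c t)" using l assms loop_mult by blast
  \<comment> \<open>\<open>\<rho>\<close> may be negative throughout. Its square is positive, hence
    has turning number 0, and that number is twice the one of \<open>\<rho>\<close>.\<close>
  have "turning (\<lambda>t. of_real (\<rho> t) * of_real (\<rho> t)) = turning (\<lambda>t. 1)"
  proof (rule turning_nonantipodal)
    fix t s :: real assume t: "t \<in> {0..2 * pi}" "s > 0"
    have "0 < \<rho> t * \<rho> t" using assms(2)[OF t(1)] by (metis not_real_square_gt_zero)
    then have "\<rho> t * \<rho> t \<noteq> - s" using t by linarith
    then show "of_real (\<rho> t) * of_real (\<rho> t) \<noteq> - (complex_of_real s * 1)"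
      by (metis mult.right_neutral of_real_eq_iff of_real_minus of_real_mult)
  qed (use loop_mult[OF l l] in \<open>auto simp: loop_def\<close>)
  then have "turning (\<lambda>t. of_real (\<rho> t)) = 0"
    using turning_mult[OF l l] by (simp add: turning_const)
  then show "turning (\<lambda>t. of_real (\<rho> t) * c t) = turning c"
    using turning_mult[OF l assms(4)] by simp
qed

text \<open>A logarithm on the whole rectangle gives logarithms of all loops at once. Its increment
  from \<open>0\<close> to \<open>2 * pi\<close> is continuous in \<open>s\<close> and a multiple of
  \<open>2 * pi * \<i>\<close>, hence constant.\<close>

lemma turning_homotopy:
  fixes H :: "real \<Rightarrow> real \<Rightarrow> complex"
  assumes "a \<le> b" and cont: "continuous_on ({a..b} \<times> {0..2 * pi}) (\<lambda>(s, t). H s t)"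
    and nz: "\<And>s t. s \<in> {a..b} \<Longrightarrow> t \<in> {0..2 * pi} \<Longrightarrow> H s t \<noteq> 0"
    and cl: "\<And>s. s \<in> {a..b} \<Longrightarrow> H s (2 * pi) = H s 0"
  shows "turning (H a) = turning (H b)"
proof -
  have "contractible ({a..b} \<times> {0..2 * pi})"
    by (intro convex_imp_contractible convex_Times) auto
  then obtain Q where Q: "continuous_on ({a..b} \<times> {0..2 * pi}) Q"
    "\<And>x. x \<in> {a..b} \<times> {0..2 * pi} \<Longrightarrow> (\<lambda>(s, t). H s t) x = exp (Q x)"
    using continuous_logarithm_on_contractible[OF cont] nz by (metis (no_types, lifting) SigmaE case_prod_conv)
  have tn: "turning (H s) = (Im (Q (s, 2 * pi)) - Im (Q (s, 0))) / (2 * pi)" if "s \<in> {a..b}" for s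
  proof (rule turning_eqI)
    show "continuous_on {0..2 * pi} (\<lambda>t. Q (s, t))"
      by (rule continuous_on_compose2[OF Q(1)]) (use that in \<open>auto intro!: continuous_intros\<close>)
    show "H s t = exp (Q (s, t))" if "t \<in> {0..2 * pi}" for t
      using Q(2)[of "(s, t)"] that \<open>s \<in> {a..b}\<close> by simp
  qed
  have "(\<lambda>s. Q (s, 2 * pi) - Q (s, 0)) constant_on {a..b}"
  proof (rule exp_eq_1_imp_constant)
    show "continuous_on {a..b} (\<lambda>s. Q (s, 2 * pi) - Q (s, 0))"
      by (intro continuous_intros; rule continuous_on_compose2[OF Q(1)]) (auto intro!: continuous_intros)
    show "exp (Q (s, 2 * pi) - Q (s, 0)) = 1" if "s \<in> {a..b}" for s
      using Q(2)[of "(s, 2 * pi)"] Q(2)[of "(s, 0)"] that cl[OF that] nz[OF that, of 0]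
      by (simp add: exp_diff)
  qed auto
  then have "Q (a, 2 * pi) - Q (a, 0) = Q (b, 2 * pi) - Q (b, 0)"
    using assms(1) unfolding constant_on_def by force
  then show ?thesis using assms(1) by (simp add: tn flip: minus_complex.simps)
qed

text \<open>A primitive \<open>q\<close> of \<open>c' / c\<close> with the right initial value is a
  logarithm, because \<open>c t * exp (- q t)\<close> has derivative 0.\<close>

lemma turning_integral:
  assumes "loop c" and der: "\<And>t. t \<in> {0..2 * pi} \<Longrightarrow> (c has_vector_derivative c' t) (at t within {0..2 * pi})"
    and cont: "continuous_on {0..2 * pi} c'"
  shows "turning c = integral {0..2 * pi} (\<lambda>t. Im (c' t / c t)) / (2 * pi)"
proof -
  have nz: "\<And>t. t \<in> {0..2 * pi} \<Longrightarrow> c t \<noteq> 0" and cc: "continuous_on {0..2 * pi} c"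
    using assms by (auto simp: loop_def)
  let ?f = "\<lambda>t. c' t / c t"
  have cf: "continuous_on {0..2 * pi} ?f" using nz cc cont by (intro continuous_intros) auto
  define q where "q t = Ln (c 0) + integral {0..t} ?f" for t
  have dq: "(q has_vector_derivative ?f t) (at t within {0..2 * pi})" if "t \<in> {0..2 * pi}" for t
    using has_vector_derivative_add[OF has_vector_derivative_const integral_has_vector_derivative[OF cf that]]
    by (simp add: q_def[abs_def])
  then have cq: "continuous_on {0..2 * pi} q"
    by (meson continuous_on_eq_continuous_within has_vector_derivative_continuous)
  have "((\<lambda>t. c t * exp (- q t)) has_vector_derivative 0) (at t within {0..2 * pi})"
    if t: "t \<in> {0..2 * pi}" for t
  proof -
    have e: "((\<lambda>t. exp (- q t)) has_vector_derivative (- ?f t) * exp (- q t)) (at t within {0..2 * pi})"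
      using field_vector_diff_chain_within[OF has_vector_derivative_minus[OF dq[OF t]], of exp "exp (- q t)"]
      by (simp add: o_def DERIV_exp has_field_derivative_at_within)
    have "c t * (- ?f t * exp (- q t)) + c' t * exp (- q t) = 0" using nz[OF t] by (simp add: field_simps)
    then show ?thesis
      using has_vector_derivative_mult[OF der[OF t] e] by simp
  qed
  then have "\<exists>k. \<forall>t\<in>{0..2 * pi}. c t * exp (- q t) = k"
    using has_vector_derivative_zero_constant[of "{0..2 * pi}" "\<lambda>t. c t * exp (- q t)"]
    by (metis convex_real_interval(5))
  then obtain k where k: "\<And>t. t \<in> {0..2 * pi} \<Longrightarrow> c t * exp (- q t) = k" by blast
  have "k = 1" using k[of 0] nz[of 0] by (simp add: q_def exp_minus)
  then have "c t = exp (q t)" if "t \<in> {0..2 * pi}" for t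
    using k[OF that] by (simp add: exp_minus field_simps)
  then have "turning c = (Im (q (2 * pi)) - Im (q 0)) / (2 * pi)" using cq by (intro turning_eqI)
  also have "Im (q (2 * pi)) - Im (q 0) = Im (integral {0..2 * pi} ?f)" by (simp add: q_def)
  also have "\<dots> = integral {0..2 * pi} (\<lambda>t. Im (?f t))"
    using integral_linear[OF integrable_continuous_real[OF cf] bounded_linear_Im] by (simp add: o_def)
  finally show ?thesis .
qed

subsection \<open>Degree of orientation preserving maps\<close>

text \<open>Stokes' theorem on an annulus for the form \<open>a (\<bar>y\<bar>\<^sup>2) (y\<^sub>1 dy\<^sub>2 - y\<^sub>2 dy\<^sub>1)\<close> pulled back along a map
  \<open>(r, t) \<mapsto> (e 1 r t, e 2 r t)\<close>, in differential form: \<open>v\<close> and \<open>u\<close> are the \<open>r\<close>- and \<open>t\<close>-derivatives of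
  \<open>e\<close>, and \<open>m\<close> is the mixed second derivative.\<close>

lemma has_derivative_angle_integral:
  fixes e v u m :: "2 \<Rightarrow> real \<Rightarrow> real \<Rightarrow> real" and a a' :: "real \<Rightarrow> real"
  assumes a: "\<And>s. (a has_real_derivative a' s) (at s)" and ca: "continuous_on UNIV a'"
    and I: "open I" "convex I"
    and er: "\<And>i r t. r \<in> I \<Longrightarrow> ((\<lambda>r. e i r t) has_real_derivative v i r t) (at r)"
    and et: "\<And>i r t. r \<in> I \<Longrightarrow> ((\<lambda>t. e i r t) has_real_derivative u i r t) (at t)"
    and ur: "\<And>i r t. r \<in> I \<Longrightarrow> ((\<lambda>r. u i r t) has_real_derivative m i r t) (at r)"
    and vt: "\<And>i r t. r \<in> I \<Longrightarrow> ((\<lambda>t. v i r t) has_real_derivative m i r t) (at t)"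
    and ce: "\<And>i. continuous_on (I \<times> UNIV) (\<lambda>x. e i (fst x) (snd x))"
    and cv: "\<And>i. continuous_on (I \<times> UNIV) (\<lambda>x. v i (fst x) (snd x))"
    and cu: "\<And>i. continuous_on (I \<times> UNIV) (\<lambda>x. u i (fst x) (snd x))"
    and cm: "\<And>i. continuous_on (I \<times> UNIV) (\<lambda>x. m i (fst x) (snd x))"
    and per: "\<And>i r. r \<in> I \<Longrightarrow> e i r (2 * pi) = e i r 0" "\<And>i r. r \<in> I \<Longrightarrow> v i r (2 * pi) = v i r 0"
    and r: "r \<in> I"
  defines "S \<equiv> \<lambda>r t. (e 1 r t)\<^sup>2 + (e 2 r t)\<^sup>2"
  shows "((\<lambda>r. integral {0..2 * pi} (\<lambda>t. a (S r t) * (e 1 r t * u 2 r t - e 2 r t * u 1 r t)))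
     has_real_derivative
       integral {0..2 * pi} (\<lambda>t. (2 * a (S r t) + 2 * S r t * a' (S r t)) * (v 1 r t * u 2 r t - v 2 r t * u 1 r t)))
     (at r)"
proof -
  \<comment> \<open>\<open>?P\<close> and \<open>?Q\<close> are the \<open>dt\<close> and
    \<open>dr\<close> coefficients of the pulled-back form. In \<open>P' - Q'\<close> the mixed
    derivatives cancel and \<open>?K\<close> remains; \<open>Q'\<close> integrates to 0 by
    periodicity.\<close>
  let ?P = "\<lambda>r t. a (S r t) * (e 1 r t * u 2 r t - e 2 r t * u 1 r t)"
  let ?Q = "\<lambda>r t. a (S r t) * (e 1 r t * v 2 r t - e 2 r t * v 1 r t)"
  let ?K = "\<lambda>r t. (2 * a (S r t) + 2 * S r t * a' (S r t)) * (v 1 r t * u 2 r t - v 2 r t * u 1 r t)"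
  define P' where "P' r t = a' (S r t) * (2 * e 1 r t * v 1 r t + 2 * e 2 r t * v 2 r t)
      * (e 1 r t * u 2 r t - e 2 r t * u 1 r t)
      + a (S r t) * (v 1 r t * u 2 r t + e 1 r t * m 2 r t - (v 2 r t * u 1 r t + e 2 r t * m 1 r t))" for r t
  define Q' where "Q' r t = a' (S r t) * (2 * e 1 r t * u 1 r t + 2 * e 2 r t * u 2 r t)
      * (e 1 r t * v 2 r t - e 2 r t * v 1 r t)
      + a (S r t) * (u 1 r t * v 2 r t + e 1 r t * m 2 r t - (u 2 r t * v 1 r t + e 2 r t * m 1 r t))" for r t
  have dP: "((\<lambda>r. ?P r t) has_real_derivative P' r t) (at r)" if "r \<in> I" for r t
  proof -
    have "((\<lambda>r. S r t) has_real_derivative (2 * e 1 r t * v 1 r t + 2 * e 2 r t * v 2 r t)) (at r)"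
      unfolding S_def by (auto intro!: derivative_eq_intros er[OF that])
    from DERIV_chain2[OF a this] have
      A: "((\<lambda>r. a (S r t)) has_real_derivative a' (S r t) * (2 * e 1 r t * v 1 r t + 2 * e 2 r t * v 2 r t)) (at r)" .
    show ?thesis unfolding P'_def
      by (rule derivative_eq_intros A er[OF that] ur[OF that] refl)+ (simp add: algebra_simps)
  qed
  have dQ: "(?Q r has_real_derivative Q' r t) (at t)" for t
  proof -
    have "(S r has_real_derivative (2 * e 1 r t * u 1 r t + 2 * e 2 r t * u 2 r t)) (at t)"
      unfolding S_def by (auto intro!: derivative_eq_intros et[OF r])
    from DERIV_chain2[OF a this] have
      A: "((\<lambda>t. a (S r t)) has_real_derivative a' (S r t) * (2 * e 1 r t * u 1 r t + 2 * e 2 r t * u 2 r t)) (at t)" .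
    show ?thesis unfolding Q'_def
      by (rule derivative_eq_intros A et[OF r] vt[OF r] refl)+ (simp add: algebra_simps)
  qed
  have caa: "continuous_on UNIV a" by (meson a DERIV_isCont continuous_at_imp_continuous_on)
  have cS: "continuous_on (I \<times> UNIV) (\<lambda>x. S (fst x) (snd x))"
    unfolding S_def by (intro continuous_intros ce)
  have cA: "continuous_on (I \<times> UNIV) (\<lambda>x. a (S (fst x) (snd x)))"
      "continuous_on (I \<times> UNIV) (\<lambda>x. a' (S (fst x) (snd x)))"
    by (rule continuous_on_compose2[OF caa cS] continuous_on_compose2[OF ca cS]; simp)+
  have cP': "continuous_on (I \<times> UNIV) (\<lambda>x. P' (fst x) (snd x))"
    unfolding P'_def by (intro continuous_intros ce cv cu cm cA)
  have slice: "continuous_on {0..2 * pi} (f r)"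
    if "continuous_on (I \<times> UNIV) (\<lambda>x. f (fst x) (snd x))" "r \<in> I" for f :: "real \<Rightarrow> real \<Rightarrow> real" and r
  proof -
    have "continuous_on {0..2 * pi} (\<lambda>t. (r, t))" by (intro continuous_intros)
    from continuous_on_compose2[OF that(1) this] show ?thesis using that(2) by auto
  qed
  have "((\<lambda>r. integral (cbox 0 (2 * pi)) (?P r)) has_real_derivative integral (cbox 0 (2 * pi)) (P' r))
      (at r within I)"
  proof (rule leibniz_rule_field_derivative[OF _ _ _ r I(2)])
    show "((\<lambda>r. ?P r t) has_real_derivative P' r t) (at r within I)" if "r \<in> I" for r t
      using dP[OF that] by (rule has_field_derivative_at_within)
    have cP: "continuous_on (I \<times> UNIV) (\<lambda>x. ?P (fst x) (snd x))"
      by (intro continuous_intros ce cu cA)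
    show "?P r integrable_on cbox 0 (2 * pi)" if "r \<in> I" for r
      using slice[of ?P, OF cP that] by (simp add: integrable_continuous_real)
    show "continuous_on (I \<times> cbox 0 (2 * pi)) (\<lambda>(x, t). P' x t)"
      unfolding case_prod_beta' by (rule continuous_on_subset[OF cP']) auto
  qed
  moreover have "integral {0..2 * pi} (P' r) = integral {0..2 * pi} (?K r)"
  proof -
    have "(Q' r has_integral (?Q r (2 * pi) - ?Q r 0)) {0..2 * pi}"
      using dQ by (intro fundamental_theorem_of_calculus)
        (auto simp: has_real_derivative_iff_has_vector_derivative[symmetric] has_field_derivative_at_within)
    moreover have "?Q r (2 * pi) - ?Q r 0 = 0" using per r by (simp add: S_def)
    ultimately have Q0: "(Q' r has_integral 0) {0..2 * pi}" by metis
    have "(P' r has_integral integral {0..2 * pi} (P' r)) {0..2 * pi}"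
      using slice[OF cP' r] by (intro integrable_integral integrable_continuous_real)
    from has_integral_diff[OF this Q0]
    have "((\<lambda>t. P' r t - Q' r t) has_integral integral {0..2 * pi} (P' r)) {0..2 * pi}" by simp
    moreover have "P' r t - Q' r t = ?K r t" for t
      unfolding P'_def Q'_def S_def by (simp add: algebra_simps power2_eq_square)
    ultimately show ?thesis by (simp add: integral_unique)
  qed
  ultimately show ?thesis by (simp only: at_within_open[OF r I(1)] cbox_interval)
qed

text \<open>The weight \<open>s \<mapsto> s * angle_weight d s\<close> is a \<open>C\<^sup>1\<close> nondecreasing function equal to \<open>1\<close> beyond \<open>d\<close>.\<close>

definition angle_weight :: "real \<Rightarrow> real \<Rightarrow> real" where
  "angle_weight d s = (if s \<le> d then 2 / d - s / d\<^sup>2 else 1 / s)"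

definition angle_weight_deriv :: "real \<Rightarrow> real \<Rightarrow> real" where
  "angle_weight_deriv d s = (if s \<le> d then - 1 / d\<^sup>2 else - 1 / s\<^sup>2)"

text \<open>The branches meet at \<open>d\<close> with common value \<open>1 / d\<close> and common
  slope \<open>- 1 / d\<^sup>2\<close>.\<close>

lemma angle_weight_has_derivative:
  assumes "d > 0"
  shows "(angle_weight d has_real_derivative angle_weight_deriv d s) (at s)"
proof -
  have "((\<lambda>s. if s \<in> {..d} then 2 / d - s / d\<^sup>2 else 1 / s) has_vector_derivative
     (if s \<in> {..d} then - 1 / d\<^sup>2 else - 1 / s\<^sup>2)) (at s within UNIV)"
    by (rule has_vector_derivative_If_within_closures[of s "{..d}" "{d<..}"])
      (use assms in \<open>auto simp: has_real_derivative_iff_has_vector_derivative[symmetric] power2_eq_square field_simps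
        intro!: derivative_eq_intros\<close>)
  then show ?thesis
    by (simp add: has_real_derivative_iff_has_vector_derivative angle_weight_def[abs_def] angle_weight_deriv_def)
qed

lemma angle_weight_deriv_continuous:
  assumes "d > 0"
  shows "continuous_on UNIV (angle_weight_deriv d)"
proof -
  have "continuous_on ({..d} \<union> {d..}) (\<lambda>s. if s \<le> d then - 1 / d\<^sup>2 else - 1 / s\<^sup>2)"
    by (rule continuous_on_If) (use assms in \<open>auto intro!: continuous_intros\<close>)
  moreover have "{..d} \<union> {d..} = UNIV" by auto
  ultimately show ?thesis by (simp add: angle_weight_deriv_def[abs_def])
qed

text \<open>Twice the derivative of \<open>s * angle_weight d s\<close>. Up to \<open>d\<close> this
  product is \<open>1 - (1 - s / d)\<^sup>2\<close>, a parabola with vertex at \<open>d\<close>,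
  where the constant 1 takes over.\<close>

lemma angle_weight_sum:
  assumes "d > 0"
  shows "2 * angle_weight d s + 2 * s * angle_weight_deriv d s = (if s \<le> d then 4 * (d - s) / d\<^sup>2 else 0)"
  using assms by (simp add: angle_weight_def angle_weight_deriv_def field_simps power2_eq_square)

lemma angle_weight_eq: "d > 0 \<Longrightarrow> d \<le> s \<Longrightarrow> angle_weight d s = 1 / s"
  by (auto simp: angle_weight_def field_simps power2_eq_square)

section \<open>Circles and the smoothed angle form along them\<close>

definition circ :: "real^2 \<Rightarrow> real \<Rightarrow> real \<Rightarrow> real^2" where
  "circ p r t = p + r *\<^sub>R polar_vec t"

lemma polar_vec_nth [simp]: "polar_vec t $ 1 = cos t" "polar_vec t $ 2 = sin t"
  by (simp_all add: polar_vec_def)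

lemma vec2_eqI: "x $ 1 = y $ 1 \<Longrightarrow> x $ 2 = y $ 2 \<Longrightarrow> x = (y :: 'a^2)"
  by (simp add: vec_eq_iff forall_2)

lemma polar_vec_axes: "polar_vec t = cos t *\<^sub>R axis 1 1 + sin t *\<^sub>R axis 2 1"
  by (rule vec2_eqI) (simp_all add: axis_def)

lemma norm_vec2: "norm (x :: real^2) = sqrt ((x $ 1)\<^sup>2 + (x $ 2)\<^sup>2)"
  by (simp add: norm_vec_def L2_set_def sum_2)

lemma norm_polar_vec [simp]: "norm (polar_vec t) = 1"
  by (simp add: norm_vec2)

lemma polar_vec_2pi [simp]: "polar_vec (2 * pi) = polar_vec 0"
  by (rule vec2_eqI) simp_all

lemma circ_2pi [simp]: "circ p r (2 * pi) = circ p r 0"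
  by (simp add: circ_def)

lemma dist_circ [simp]: "dist p (circ p r t) = \<bar>r\<bar>" "dist (circ p r t) p = \<bar>r\<bar>"
  by (simp_all add: circ_def dist_norm)

lemma circ_neq: "r > 0 \<Longrightarrow> circ p r t \<noteq> p"
  by (metis abs_of_pos dist_circ(1) dist_self less_irrefl)

lemma ex_circ:
  assumes "x \<noteq> p"
  obtains t where "t \<in> {0..2 * pi}" "x = circ p (dist x p) t"
proof -
  let ?y = "(1 / dist x p) *\<^sub>R (x - p)"
  have n: "norm ?y = 1" using assms by (simp add: dist_norm)
  then have "(?y $ 1)\<^sup>2 + (?y $ 2)\<^sup>2 = 1" by (simp add: norm_vec2 del: vector_scaleR_component)
  then obtain t where t: "0 \<le> t" "t < 2 * pi" "?y $ 1 = cos t" "?y $ 2 = sin t"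
    using sincos_total_2pi by metis
  then have "?y = polar_vec t" by (intro vec2_eqI) simp_all
  then have "x = circ p (dist x p) t" using assms by (simp add: circ_def flip: \<open>?y = polar_vec t\<close>)
  moreover have "t \<in> {0..2 * pi}" using t by simp
  ultimately show ?thesis using that by blast
qed

lemma continuous_on_circ [continuous_intros]:
  fixes r t :: "'a::t2_space \<Rightarrow> real"
  assumes "continuous_on S r" "continuous_on S t"
  shows "continuous_on S (\<lambda>x. circ p (r x) (t x))"
  unfolding circ_def polar_vec_axes
  by (intro continuous_intros continuous_on_cos continuous_on_sin assms)

lemma DERIV_circ_radius:
  fixes f :: "real^2 \<Rightarrow> real"
  assumes "f differentiable (at (circ p r t))"
  shows "((\<lambda>r. f (circ p r t)) has_real_derivative
    (cos t * partial_deriv 1 f (circ p r t) + sin t * partial_deriv 2 f (circ p r t))) (at r)"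
proof -
  have "((\<lambda>r. circ p r t) has_derivative (\<lambda>h. h *\<^sub>R polar_vec t)) (at r)"
    unfolding circ_def by (auto intro!: derivative_eq_intros)
  from has_derivative_compose[OF this has_derivative_partials2[OF assms]]
  show ?thesis by (rule has_derivative_imp_has_field_derivative) (simp add: algebra_simps)
qed

lemma DERIV_circ_angle:
  fixes f :: "real^2 \<Rightarrow> real"
  assumes "f differentiable (at (circ p r t))"
  shows "((\<lambda>t. f (circ p r t)) has_real_derivative
    (r * (cos t * partial_deriv 2 f (circ p r t) - sin t * partial_deriv 1 f (circ p r t)))) (at t)"
proof -
  have "((\<lambda>t. circ p r t) has_derivative (\<lambda>h. h *\<^sub>R (r *\<^sub>R (- sin t *\<^sub>R axis 1 1 + cos t *\<^sub>R axis 2 1)))) (at t)"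
    unfolding circ_def polar_vec_axes
    by (auto intro!: derivative_eq_intros simp: algebra_simps)
  from has_derivative_compose[OF this has_derivative_partials2[OF assms]]
  show ?thesis by (rule has_derivative_imp_has_field_derivative) (simp add: axis_def algebra_simps)
qed

definition planar_jacobian :: "(real^2 \<Rightarrow> real) \<Rightarrow> (real^2 \<Rightarrow> real) \<Rightarrow> real^2 \<Rightarrow> real" where
  "planar_jacobian f g x = partial_deriv 1 f x * partial_deriv 2 g x - partial_deriv 2 f x * partial_deriv 1 g x"

text \<open>The smoothed \<open>d arg\<close> of \<open>f + \<i> g\<close> along the circle. Unlike
  the turning number it stays meaningful and differentiable in \<open>r\<close> when the circle
  meets zeros, so it can compare circles with zeros between them.\<close>

definition circ_angle_integral ::
  "(real^2 \<Rightarrow> real) \<Rightarrow> (real^2 \<Rightarrow> real) \<Rightarrow> real^2 \<Rightarrow> real \<Rightarrow> real \<Rightarrow> real" where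
  "circ_angle_integral f g p d r = integral {0..2 * pi} (\<lambda>t. let x = circ p r t in
     angle_weight d ((f x)\<^sup>2 + (g x)\<^sup>2) *
     (f x * (r * (cos t * partial_deriv 2 g x - sin t * partial_deriv 1 g x))
      - g x * (r * (cos t * partial_deriv 2 f x - sin t * partial_deriv 1 f x))))"

lemma circ_angle_integral_0 [simp]: "circ_angle_integral f g p d 0 = 0"
  by (simp add: circ_angle_integral_def)

text \<open>The Jacobian enters the derivative with a nonnegative weight supported where
  \<open>f\<^sup>2 + g\<^sup>2\<close> is at most \<open>d\<close>. So a sign of the Jacobian gives
  monotonicity in the radius.\<close>

lemma circ_angle_integral_has_derivative:
  assumes U: "open U" "ball p R \<subseteq> U" and f: "smooth_on U f" and g: "smooth_on U g"
    and d: "d > 0" and r: "\<bar>r\<bar> < R"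
  shows "(circ_angle_integral f g p d has_real_derivative
     integral {0..2 * pi} (\<lambda>t. let s = (f (circ p r t))\<^sup>2 + (g (circ p r t))\<^sup>2 in
       (if s \<le> d then 4 * (d - s) / d\<^sup>2 else 0) * (r * planar_jacobian f g (circ p r t)))) (at r)"
proof -
  let ?h = "\<lambda>i::2. if i = 1 then f else g"
  let ?I = "{- R<..<R}"
  let ?e = "\<lambda>i r t. ?h i (circ p r t)"
  let ?v = "\<lambda>i r t. cos t * partial_deriv 1 (?h i) (circ p r t) + sin t * partial_deriv 2 (?h i) (circ p r t)"
  let ?w = "\<lambda>i r t. cos t * partial_deriv 2 (?h i) (circ p r t) - sin t * partial_deriv 1 (?h i) (circ p r t)"
  let ?u = "\<lambda>i r t. r * ?w i r t"
  let ?H = "\<lambda>i j k r t. partial_deriv j (partial_deriv k (?h i)) (circ p r t)"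
  let ?m = "\<lambda>i r t. ?w i r t + r * (cos t * (cos t * ?H i 1 2 r t + sin t * ?H i 2 2 r t)
      - sin t * (cos t * ?H i 1 1 r t + sin t * ?H i 2 1 r t))"
  have inU: "circ p r t \<in> U" if "r \<in> ?I" for r t
    using that U(2) by (auto simp: subset_iff)
  have h: "smooth_on U (?h i)" for i using f g by simp
  have h': "smooth_on U (partial_deriv j (?h i))" "smooth_on U (partial_deriv k (partial_deriv j (?h i)))" for i j k
    using h smooth_on_partial_deriv by blast+
  note D = smooth_on_differentiable[OF h inU] smooth_on_differentiable[OF h'(1) inU]
  have cont: "continuous_on (?I \<times> UNIV) (\<lambda>x. q (circ p (fst x) (snd x)))"
    if "smooth_on U q" for q :: "real^2 \<Rightarrow> real"
  proof (rule continuous_on_compose2[OF smooth_on_continuous[OF that]])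
    show "continuous_on (?I \<times> UNIV) (\<lambda>x. circ p (fst x) (snd x))" by (intro continuous_intros)
    show "(\<lambda>x. circ p (fst x) (snd x)) ` (?I \<times> UNIV) \<subseteq> U" using inU by (auto simp del: greaterThanLessThan_iff)
  qed
  note C = cont[OF h] cont[OF h'(1)] cont[OF h'(2)]
  have comm: "?H i 2 1 r t = ?H i 1 2 r t" if "r \<in> ?I" for i r t
    using partial_deriv_commute_real[OF U(1) h inU[OF that]] by blast
  have "((\<lambda>r. integral {0..2 * pi} (\<lambda>t. angle_weight d ((?e 1 r t)\<^sup>2 + (?e 2 r t)\<^sup>2) *
       (?e 1 r t * ?u 2 r t - ?e 2 r t * ?u 1 r t)))
     has_real_derivative
       integral {0..2 * pi} (\<lambda>t. (2 * angle_weight d ((?e 1 r t)\<^sup>2 + (?e 2 r t)\<^sup>2)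
         + 2 * ((?e 1 r t)\<^sup>2 + (?e 2 r t)\<^sup>2) * angle_weight_deriv d ((?e 1 r t)\<^sup>2 + (?e 2 r t)\<^sup>2))
         * (?v 1 r t * ?u 2 r t - ?v 2 r t * ?u 1 r t))) (at r)"
  proof (rule has_derivative_angle_integral[where I = ?I and m = ?m])
    show "((\<lambda>r. ?e i r t) has_real_derivative ?v i r t) (at r)" if "r \<in> ?I" for i r t
      using DERIV_circ_radius[OF D(1)[OF that]] .
    show "((\<lambda>t. ?e i r t) has_real_derivative ?u i r t) (at t)" if "r \<in> ?I" for i r t
      using DERIV_circ_angle[OF D(1)[OF that]] .
    show "((\<lambda>r. ?u i r t) has_real_derivative ?m i r t) (at r)" if "r \<in> ?I" for i r t
      by (rule derivative_eq_intros refl DERIV_circ_radius[OF D(2)[OF that]])+ (simp add: algebra_simps)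
    show "((\<lambda>t. ?v i r t) has_real_derivative ?m i r t) (at t)" if "r \<in> ?I" for i r t
      by (rule derivative_eq_intros refl DERIV_circ_angle[OF D(2)[OF that]])+
        (simp add: comm[OF that] algebra_simps)
    show "continuous_on (?I \<times> UNIV) (\<lambda>x. ?e i (fst x) (snd x))" for i using C by blast
    show "continuous_on (?I \<times> UNIV) (\<lambda>x. ?v i (fst x) (snd x))" for i by (intro continuous_intros C)
    show "continuous_on (?I \<times> UNIV) (\<lambda>x. ?u i (fst x) (snd x))" for i by (intro continuous_intros C)
    show "continuous_on (?I \<times> UNIV) (\<lambda>x. ?m i (fst x) (snd x))" for i by (intro continuous_intros C)
  qed (use r d in \<open>auto intro: angle_weight_has_derivative angle_weight_deriv_continuous\<close>)
  note deriv = this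
  have "(2 * angle_weight d ((?e 1 r t)\<^sup>2 + (?e 2 r t)\<^sup>2)
         + 2 * ((?e 1 r t)\<^sup>2 + (?e 2 r t)\<^sup>2) * angle_weight_deriv d ((?e 1 r t)\<^sup>2 + (?e 2 r t)\<^sup>2))
         * (?v 1 r t * ?u 2 r t - ?v 2 r t * ?u 1 r t) =
      (let s = (f (circ p r t))\<^sup>2 + (g (circ p r t))\<^sup>2 in
       (if s \<le> d then 4 * (d - s) / d\<^sup>2 else 0) * (r * planar_jacobian f g (circ p r t)))" for t
  proof -
    have "(c * a + s * b) * (r * (c * d - s * e)) - (c * e + s * d) * (r * (c * b - s * a))
      = r * (c * c + s * s) * (a * d - b * e)" for c s a b d e :: real
      by (simp add: algebra_simps)
    then have "?v 1 r t * ?u 2 r t - ?v 2 r t * ?u 1 r t = r * planar_jacobian f g (circ p r t)"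
      by (simp add: planar_jacobian_def)
    then show ?thesis unfolding angle_weight_sum[OF d] Let_def by simp
  qed
  from deriv[unfolded this] show ?thesis
    by (simp add: circ_angle_integral_def[abs_def] Let_def)
qed

definition circ_loop :: "(real^2 \<Rightarrow> real) \<Rightarrow> (real^2 \<Rightarrow> real) \<Rightarrow> real^2 \<Rightarrow> real \<Rightarrow> real \<Rightarrow> complex" where
  "circ_loop f g p r t = Complex (f (circ p r t)) (g (circ p r t))"

lemma circ_loop_closed [simp]: "circ_loop f g p r (2 * pi) = circ_loop f g p r 0"
  by (simp add: circ_loop_def)

lemma continuous_on_circ_loop:
  assumes "continuous_on S f" "continuous_on S g" "\<And>t. t \<in> {0..2 * pi} \<Longrightarrow> circ p r t \<in> S"
  shows "continuous_on {0..2 * pi} (circ_loop f g p r)"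
  unfolding circ_loop_def Complex_eq
  by (intro continuous_intros continuous_on_compose2[OF assms(1)] continuous_on_compose2[OF assms(2)])
    (use assms(3) in auto)

lemma loop_circ_loop:
  assumes "continuous_on S f" "continuous_on S g" "\<And>t. t \<in> {0..2 * pi} \<Longrightarrow> circ p r t \<in> S"
    "\<And>t. t \<in> {0..2 * pi} \<Longrightarrow> f (circ p r t) \<noteq> 0 \<or> g (circ p r t) \<noteq> 0"
  shows "loop (circ_loop f g p r)"
  using continuous_on_circ_loop[OF assms(1,2,3)] assms(4)
  by (auto simp: loop_def circ_loop_def complex_eq_iff)

text \<open>Where \<open>f\<^sup>2 + g\<^sup>2\<close> is at least \<open>d\<close>, the weight is
  its reciprocal and the integrand becomes the imaginary part of \<open>c' / c\<close>.\<close>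

lemma circ_angle_integral_eq_turning:
  assumes U: "open U" "ball p R \<subseteq> U" and f: "smooth_on U f" and g: "smooth_on U g"
    and d: "d > 0" and r: "\<bar>r\<bar> < R"
    and ge: "\<And>t. t \<in> {0..2 * pi} \<Longrightarrow> d \<le> (f (circ p r t))\<^sup>2 + (g (circ p r t))\<^sup>2"
  shows "circ_angle_integral f g p d r = 2 * pi * turning (circ_loop f g p r)"
proof -
  have inU: "circ p r t \<in> U" for t using r U(2) by (auto simp: subset_iff)
  let ?T = "\<lambda>h t. r * (cos t * partial_deriv 2 h (circ p r t) - sin t * partial_deriv 1 h (circ p r t))"
  let ?c = "circ_loop f g p r"
  have l: "loop ?c"
  proof (rule loop_circ_loop)
    show "f (circ p r t) \<noteq> 0 \<or> g (circ p r t) \<noteq> 0" if "t \<in> {0..2 * pi}" for t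
      using ge[OF that] d by auto
  qed (use f g inU smooth_on_continuous in blast)+
  have cont: "continuous_on {0..2 * pi} (\<lambda>t. q (circ p r t))"
    if "smooth_on U q" for q :: "real^2 \<Rightarrow> real"
    by (rule continuous_on_compose2[OF smooth_on_continuous[OF that]])
      (use inU in \<open>auto intro!: continuous_intros\<close>)
  have "turning ?c = integral {0..2 * pi} (\<lambda>t. Im (Complex (?T f t) (?T g t) / ?c t)) / (2 * pi)"
  proof (rule turning_integral[OF l])
    fix t
    have "((\<lambda>t. f (circ p r t)) has_real_derivative ?T f t) (at t within {0..2 * pi})"
      "((\<lambda>t. g (circ p r t)) has_real_derivative ?T g t) (at t within {0..2 * pi})"
      using DERIV_circ_angle[OF smooth_on_differentiable[OF f inU]]
        DERIV_circ_angle[OF smooth_on_differentiable[OF g inU]]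
      by (auto intro: has_field_derivative_at_within)
    then show "(?c has_vector_derivative Complex (?T f t) (?T g t)) (at t within {0..2 * pi})"
      unfolding has_vector_derivative_complex_iff circ_loop_def by simp
    show "continuous_on {0..2 * pi} (\<lambda>t. Complex (?T f t) (?T g t))"
      unfolding Complex_eq
      by (intro continuous_intros cont smooth_on_partial_deriv f g)
  qed
  also have "integral {0..2 * pi} (\<lambda>t. Im (Complex (?T f t) (?T g t) / ?c t)) = circ_angle_integral f g p d r"
    unfolding circ_angle_integral_def
  proof (rule integral_cong)
    fix t assume t: "t \<in> {0..2 * pi}"
    show "Im (Complex (?T f t) (?T g t) / ?c t) = (let x = circ p r t in
     angle_weight d ((f x)\<^sup>2 + (g x)\<^sup>2) *
     (f x * (r * (cos t * partial_deriv 2 g x - sin t * partial_deriv 1 g x))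
      - g x * (r * (cos t * partial_deriv 2 f x - sin t * partial_deriv 1 f x))))"
      unfolding Let_def angle_weight_eq[OF d ge[OF t]] by (simp add: Im_divide circ_loop_def mult.commute)
  qed
  finally show ?thesis by simp
qed

text \<open>The Jacobian may vanish at the center, so zeros could a priori accumulate there and the
  inverse function theorem says nothing. The aim is to exclude this and to bound the turning number
  from below.\<close>

locale orientation_preserving_off_center =
  fixes U :: "(real^2) set" and p :: "real^2" and R :: real and f g :: "real^2 \<Rightarrow> real"
  assumes U: "open U" "ball p R \<subseteq> U" and f: "smooth_on U f" and g: "smooth_on U g"
    and R: "R > 0" and zero: "f p = 0" "g p = 0"
    and jac: "\<And>x. x \<in> ball p R \<Longrightarrow> x \<noteq> p \<Longrightarrow> planar_jacobian f g x > 0"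
begin

definition good :: "real \<Rightarrow> bool" where
  "good r \<longleftrightarrow> 0 < r \<and> r < R \<and> (\<forall>t\<in>{0..2 * pi}. f (circ p r t) \<noteq> 0 \<or> g (circ p r t) \<noteq> 0)"

abbreviation "W \<equiv> circ_angle_integral f g p"

lemma circ_in_U: "\<bar>r\<bar> < R \<Longrightarrow> circ p r t \<in> U"
  using U(2) by (auto simp: subset_iff)

lemma continuous_on_circle:
  assumes "smooth_on U q" "\<bar>r\<bar> < R"
  shows "continuous_on {0..2 * pi} (\<lambda>t. q (circ p r t))"
  by (rule continuous_on_compose2[OF smooth_on_continuous[OF assms(1)]])
    (use circ_in_U[OF assms(2)] in \<open>auto intro!: continuous_intros\<close>)

lemma W_integrand:
  assumes "d > 0" "0 < r" "r < R"
  defines "k \<equiv> \<lambda>t. let s = (f (circ p r t))\<^sup>2 + (g (circ p r t))\<^sup>2 in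
       (if s \<le> d then 4 * (d - s) / d\<^sup>2 else 0) * (r * planar_jacobian f g (circ p r t))"
  shows "continuous_on {0..2 * pi} k" "\<And>t. 0 \<le> k t"
    "\<And>t. (f (circ p r t))\<^sup>2 + (g (circ p r t))\<^sup>2 < d \<Longrightarrow> 0 < k t"
proof -
  have J: "0 < planar_jacobian f g (circ p r t)" for t
    using jac circ_neq assms by simp
  \<comment> \<open>Written with \<open>max 0\<close>, the cut-off is visibly continuous.\<close>
  have "k = (\<lambda>t. (4 * max 0 (d - ((f (circ p r t))\<^sup>2 + (g (circ p r t))\<^sup>2)) / d\<^sup>2) * (r * planar_jacobian f g (circ p r t)))"
    by (auto simp: k_def Let_def max_def)
  moreover have c: "continuous_on {0..2 * pi} (\<lambda>t. q (circ p r t))" if "smooth_on U q" for q :: "real^2 \<Rightarrow> real"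
    using continuous_on_circle[OF that] assms(2,3) by simp
  note c = c[OF f] c[OF g] c[OF smooth_on_partial_deriv[OF f]] c[OF smooth_on_partial_deriv[OF g]]
  have "continuous_on {0..2 * pi}
      (\<lambda>t. (4 * max 0 (d - ((f (circ p r t))\<^sup>2 + (g (circ p r t))\<^sup>2)) / d\<^sup>2) * (r * planar_jacobian f g (circ p r t)))"
    unfolding planar_jacobian_def using assms(1) by (intro continuous_intros c) auto
  ultimately show "continuous_on {0..2 * pi} k" by simp
  show "0 \<le> k t" for t
    using J[of t] assms(1-3) by (auto simp: k_def Let_def intro!: mult_nonneg_nonneg divide_nonneg_nonneg)
  show "0 < k t" if "(f (circ p r t))\<^sup>2 + (g (circ p r t))\<^sup>2 < d" for t
    using J[of t] assms(1-3) that by (auto simp: k_def Let_def intro!: mult_pos_pos divide_pos_pos)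
qed

lemma W_has_derivative_nonneg:
  assumes "d > 0" "0 \<le> r" "r < R"
  shows "\<exists>y. (W d has_real_derivative y) (at r) \<and> 0 \<le> y"
proof (cases "r = 0")
  case True
  \<comment> \<open>The area factor \<open>r\<close> is 0 here, so the Jacobian at the center, whose
    sign is unknown, drops out.\<close>
  show ?thesis
    using circ_angle_integral_has_derivative[OF U f g assms(1), of 0] R unfolding True
    by (intro exI[of _ 0]) (simp add: Let_def)
next
  case False
  then have r: "0 < r" using assms by simp
  show ?thesis
    using circ_angle_integral_has_derivative[OF U f g assms(1), of r]
      W_integrand[OF assms(1) r assms(3)] r assms(3)
    by (auto intro!: exI conjI integral_nonneg integrable_continuous_real)
qed

lemma W_mono:
  assumes "d > 0" "0 \<le> r1" "r1 \<le> r2" "r2 < R"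
  shows "W d r1 \<le> W d r2"
  using assms W_has_derivative_nonneg[OF assms(1)]
  by (intro DERIV_nonneg_imp_nondecreasing[OF assms(3)]) auto

text \<open>At radius \<open>r\<close> the integrand is continuous, nonnegative, and positive at
  \<open>t\<close>, so \<open>W d\<close> has positive slope there; monotonicity carries the gain to
  \<open>r2\<close>.\<close>

lemma W_strict_mono:
  assumes "d > 0" "0 \<le> r1" "r1 < r" "r < r2" "r2 < R"
    and t: "t \<in> {0..2 * pi}" "(f (circ p r t))\<^sup>2 + (g (circ p r t))\<^sup>2 < d"
  shows "W d r1 < W d r2"
proof -
  have r: "0 < r" "r < R" using assms by auto
  let ?k = "\<lambda>t. let s = (f (circ p r t))\<^sup>2 + (g (circ p r t))\<^sup>2 in
       (if s \<le> d then 4 * (d - s) / d\<^sup>2 else 0) * (r * planar_jacobian f g (circ p r t))"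
  note k = W_integrand[OF assms(1) r]
  have "integral {0..2 * pi} ?k \<noteq> 0"
    using integral_eq_0_iff[OF k(1) _ k(2)] k(3)[OF t(2)] t(1) by force
  moreover have "0 \<le> integral {0..2 * pi} ?k"
    using k by (intro integral_nonneg integrable_continuous_real)
  ultimately have pos: "0 < integral {0..2 * pi} ?k" by linarith
  have "(W d has_real_derivative integral {0..2 * pi} ?k) (at r)"
    using circ_angle_integral_has_derivative[OF U f g assms(1), of r] r by simp
  from DERIV_pos_inc_right[OF this pos] obtain e where
    e: "e > 0" "\<And>h. 0 < h \<Longrightarrow> h < e \<Longrightarrow> W d r < W d (r + h)" by blast
  define h where "h = min (e / 2) (r2 - r)"
  have h: "0 < h" "h < e" "r + h \<le> r2" using e assms by (auto simp: h_def)
  have "W d r1 \<le> W d r" using assms by (intro W_mono) auto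
  also have "\<dots> < W d (r + h)" using e h by blast
  also have "\<dots> \<le> W d r2" using assms h r by (intro W_mono) auto
  finally show ?thesis .
qed

lemma loop_good: "good r \<Longrightarrow> loop (circ_loop f g p r)"
  using f g smooth_on_continuous circ_in_U[of r]
  by (intro loop_circ_loop[of U]) (auto simp: good_def)

lemma good_lower_bound:
  assumes "good r"
  obtains d where "d > 0" "\<And>t. t \<in> {0..2 * pi} \<Longrightarrow> d \<le> (f (circ p r t))\<^sup>2 + (g (circ p r t))\<^sup>2"
proof -
  have "continuous_on {0..2 * pi} (\<lambda>t. (f (circ p r t))\<^sup>2 + (g (circ p r t))\<^sup>2)"
    using assms by (intro continuous_intros continuous_on_circle f g) (auto simp: good_def)
  from continuous_attains_inf[OF _ _ this] obtain t0 where t0: "t0 \<in> {0..2 * pi}"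
    "\<And>t. t \<in> {0..2 * pi} \<Longrightarrow>
      (f (circ p r t0))\<^sup>2 + (g (circ p r t0))\<^sup>2 \<le> (f (circ p r t))\<^sup>2 + (g (circ p r t))\<^sup>2"
    by auto
  have "0 < (f (circ p r t0))\<^sup>2 + (g (circ p r t0))\<^sup>2"
    using assms t0(1) by (auto simp: good_def sum_power2_gt_zero_iff)
  then show ?thesis using that t0 by blast
qed

lemma W_good:
  assumes "good r"
  obtains d0 where "d0 > 0" "\<And>d. 0 < d \<Longrightarrow> d \<le> d0 \<Longrightarrow> W d r = 2 * pi * turning (circ_loop f g p r)"
proof -
  obtain d where d: "d > 0" "\<And>t. t \<in> {0..2 * pi} \<Longrightarrow> d \<le> (f (circ p r t))\<^sup>2 + (g (circ p r t))\<^sup>2"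
    using good_lower_bound[OF assms] by blast
  show ?thesis
  proof (rule that[OF d(1)])
    fix e assume e: "0 < e" "e \<le> d"
    show "W e r = 2 * pi * turning (circ_loop f g p r)"
      by (rule circ_angle_integral_eq_turning[OF U f g e(1)])
        (use assms d(2) e in \<open>force simp: good_def\<close>)+
  qed
qed

text \<open>\<open>W d\<close> vanishes at radius 0 and grows strictly, since \<open>f\<close> and
  \<open>g\<close> become small towards the center. So the turning number is positive, and it is an
  integer.\<close>

lemma turning_good_pos:
  assumes "good r"
  shows "turning (circ_loop f g p r) \<ge> 1"
proof -
  obtain d where d: "d > 0" "W d r = 2 * pi * turning (circ_loop f g p r)"
    using W_good[OF assms] by (metis order_refl)
  have r: "0 < r" "r < R" using assms by (auto simp: good_def)
  have "continuous_on {-R<..<R} (\<lambda>r. (f (circ p r 0))\<^sup>2 + (g (circ p r 0))\<^sup>2)"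
    by (intro continuous_intros continuous_on_compose2[OF smooth_on_continuous[OF f]]
        continuous_on_compose2[OF smooth_on_continuous[OF g]]) (auto intro!: circ_in_U)
  then have "isCont (\<lambda>r. (f (circ p r 0))\<^sup>2 + (g (circ p r 0))\<^sup>2) 0"
    using R by (simp add: continuous_on_eq_continuous_at)
  moreover have "(f (circ p 0 0))\<^sup>2 + (g (circ p 0 0))\<^sup>2 = 0" using zero by (simp add: circ_def)
  ultimately obtain e where e: "e > 0"
    "\<And>r. dist r 0 < e \<Longrightarrow> dist ((f (circ p r 0))\<^sup>2 + (g (circ p r 0))\<^sup>2) 0 < d"
    unfolding continuous_at_eps_delta using d(1) by metis
  define r' where "r' = min e r / 2"
  have r': "0 < r'" "r' < r" "r' < e" using e r by (auto simp: r'_def)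
  have "W d 0 < W d r"
    by (rule W_strict_mono[of d 0 r' r 0]) (use r r' e(2)[of r'] d in \<open>auto simp: dist_real_def\<close>)
  then have "0 < turning (circ_loop f g p r)" using d by (simp add: zero_less_mult_iff)
  moreover obtain n :: int where "turning (circ_loop f g p r) = of_int n"
    using turning_Ints[OF loop_good[OF assms]] by (auto elim: Ints_cases)
  ultimately show ?thesis by simp
qed

text \<open>One \<open>d\<close> small enough for both circles turns both values of
  \<open>W d\<close> into turning numbers; the zero between the circles forces strict
  growth.\<close>

lemma turning_good_strict_mono:
  assumes "good r1" "good r2" "r1 < r" "r < r2"
    and t: "t \<in> {0..2 * pi}" "f (circ p r t) = 0" "g (circ p r t) = 0"
  shows "turning (circ_loop f g p r1) < turning (circ_loop f g p r2)"
proof -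
  obtain d1 where d1: "d1 > 0" "\<And>d. 0 < d \<Longrightarrow> d \<le> d1 \<Longrightarrow> W d r1 = 2 * pi * turning (circ_loop f g p r1)"
    using W_good[OF assms(1)] by blast
  obtain d2 where d2: "d2 > 0" "\<And>d. 0 < d \<Longrightarrow> d \<le> d2 \<Longrightarrow> W d r2 = 2 * pi * turning (circ_loop f g p r2)"
    using W_good[OF assms(2)] by blast
  have "W (min d1 d2) r1 < W (min d1 d2) r2"
    by (rule W_strict_mono[of _ _ r _ t]) (use d1 d2 assms in \<open>auto simp: good_def\<close>)
  then show ?thesis using d1 d2 by simp
qed

text \<open>The derivative at \<open>z\<close> is invertible, hence bounded below by some
  \<open>B > 0\<close>, and near \<open>z\<close> the first-order remainder is at most half of that
  bound.\<close>

lemma zero_isolated_off_center: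
  assumes z: "z \<in> ball p R" "z \<noteq> p" "f z = 0" "g z = 0"
  shows "\<exists>e>0. \<forall>x\<in>ball z e. x \<noteq> z \<longrightarrow> f x \<noteq> 0 \<or> g x \<noteq> 0"
proof -
  have zU: "z \<in> U" using z U by blast
  let ?D = "\<lambda>v::real^2. (v $ 1 * partial_deriv 1 f z + v $ 2 * partial_deriv 2 f z,
                 v $ 1 * partial_deriv 1 g z + v $ 2 * partial_deriv 2 g z)"
  have D: "((\<lambda>x. (f x, g x)) has_derivative ?D) (at z)"
    using has_derivative_Pair[OF has_derivative_partials2[OF smooth_on_differentiable[OF f zU]]
        has_derivative_partials2[OF smooth_on_differentiable[OF g zU]]] by simp
  then have lin: "linear ?D" by (rule has_derivative_linear)
  have "v = 0" if v: "?D v = 0" for v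
  proof -
    let ?J = "planar_jacobian f g z"
    have J: "?J \<noteq> 0" using jac[OF z(1,2)] by simp
    have e: "v $ 1 * partial_deriv 1 f z + v $ 2 * partial_deriv 2 f z = 0"
      "v $ 1 * partial_deriv 1 g z + v $ 2 * partial_deriv 2 g z = 0"
      using v by (auto simp: zero_prod_def)
    have "?J * v $ 1 = partial_deriv 2 g z * (v $ 1 * partial_deriv 1 f z + v $ 2 * partial_deriv 2 f z)
      - partial_deriv 2 f z * (v $ 1 * partial_deriv 1 g z + v $ 2 * partial_deriv 2 g z)"
      "?J * v $ 2 = partial_deriv 1 f z * (v $ 1 * partial_deriv 1 g z + v $ 2 * partial_deriv 2 g z)
      - partial_deriv 1 g z * (v $ 1 * partial_deriv 1 f z + v $ 2 * partial_deriv 2 f z)"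
      by (simp_all add: planar_jacobian_def algebra_simps)
    then have "?J * v $ 1 = 0" "?J * v $ 2 = 0" unfolding e by simp_all
    then have "v $ 1 = 0" "v $ 2 = 0" using J by simp_all
    then show ?thesis by (intro vec2_eqI) simp_all
  qed
  then have "inj ?D" using linear_injective_0[OF lin] by blast
  from linear_inj_bounded_below_pos[OF lin this] obtain B where
    B: "B > 0" "\<And>v. B * norm v \<le> norm (?D v)" by blast
  have "B / 2 > 0" using B(1) by simp
  from D[unfolded has_derivative_at_alt, THEN conjunct2, rule_format, OF this] obtain e where e: "e > 0"
    "\<And>y. norm (y - z) < e \<Longrightarrow> norm ((f y, g y) - (f z, g z) - ?D (y - z)) \<le> B / 2 * norm (y - z)"
    by blast
  have "f x \<noteq> 0 \<or> g x \<noteq> 0" if x: "x \<in> ball z e" "x \<noteq> z" for x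
  proof (rule ccontr)
    assume c: "\<not> (f x \<noteq> 0 \<or> g x \<noteq> 0)"
    have "norm (x - z) < e" using x by (simp add: dist_norm norm_minus_commute)
    note e(2)[OF this]
    moreover have "(f x, g x) - (f z, g z) = 0" using c z by (simp add: zero_prod_def)
    ultimately have "norm (?D (x - z)) \<le> B / 2 * norm (x - z)"
      by (simp only: diff_0 norm_minus_cancel)
    moreover have "B / 2 * norm (x - z) < B * norm (x - z)" using B x by simp
    ultimately show False using B(2)[of "x - z"] by linarith
  qed
  then show ?thesis using e(1) by blast
qed

text \<open>Zeros in a compact annulus are isolated, hence finite in number, and spoil only finitely
  many radii.\<close>

lemma ex_good:
  assumes "0 < a" "a < b" "b < R"
  obtains r where "a < r" "r < b" "good r"
proof -
  let ?K = "cball p b - ball p a"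
  let ?Z = "{z \<in> ?K. f z = 0 \<and> g z = 0}"
  have K: "compact ?K" by (simp add: compact_diff)
  have KU: "?K \<subseteq> ball p R" using assms by auto
  have "finite ?Z"
  proof (rule ccontr)
    assume "infinite ?Z"
    then obtain z where z: "z \<in> ?K" "z islimpt ?Z"
      using K[unfolded compact_eq_Bolzano_Weierstrass] by blast
    have cont: "continuous_on ?K f" "continuous_on ?K g"
      using KU U f g smooth_on_continuous continuous_on_subset by (metis subset_trans)+
    have "closed {x \<in> ?K. f x = 0}" "closed {x \<in> ?K. g x = 0}"
      using cont K continuous_closed_preimage_constant compact_imp_closed by blast+
    then have "closed ({x \<in> ?K. f x = 0} \<inter> {x \<in> ?K. g x = 0})" by blast
    moreover have "{x \<in> ?K. f x = 0} \<inter> {x \<in> ?K. g x = 0} = ?Z" by auto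
    ultimately have "closed ?Z" by simp
    then have "z \<in> ?Z" using z(2) closed_limpt by blast
    moreover have "z \<noteq> p" "z \<in> ball p R" using z(1) assms by auto
    ultimately obtain e where e: "e > 0" "\<forall>x\<in>ball z e. x \<noteq> z \<longrightarrow> f x \<noteq> 0 \<or> g x \<noteq> 0"
      using zero_isolated_off_center[of z] by blast
    obtain x where x: "x \<in> ?Z" "x \<noteq> z" "dist x z < e"
      using z(2)[unfolded islimpt_approachable, rule_format, OF e(1)] by blast
    then have "x \<in> ball z e" by (simp add: dist_commute)
    then show False using e(2) x(1,2) by blast
  qed
  then have "finite (dist p ` ?Z)" by simp
  then have "infinite ({a<..<b} - dist p ` ?Z)"
    using assms(2) by (simp add: Diff_infinite_finite infinite_Ioo)
  then have "{a<..<b} - dist p ` ?Z \<noteq> {}" by (metis finite.emptyI)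
  then obtain r where "r \<in> {a<..<b} - dist p ` ?Z" by blast
  then have r: "a < r" "r < b" "r \<notin> dist p ` ?Z" 
    unfolding Diff_iff greaterThanLessThan_iff by blast+
  have "good r" unfolding good_def
  proof (intro conjI ballI)
    fix t :: real
    have "dist p (circ p r t) = r" using r assms by simp
    then have "circ p r t \<notin> ?Z" using r(3) by force
    then show "f (circ p r t) \<noteq> 0 \<or> g (circ p r t) \<noteq> 0" using r assms by auto
  qed (use r assms in auto)
  then show ?thesis using that r by blast
qed

text \<open>Otherwise zeros accumulate at the center, and the turning number, a positive integer, would
  drop strictly along an infinite sequence of shrinking good circles.\<close>

lemma center_isolated_zero:
  obtains r where "0 < r" "r < R" "\<And>x. dist x p \<le> r \<Longrightarrow> x \<noteq> p \<Longrightarrow> f x \<noteq> 0 \<or> g x \<noteq> 0"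
proof -
  let ?N = "\<lambda>r. nat \<lfloor>turning (circ_loop f g p r)\<rfloor>"
  obtain r0 where "good r0" using ex_good[of "R / 3" "R / 2"] R by auto
  \<comment> \<open>Descent in the form of a minimum: \<open>r\<close> has the least turning number
    among the good radii. Taking \<open>nat\<close> of the floor loses nothing, since these numbers
    are integers and at least 1.\<close>
  then obtain r where r: "good r" "\<And>s. good s \<Longrightarrow> ?N r \<le> ?N s"
    using ex_has_least_nat[of good r0 ?N] by blast
  have "f x \<noteq> 0 \<or> g x \<noteq> 0" if x: "dist x p \<le> r / 2" "x \<noteq> p" for x
  proof (rule ccontr)
    assume c: "\<not> (f x \<noteq> 0 \<or> g x \<noteq> 0)"
    obtain t where t: "t \<in> {0..2 * pi}" "x = circ p (dist x p) t" using ex_circ[OF x(2)] by blast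
    have r0: "0 < r" "r < R" using r(1) by (auto simp: good_def)
    have dx: "0 < dist x p" "dist x p < r" using x r0 by auto
    then obtain s where s: "s < dist x p" "good s"
      using ex_good[of "dist x p / 2" "dist x p"] r0 by auto
    have "turning (circ_loop f g p s) < turning (circ_loop f g p r)"
      using turning_good_strict_mono[OF s(2) r(1) s(1) dx(2) t(1)] c t(2) by auto
    moreover obtain m n :: int where mn:  "turning (circ_loop f g p s) = of_int m"
      "turning (circ_loop f g p r) = of_int n"
      using turning_Ints[OF loop_good] s(2) r(1) by (metis Ints_cases)
    ultimately have "m < n" by simp
    moreover have "1 \<le> m" using turning_good_pos[OF s(2)] mn(1) by simp
    ultimately have "?N s < ?N r" unfolding mn by simp
    then show False using r(2)[OF s(2)] by linarith
  qed
  moreover have "0 < r / 2" "r / 2 < R" using r(1) by (auto simp: good_def)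
  ultimately show ?thesis using that by blast
qed

end

subsection \<open>Turning of a gradient at a strict minimum\<close>

definition cpx :: "real^2 \<Rightarrow> complex" where
  "cpx v = Complex (v $ 1) (v $ 2)"

lemma cpx_simps [simp]:
  "cpx (v - w) = cpx v - cpx w" "cpx (v + w) = cpx v + cpx w" "cpx (- v) = - cpx v"
  "cpx (a *\<^sub>R v) = of_real a * cpx v" "cpx (polar_vec t) = cis t"
  by (simp_all add: cpx_def complex_eq_iff)

lemma cpx_eq_0 [simp]: "cpx v = 0 \<longleftrightarrow> v = 0"
  by (auto simp: cpx_def complex_eq_iff vec_eq_iff forall_2)

lemma cpx_inject: "cpx v = cpx w \<longleftrightarrow> v = w"
  by (auto simp: cpx_def complex_eq_iff vec_eq_iff forall_2)

lemma continuous_on_cpx [continuous_intros]: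
  "continuous_on S f \<Longrightarrow> continuous_on S (\<lambda>x. cpx (f x))"
  unfolding cpx_def Complex_eq by (intro continuous_intros)

text \<open>The Hessian at \<open>p\<close> may be degenerate, so the turning number of
  \<open>V\<close> cannot be found by linearization. A Lipschitz gradient is enough for gradient
  descent.\<close>

locale strict_minimum =
  fixes p :: "real^2" and R L :: real and \<phi> :: "real^2 \<Rightarrow> real" and V :: "real^2 \<Rightarrow> real^2"
  assumes R: "R > 0" and lip: "L-lipschitz_on (cball p R) V"
    and grad: "\<And>x. x \<in> cball p R \<Longrightarrow> (\<phi> has_derivative (\<lambda>v. V x \<bullet> v)) (at x)"
    and at_p: "\<phi> p = 0" "V p = 0"
    and pos: "\<And>x. x \<in> cball p R \<Longrightarrow> x \<noteq> p \<Longrightarrow> \<phi> x > 0"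
    and nz: "\<And>x. x \<in> cball p R \<Longrightarrow> x \<noteq> p \<Longrightarrow> V x \<noteq> 0"
begin

text \<open>The factor 2 yields \<open>step * L \<le> 1 / 2\<close>; the added 1 covers
  \<open>L = 0\<close>.\<close>

definition step :: real where "step = 1 / (2 * (L + 1))"

text \<open>The parameter \<open>u\<close> deforms the identity into a full gradient step.\<close>

definition T :: "real \<Rightarrow> real^2 \<Rightarrow> real^2" where
  "T u x = x - (u * step) *\<^sub>R V x"

lemma L_nonneg: "L \<ge> 0" using lip by (rule lipschitz_on_nonneg)

lemma step: "step > 0" "step * L \<le> 1 / 2"
  using L_nonneg by (auto simp: step_def field_simps)

lemma cont_V: "continuous_on (cball p R) V" using lip lipschitz_on_continuous_on by blast

lemma cont_\<phi>: "continuous_on (cball p R) \<phi>"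
  using grad by (meson continuous_at_imp_continuous_on has_derivative_continuous)

lemma norm_V_le: "x \<in> cball p R \<Longrightarrow> norm (V x) \<le> L * dist x p"
  using lipschitz_onD[OF lip, of x p] R at_p by (simp add: dist_norm)

text \<open>As \<open>V\<close> is Lipschitz and vanishes at \<open>p\<close>, a step moves
  \<open>x\<close> by at most half its distance to \<open>p\<close>.\<close>

lemma segment_in_cball:
  assumes "dist x p \<le> R / 2" "0 \<le> \<tau>" "\<tau> \<le> step"
  shows "x - \<tau> *\<^sub>R V x \<in> cball p R"
proof -
  have "x \<in> cball p R" using assms R by (simp add: dist_commute)
  then have "\<tau> * norm (V x) \<le> step * (L * dist x p)"
    using assms step norm_V_le by (intro mult_mono) auto
  also have "\<dots> \<le> 1 / 2 * dist x p"
    using step(2) by (metis mult.assoc mult_right_mono zero_le_dist)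
  finally have "\<tau> * norm (V x) \<le> R / 4" using assms(1) by simp
  moreover have "dist (x - \<tau> *\<^sub>R V x) p \<le> dist x p + norm (\<tau> *\<^sub>R V x)"
    using norm_triangle_ineq4[of "x - p" "\<tau> *\<^sub>R V x"] by (simp add: dist_norm algebra_simps)
  ultimately show ?thesis using assms R by (simp add: dist_commute)
qed

text \<open>Along the step the gradient changes by at most half its initial length, so its product
  with \<open>V x\<close> stays at least \<open>(norm (V x))\<^sup>2 / 2\<close>.\<close>

lemma descent:
  assumes x: "dist x p \<le> R / 2" and u: "0 \<le> u" "u \<le> 1"
  shows "\<phi> (T u x) \<le> \<phi> x - u * step / 2 * (norm (V x))\<^sup>2"
proof (cases "u = 0")
  case True
  then show ?thesis by (simp add: T_def)
next
  case False
  then have us: "0 < u * step" using u step by simp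
  have us1: "u * step \<le> step" using u step by (simp add: mult_left_le_one_le)
  define \<psi> where "\<psi> \<tau> = \<phi> (x - \<tau> *\<^sub>R V x)" for \<tau>
  have d: "(\<psi> has_real_derivative - (V (x - \<tau> *\<^sub>R V x) \<bullet> V x)) (at \<tau>)"
    if "0 \<le> \<tau>" "\<tau> \<le> u * step" for \<tau>
  proof -
    have "x - \<tau> *\<^sub>R V x \<in> cball p R" using segment_in_cball x that us1 by force
    moreover have "((\<lambda>\<tau>. x - \<tau> *\<^sub>R V x) has_derivative (\<lambda>h. - (h *\<^sub>R V x))) (at \<tau>)"
      by (auto intro!: derivative_eq_intros)
    ultimately have "(\<psi> has_derivative (\<lambda>h. V (x - \<tau> *\<^sub>R V x) \<bullet> - (h *\<^sub>R V x))) (at \<tau>)"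
      unfolding \<psi>_def using has_derivative_compose grad by blast
    then show ?thesis by (rule has_derivative_imp_has_field_derivative) simp
  qed
  obtain \<tau> where \<tau>: "0 < \<tau>" "\<tau> < u * step"
    "\<psi> (u * step) - \<psi> 0 = (u * step - 0) * - (V (x - \<tau> *\<^sub>R V x) \<bullet> V x)"
    using MVT2[OF us d] by auto
  let ?y = "x - \<tau> *\<^sub>R V x"
  have y: "?y \<in> cball p R" using segment_in_cball x \<tau> us1 by force
  have xR: "x \<in> cball p R" using x R by (simp add: dist_commute)
  have "norm (V ?y - V x) \<le> L * norm (\<tau> *\<^sub>R V x)"
    using lipschitz_onD[OF lip y xR] by (simp add: dist_norm)
  also have "\<dots> = (\<tau> * L) * norm (V x)" using \<tau> by simp
  also have "\<dots> \<le> (step * L) * norm (V x)" using \<tau> us1 L_nonneg by (intro mult_right_mono) auto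
  also have "\<dots> \<le> 1 / 2 * norm (V x)" using step(2) by (rule mult_right_mono) simp
  finally have "norm (V ?y - V x) * norm (V x) \<le> 1 / 2 * norm (V x) * norm (V x)"
    by (rule mult_right_mono) simp
  moreover have "- ((V ?y - V x) \<bullet> V x) \<le> norm (V ?y - V x) * norm (V x)"
    using Cauchy_Schwarz_ineq2[of "V ?y - V x" "V x"] by linarith
  ultimately have "V x \<bullet> V x - V ?y \<bullet> V x \<le> 1 / 2 * (norm (V x))\<^sup>2"
    by (simp add: inner_diff_left power2_eq_square)
  then have "(norm (V x))\<^sup>2 / 2 \<le> V ?y \<bullet> V x" by (simp add: power2_norm_eq_inner)
  then have "(u * step) * ((norm (V x))\<^sup>2 / 2) \<le> (u * step) * (V ?y \<bullet> V x)"
    using us by (intro mult_left_mono) auto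
  then show ?thesis using \<tau>(3) by (simp add: \<psi>_def T_def)
qed

text \<open>Iterate the gradient step \<open>T 1\<close>. On a small circle, \<open>(T 1)\<^sup>n x - x\<close> never vanishes for \<open>n \<ge> 1\<close>,
  since \<open>\<phi>\<close> decreases; for \<open>n = 1\<close> it is a negative multiple of the gradient and for large \<open>n\<close> it is
  close to \<open>p - x\<close>.\<close>

lemma gradient_turning:
  obtains r where "0 < r" "r < R" "turning (\<lambda>t. cpx (V (circ p r t))) = 1"
proof -
  let ?K = "cball p R - ball p (R / 2)"
  have K: "compact ?K" "?K \<subseteq> cball p R" "?K \<noteq> {}"
  proof -
    have "circ p R 0 \<in> ?K" using R by simp
    then show "?K \<noteq> {}" by blast
  qed (auto simp: compact_diff)
  obtain k where k: "k \<in> ?K" "\<And>x. x \<in> ?K \<Longrightarrow> \<phi> k \<le> \<phi> x"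
    using continuous_attains_inf[OF K(1,3) continuous_on_subset[OF cont_\<phi> K(2)]] by blast
  define c where "c = \<phi> k"
  have "k \<noteq> p" using k(1) R by auto
  then have c: "c > 0" using k(1) pos[of k] by (simp add: c_def)
  \<comment> \<open>Trapping region: a step from here stays in \<open>cball p R\<close> and does not
    raise \<open>\<phi>\<close>, while \<open>\<phi>\<close> is at least \<open>c\<close> on the
    outer annulus \<open>?K\<close>, so the annulus cannot be entered.\<close>
  define S where "S = {x. dist x p < R / 2 \<and> \<phi> x < c}"
  have S_sub: "x \<in> cball p R" "dist x p \<le> R / 2" if "x \<in> S" for x
    using that R by (auto simp: S_def dist_commute)
  have T_S: "T u x \<in> S" "\<phi> (T u x) \<le> \<phi> x" if "x \<in> S" "0 \<le> u" "u \<le> 1" for u x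
  proof -
    have "0 \<le> u * step / 2 * (norm (V x))\<^sup>2" using step that by simp
    then show le: "\<phi> (T u x) \<le> \<phi> x" using descent[OF S_sub(2)[OF that(1)] that(2,3)] by linarith
    have "T u x \<in> cball p R"
      unfolding T_def using step that by (intro segment_in_cball S_sub) (auto simp: mult_left_le_one_le)
    moreover have "T u x \<notin> ?K"
      using k(2)[of "T u x"] le that(1) by (auto simp: S_def c_def)
    ultimately show "T u x \<in> S" using le that(1) by (auto simp: S_def dist_commute)
  qed
  define F where "F = T 1"
  have F_S: "F x \<in> S" "\<phi> (F x) \<le> \<phi> x" if "x \<in> S" for x using T_S[OF that, of 1] by (auto simp: F_def)
  have F_less: "\<phi> (F x) < \<phi> x" if "x \<in> S" "x \<noteq> p" for x
  proof -
    have "0 < 1 * step / 2 * (norm (V x))\<^sup>2" using step nz[OF S_sub(1)] that by simp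
    then show ?thesis using descent[OF S_sub(2)[OF that(1)], of 1] by (simp add: F_def)
  qed
  have F_p: "F p = p" by (simp add: F_def T_def at_p)
  have Fn_S: "(F ^^ n) x \<in> S" if "x \<in> S" for n x by (induction n) (use that F_S in auto)
  have Fn_le: "\<phi> ((F ^^ n) x) \<le> \<phi> x" if "x \<in> S" for n x
  proof (induction n)
    case (Suc n)
    then show ?case using F_S(2)[OF Fn_S[OF that, of n]] by simp
  qed simp
  have Fn_p: "(F ^^ n) p = p" for n by (induction n) (use F_p in auto)
  have Fn_less: "\<phi> ((F ^^ n) x) < \<phi> x" if "x \<in> S" "x \<noteq> p" "n \<ge> 1" for n x
  proof -
    obtain m where "n = Suc m" using \<open>n \<ge> 1\<close> by (cases n) auto
    then have "(F ^^ n) x = (F ^^ m) (F x)" by (simp add: funpow_swap1)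
    then show ?thesis using Fn_le[OF F_S(1)[OF that(1)], of m] F_less[OF that(1,2)] by simp
  qed
  have cont_T: "continuous_on ({0..1} \<times> S) (\<lambda>z. T (fst z) (snd z))"
    unfolding T_def
    by (intro continuous_intros continuous_on_compose2[OF cont_V]) (use S_sub in auto)
  have cont_F: "continuous_on S F"
    unfolding F_def T_def by (intro continuous_intros continuous_on_subset[OF cont_V]) (use S_sub in auto)
  have cont_Fn: "continuous_on S (F ^^ n)" for n
  proof (induction n)
    case (Suc n)
    show ?case unfolding funpow.simps
      by (rule continuous_on_compose[OF Suc continuous_on_subset[OF cont_F]]) (use Fn_S in auto)
  qed (simp add: id_def)
  have "isCont \<phi> p" using has_derivative_continuous grad R by (metis centre_in_cball less_imp_le)
  then obtain e where e: "e > 0" "\<And>x. dist x p < e \<Longrightarrow> \<phi> x < c"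
    unfolding continuous_at_eps_delta using c at_p(1)
    by (metis abs_less_iff diff_zero dist_real_def)
  define r where "r = min e (R / 2) / 2"
  have r: "0 < r" "r < e" "r < R / 2" using e R by (auto simp: r_def)
  have circ_S: "circ p r t \<in> S" for t using r e by (simp add: S_def)
  have circ_p: "circ p r t \<noteq> p" for t using r circ_neq by blast
  let ?w = "\<lambda>n t. cpx ((F ^^ n) (circ p r t) - circ p r t)"
  have loop_w: "loop (?w n)" if "n \<ge> 1" for n
  proof -
    have "continuous_on {0..2 * pi} (\<lambda>t. (F ^^ n) (circ p r t))"
      by (rule continuous_on_compose2[OF cont_Fn]) (use circ_S in \<open>auto intro!: continuous_intros\<close>)
    moreover have "(F ^^ n) (circ p r t) \<noteq> circ p r t" for t
      using Fn_less[OF circ_S circ_p that] by (metis less_irrefl)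
    ultimately show ?thesis unfolding loop_def
      by (auto intro!: continuous_intros simp del: cpx_simps)
  qed
  have w_Suc: "turning (?w (Suc n)) = turning (?w n)" if "n \<ge> 1" for n
  proof -
    \<comment> \<open>Passing from \<open>n\<close> to \<open>n + 1\<close> iterations: a fraction
      \<open>u\<close> of one gradient step is inserted before the \<open>n\<close>
      iterations.\<close>
    let ?H = "\<lambda>u t. cpx ((F ^^ n) (T u (circ p r t)) - circ p r t)"
    have "turning (?H 0) = turning (?H 1)"
    proof (rule turning_homotopy)
      have "continuous_on ({0..1} \<times> {0..2 * pi}) (\<lambda>z. T (fst z) (circ p r (snd z)))"
      proof -
        have A: "continuous_on ({0..1::real} \<times> {0..2 * pi}) (\<lambda>z. (fst z, circ p r (snd z)))"
          by (intro continuous_intros)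
        have B: "(\<lambda>z. (fst z, circ p r (snd z))) ` ({0..1::real} \<times> {0..2 * pi}) \<subseteq> {0..1} \<times> S"
          using circ_S by (simp add: image_subset_iff)
        show ?thesis using continuous_on_compose2[OF cont_T A B] by simp
      qed
      then have "continuous_on ({0..1} \<times> {0..2 * pi}) (\<lambda>z. (F ^^ n) (T (fst z) (circ p r (snd z))))"
        by (rule continuous_on_compose2[OF cont_Fn]) (use circ_S T_S in auto)
      then show "continuous_on ({0..1} \<times> {0..2 * pi}) (\<lambda>(u, t). ?H u t)"
        unfolding case_prod_beta' by (intro continuous_intros)
      show "?H u t \<noteq> 0" if u: "u \<in> {0..1}" for u t
      proof -
        have "\<phi> ((F ^^ n) (T u (circ p r t))) < \<phi> (circ p r t)"
        proof (cases "T u (circ p r t) = p")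
          case True
          then show ?thesis using Fn_p at_p pos[OF S_sub(1)[OF circ_S] circ_p] by simp
        next
          case False
          then show ?thesis
            using Fn_less[OF T_S(1)[OF circ_S], of u t n] T_S(2)[OF circ_S, of u t] u \<open>n \<ge> 1\<close> by force
        qed
        then show ?thesis by (metis cpx_eq_0 eq_iff_diff_eq_0 less_irrefl)
      qed
    qed simp_all
    moreover have "?H 0 = ?w n" by (simp add: T_def)
    moreover have "?H 1 = ?w (Suc n)" by (simp add: F_def funpow_swap1)
    ultimately show ?thesis by simp
  qed
  have w_eq: "turning (?w n) = turning (?w 1)" if "n \<ge> 1" for n
    using that by (induction n rule: dec_induct) (use w_Suc in auto)
  let ?A = "cball p R - ball p r"
  have A: "compact ?A" "?A \<subseteq> cball p R" "?A \<noteq> {}"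
  proof -
    have "circ p R 0 \<in> ?A" using R r by simp
    then show "?A \<noteq> {}" by blast
  qed (auto simp: compact_diff)
  obtain a where a: "a \<in> ?A" "\<And>x. x \<in> ?A \<Longrightarrow> \<phi> a \<le> \<phi> x"
    using continuous_attains_inf[OF A(1,3) continuous_on_subset[OF cont_\<phi> A(2)]] by blast
  have "a \<noteq> p" using a(1) r by auto
  then have a0: "0 < \<phi> a" using a(1) pos[of a] by simp
  \<comment> \<open>This compact set misses \<open>p\<close>, so the gradient has a positive lower
    bound on it, and each iteration from it lowers \<open>\<phi>\<close> by at least
    \<open>\<eta>\<close>.\<close>
  let ?B = "{x \<in> cball p R. \<phi> a \<le> \<phi> x}"
  have "closed ?B"
    by (rule continuous_on_closed_Collect_le[OF continuous_on_const cont_\<phi> closed_cball])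
  then have "compact (cball p R \<inter> ?B)" by (rule compact_Int_closed[OF compact_cball])
  moreover have "cball p R \<inter> ?B = ?B" by blast
  ultimately have B: "compact ?B" by simp
  have B': "?B \<noteq> {}" using a(1) by auto
  have cB: "continuous_on ?B (\<lambda>x. norm (V x))"
    by (rule continuous_on_norm[OF continuous_on_subset[OF cont_V]]) blast
  obtain b where b: "b \<in> ?B" "\<And>x. x \<in> ?B \<Longrightarrow> norm (V b) \<le> norm (V x)"
    using continuous_attains_inf[OF B B' cB] by blast
  define \<eta> where "\<eta> = 1 * step / 2 * (norm (V b))\<^sup>2"
  have "b \<noteq> p" using b(1) a0 at_p by auto
  then have \<eta>: "\<eta> > 0" using b(1) nz[of b] step by (simp add: \<eta>_def)
  have decay: "\<phi> ((F ^^ n) x) < \<phi> a \<or> \<phi> ((F ^^ n) x) \<le> \<phi> x - real n * \<eta>" if x: "x \<in> S" for n x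
  proof (induction n)
    case (Suc n)
    let ?y = "(F ^^ n) x"
    have y: "?y \<in> S" using Fn_S x by blast
    show ?case
    proof (cases "\<phi> ?y < \<phi> a")
      case True
      then show ?thesis using F_S(2)[OF y] by simp
    next
      case False
      then have "?y \<in> ?B" using S_sub[OF y] by simp
      from b(2)[OF this] have "(norm (V b))\<^sup>2 \<le> (norm (V ?y))\<^sup>2" by (simp add: power_mono)
      then have "\<eta> \<le> 1 * step / 2 * (norm (V ?y))\<^sup>2"
        unfolding \<eta>_def using step by (intro mult_left_mono) auto
      moreover have "\<phi> (F ?y) \<le> \<phi> ?y - 1 * step / 2 * (norm (V ?y))\<^sup>2"
        unfolding F_def using descent[OF S_sub(2)[OF y[unfolded F_def]], of 1] by (simp add: F_def)
      ultimately show ?thesis using Suc False by (simp add: algebra_simps)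
    qed
  qed simp
  \<comment> \<open>Since \<open>\<phi> < c\<close> on \<open>S\<close>, lowering it
    \<open>n\<close> times by \<open>\<eta>\<close> would make \<open>\<phi>\<close> negative. So
    \<open>n\<close> iterations bring every point of \<open>S\<close> closer to \<open>p\<close>
    than \<open>r\<close>.\<close>
  obtain n where n: "c < real n * \<eta>" using \<eta> reals_Archimedean3 by blast
  then have n1: "n \<ge> 1" using c by (cases n) auto
  have near: "dist ((F ^^ n) x) p < r" if x: "x \<in> S" for x
  proof -
    have y: "(F ^^ n) x \<in> S" using Fn_S x by blast
    then have "0 \<le> \<phi> ((F ^^ n) x)" using pos[OF S_sub(1)[OF y]] at_p by force
    moreover have "\<phi> x < c" using x by (simp add: S_def)
    ultimately have "\<phi> ((F ^^ n) x) < \<phi> a" using decay[OF x, of n] n by linarith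
    then have "(F ^^ n) x \<notin> ?A" using a(2) by force
    then show ?thesis using S_sub[OF y] by (auto simp: dist_commute)
  qed
  have loop_neg_cis: "loop (\<lambda>t. - cis t)" using loop_cis by (auto simp: loop_def intro!: continuous_intros)
  have "turning (?w n) = turning (\<lambda>t. - cis t)"
  proof (rule turning_nonantipodal[OF loop_w[OF n1] loop_neg_cis])
    fix t s :: real assume s: "s > 0"
    \<comment> \<open>A displacement pointing radially outward would put the iterate at distance
      \<open>r + s\<close> from \<open>p\<close>.\<close>
    show "?w n t \<noteq> - (of_real s * - cis t)"
    proof
      assume "?w n t = - (of_real s * - cis t)"
      then have "cpx ((F ^^ n) (circ p r t) - circ p r t) = cpx (s *\<^sub>R polar_vec t)" by simp
      then have "(F ^^ n) (circ p r t) - circ p r t = s *\<^sub>R polar_vec t" unfolding cpx_inject .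
      then have "(F ^^ n) (circ p r t) = circ p (r + s) t"
        by (simp add: circ_def algebra_simps)
      then have "dist ((F ^^ n) (circ p r t)) p = r + s" using r s by simp
      then show False using near[OF circ_S, of t] s by simp
    qed
  qed
  moreover have "turning (\<lambda>t. - cis t) = 1"
    using turning_real_mult(1)[of "\<lambda>t. - 1" cis] loop_cis turning_cis by simp
  ultimately have "turning (?w 1) = 1" using w_eq[OF n1] by simp
  moreover have "?w 1 = (\<lambda>t. of_real (- step) * cpx (V (circ p r t)))"
    by (simp add: F_def T_def)
  moreover have "turning (\<lambda>t. of_real (- step) * cpx (V (circ p r t))) = turning (\<lambda>t. cpx (V (circ p r t)))"
  proof (rule turning_real_mult(1))
    show "loop (\<lambda>t. cpx (V (circ p r t)))"
      unfolding loop_def using nz[OF S_sub(1)[OF circ_S] circ_p] S_sub(1)[OF circ_S]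
      by (auto intro!: continuous_intros continuous_on_compose2[OF cont_V] simp del: mem_cball)
  qed (use step in auto)
  ultimately have "turning (\<lambda>t. cpx (V (circ p r t))) = 1" by simp
  then show ?thesis using that r R by simp
qed

end

subsection \<open>Planar maps with indefinite symmetric derivative\<close>

text \<open>In complex notation \<open>B v = (t * v + D * cnj v) / 2\<close> with the trace
  \<open>t\<close> and \<open>D = b11 - b22 + 2 \<i> b12\<close>. Since \<open>D\<close> has squared
  length \<open>t\<^sup>2 - 4 * det B\<close>, the second term dominates; antipodality would give
  \<open>t * v = - (1 + 2 * s) * D * cnj v\<close>, which the lengths forbid.\<close>

lemma indefinite_form_nonantipodal:
  fixes b11 b12 b22 v1 v2 s :: real
  assumes det: "b11 * b22 - b12 * b12 < 0" and v: "v1 \<noteq> 0 \<or> v2 \<noteq> 0" and s: "s > 0"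
  shows "Complex (b11 * v1 + b12 * v2) (b12 * v1 + b22 * v2) \<noteq>
    - (of_real s * (Complex (b11 - b22) (2 * b12) * cnj (Complex v1 v2)))"
proof
  let ?w1 = "(b11 - b22) * v1 + 2 * b12 * v2" and ?w2 = "2 * b12 * v1 - (b11 - b22) * v2"
  let ?t = "b11 + b22"
  assume "Complex (b11 * v1 + b12 * v2) (b12 * v1 + b22 * v2) =
    - (of_real s * (Complex (b11 - b22) (2 * b12) * cnj (Complex v1 v2)))"
  then have "b11 * v1 + b12 * v2 = - (s * ?w1)" "b12 * v1 + b22 * v2 = - (s * ?w2)"
    by (simp_all add: complex_eq_iff algebra_simps)
  then have t: "?t * v1 = - ((1 + 2 * s) * ?w1)" "?t * v2 = - ((1 + 2 * s) * ?w2)"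
    by (simp_all add: algebra_simps)
  have "?t\<^sup>2 * (v1\<^sup>2 + v2\<^sup>2) = (?t * v1)\<^sup>2 + (?t * v2)\<^sup>2"
    by (simp add: power_mult_distrib distrib_left)
  also have "\<dots> = (1 + 2 * s)\<^sup>2 * (?w1\<^sup>2 + ?w2\<^sup>2)"
  proof -
    have "(- (k * x))\<^sup>2 + (- (k * y))\<^sup>2 = k\<^sup>2 * (x\<^sup>2 + y\<^sup>2)" for k x y :: real
      by (simp add: power2_eq_square algebra_simps)
    then show ?thesis unfolding t .
  qed
  also have "\<dots> \<ge> 1 * (?w1\<^sup>2 + ?w2\<^sup>2)"
  proof (rule mult_right_mono)
    show "1 \<le> (1 + 2 * s)\<^sup>2" using s by (simp add: power2_eq_square algebra_simps)
  qed simp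
  also have "1 * (?w1\<^sup>2 + ?w2\<^sup>2) = (?t\<^sup>2 - 4 * (b11 * b22 - b12 * b12)) * (v1\<^sup>2 + v2\<^sup>2)"
    by (simp add: power2_eq_square algebra_simps)
  finally have "0 \<le> (b11 * b22 - b12 * b12) * (v1\<^sup>2 + v2\<^sup>2)" by (simp add: algebra_simps)
  moreover have "0 < v1\<^sup>2 + v2\<^sup>2" using v by (simp add: sum_power2_gt_zero_iff)
  ultimately show False using det by (simp add: zero_le_mult_iff)
qed

lemma lipschitz_on_vec2:
  fixes V :: "'a::metric_space \<Rightarrow> real^2"
  assumes "L1-lipschitz_on S (\<lambda>x. V x $ 1)" "L2-lipschitz_on S (\<lambda>x. V x $ 2)"
  shows "(L1 + L2)-lipschitz_on S V"
proof (rule lipschitz_onI)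
  fix x y assume xy: "x \<in> S" "y \<in> S"
  have "dist (V x) (V y) \<le> (\<Sum>i\<in>UNIV. \<bar>(V x - V y) $ i\<bar>)"
    unfolding dist_norm by (rule norm_le_l1_cart)
  also have "\<dots> \<le> L1 * dist x y + L2 * dist x y"
    using lipschitz_onD[OF assms(1) xy] lipschitz_onD[OF assms(2) xy]
    by (simp add: sum_2 dist_real_def)
  finally show "dist (V x) (V y) \<le> (L1 + L2) * dist x y" by (simp add: distrib_right)
qed (use lipschitz_on_nonneg[OF assms(1)] lipschitz_on_nonneg[OF assms(2)] in simp)

lemma eventually_at_pos_within:
  fixes f :: "'a::metric_space \<Rightarrow> real"
  assumes "open U" "p \<in> U" "continuous_on U f" "f p > 0"
  shows "\<exists>e>0. \<forall>x\<in>cball p e. x \<in> U \<and> f x > 0"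
proof -
  have "open {x \<in> U. f x \<in> {0<..}}"
    using continuous_open_preimage[OF assms(3,1), of "{0<..}"] by (simp add: vimage_def Int_def)
  moreover have "p \<in> {x \<in> U. f x \<in> {0<..}}" using assms by simp
  ultimately obtain e where "e > 0" "cball p e \<subseteq> {x \<in> U. f x \<in> {0<..}}"
    using open_contains_cball by blast
  then show ?thesis by (intro exI[of _ e]) auto
qed

text \<open>Kept apart from \<open>indefinite_map_pair\<close> so that \<open>b\<close> is available
  when the assumptions there are stated.\<close>

locale smooth_map_pair =
  fixes U :: "(real^2) set" and p :: "real^2" and X1 X2 F1 F2 :: "real^2 \<Rightarrow> real"
  assumes U: "open U" "p \<in> U"
    and smooth: "smooth_on U X1" "smooth_on U X2" "smooth_on U F1" "smooth_on U F2"
begin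

definition b :: "2 \<Rightarrow> 2 \<Rightarrow> real^2 \<Rightarrow> real" where
  "b i j x = partial_deriv i X1 x * partial_deriv j F1 x + partial_deriv i X2 x * partial_deriv j F2 x"

text \<open>The traceless part of \<open>b\<close>. For symmetric \<open>b\<close> its argument is
  twice the angle of the eigenline for the larger eigenvalue.\<close>

definition D :: "real^2 \<Rightarrow> complex" where
  "D x = Complex (b 1 1 x - b 2 2 x) (2 * b 1 2 x)"

end

locale indefinite_map_pair = smooth_map_pair +
  assumes sym: "\<And>x. x \<in> U \<Longrightarrow> b 1 2 x = b 2 1 x"
    and immersion: "\<And>x. x \<in> U \<Longrightarrow> planar_jacobian X1 X2 x \<noteq> 0"
    and indef: "\<And>x. x \<in> U \<Longrightarrow> x \<noteq> p \<Longrightarrow> b 1 1 x * b 2 2 x - b 1 2 x * b 1 2 x < 0"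
begin

lemma smooth_b: "smooth_on U (b i j)"
  unfolding b_def by (intro smooth_on_add smooth_on_mult smooth_on_partial_deriv smooth U)

lemma cont_D: "continuous_on U D"
  unfolding D_def Complex_eq by (intro continuous_intros smooth_on_continuous smooth_b)

lemma D_nonzero: "x \<in> U \<Longrightarrow> x \<noteq> p \<Longrightarrow> D x \<noteq> 0"
proof
  assume x: "x \<in> U" "x \<noteq> p" "D x = 0"
  then have "b 1 1 x = b 2 2 x" "b 1 2 x = 0" by (auto simp: D_def complex_eq_iff)
  then show False using indef[OF x(1,2)] by (simp add: not_less)
qed

lemma loop_D:
  assumes "r > 0" "cball p r \<subseteq> U"
  shows "loop (\<lambda>t. D (circ p r t))"
proof -
  have "circ p r t \<in> U" for t using assms by (auto simp: subset_iff)
  moreover have "circ p r t \<noteq> p" for t using assms circ_neq by blast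
  ultimately show ?thesis unfolding loop_def
    using D_nonzero by (auto intro!: continuous_on_compose2[OF cont_D] continuous_intros)
qed

lemma turning_D_radius:
  assumes "0 < r" "r \<le> s" "cball p s \<subseteq> U"
  shows "turning (\<lambda>t. D (circ p r t)) = turning (\<lambda>t. D (circ p s t))"
proof (rule turning_homotopy[OF assms(2)])
  have inU: "circ p q t \<in> U" if "q \<in> {r..s}" for q t using assms that by (auto simp: subset_iff)
  show "continuous_on ({r..s} \<times> {0..2 * pi}) (\<lambda>(q, t). D (circ p q t))"
    unfolding case_prod_beta'
    by (rule continuous_on_compose2[OF cont_D]) (auto intro!: continuous_intros inU)
  show "D (circ p q t) \<noteq> 0" if "q \<in> {r..s}" for q t
    using D_nonzero[OF inU[OF that]] circ_neq assms that by simp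
qed simp

definition f1 :: "real^2 \<Rightarrow> real" where "f1 x = F1 x - F1 p"
definition f2 :: "real^2 \<Rightarrow> real" where "f2 x = F2 x - F2 p"

lemma smooth_f: "smooth_on U f1" "smooth_on U f2"
  unfolding f1_def f2_def by (intro smooth_on_diff smooth_on_const smooth U)+

lemma f_at_p [simp]: "f1 p = 0" "f2 p = 0" by (simp_all add: f1_def f2_def)

lemma partial_f:
  assumes "x \<in> U"
  shows "partial_deriv i f1 x = partial_deriv i F1 x" "partial_deriv i f2 x = partial_deriv i F2 x"
  using partial_deriv_diff[OF smooth_on_differentiable[OF smooth(3) assms] differentiable_const]
    partial_deriv_diff[OF smooth_on_differentiable[OF smooth(4) assms] differentiable_const]
  by (simp_all add: f1_def[abs_def] f2_def[abs_def])

text \<open>The vector \<open>v\<close> is \<open>f\<close> multiplied by the adjugate of the Jacobian matrix of \<open>X\<close>, and \<open>w\<close> is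
  \<open>f\<close> multiplied by that adjugate frozen at \<open>p\<close>.\<close>

definition v1 :: "real^2 \<Rightarrow> real" where
  "v1 x = partial_deriv 2 X2 x * f1 x - partial_deriv 2 X1 x * f2 x"
definition v2 :: "real^2 \<Rightarrow> real" where
  "v2 x = partial_deriv 1 X1 x * f2 x - partial_deriv 1 X2 x * f1 x"
definition w1 :: "real^2 \<Rightarrow> real" where
  "w1 x = partial_deriv 2 X2 p * f1 x - partial_deriv 2 X1 p * f2 x"
definition w2 :: "real^2 \<Rightarrow> real" where
  "w2 x = partial_deriv 1 X1 p * f2 x - partial_deriv 1 X2 p * f1 x"

definition grad :: "real^2 \<Rightarrow> real^2" where
  "grad x = (\<chi> i. partial_deriv i F1 x * f1 x + partial_deriv i F2 x * f2 x)"

lemma smooth_v: "smooth_on U v1" "smooth_on U v2"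
  unfolding v1_def v2_def
  by (intro smooth_on_diff smooth_on_mult smooth_on_partial_deriv smooth smooth_f U)+

lemma smooth_w: "smooth_on U w1" "smooth_on U w2"
  unfolding w1_def w2_def
  by (intro smooth_on_diff smooth_on_mult smooth_on_const smooth_f U)+

lemma smooth_grad: "smooth_on U (\<lambda>x. grad x $ i)"
  unfolding grad_def vec_lambda_beta
  by (intro smooth_on_add smooth_on_mult smooth_on_partial_deriv smooth smooth_f U)

lemma det_b:
  assumes "x \<in> U"
  shows "planar_jacobian X1 X2 x * planar_jacobian F1 F2 x = b 1 1 x * b 2 2 x - b 1 2 x * b 1 2 x"
proof -
  have "planar_jacobian X1 X2 x * planar_jacobian F1 F2 x = b 1 1 x * b 2 2 x - b 1 2 x * b 2 1 x"
    unfolding planar_jacobian_def b_def by (simp add: algebra_simps)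
  then show ?thesis using sym[OF assms] by simp
qed

text \<open>By symmetry \<open>b\<close> equals \<open>DF\<^sup>T DX\<close>, and
  \<open>DX v\<close> is \<open>f\<close> times the Jacobian determinant of \<open>X\<close>, since
  \<open>v\<close> is the adjugate applied to \<open>f\<close>.\<close>

lemma b_v:
  assumes "x \<in> U"
  shows "planar_jacobian X1 X2 x * grad x $ 1 = b 1 1 x * v1 x + b 1 2 x * v2 x"
    "planar_jacobian X1 X2 x * grad x $ 2 = b 1 2 x * v1 x + b 2 2 x * v2 x"
proof -
  have "planar_jacobian X1 X2 x * grad x $ 1 = b 1 1 x * v1 x + b 2 1 x * v2 x"
    unfolding grad_def planar_jacobian_def b_def v1_def v2_def by (simp add: algebra_simps)
  then show "planar_jacobian X1 X2 x * grad x $ 1 = b 1 1 x * v1 x + b 1 2 x * v2 x"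
    using sym[OF assms] by simp
  show "planar_jacobian X1 X2 x * grad x $ 2 = b 1 2 x * v1 x + b 2 2 x * v2 x"
    unfolding grad_def planar_jacobian_def b_def v1_def v2_def by (simp add: algebra_simps)
qed

text \<open>Polarization of the determinant: \<open>mixed x\<close> is the coefficient of
  \<open>s\<close> in \<open>det (DX x + s * DX p)\<close>.\<close>

definition mixed :: "real^2 \<Rightarrow> real" where
  "mixed x = partial_deriv 1 X1 x * partial_deriv 2 X2 p + partial_deriv 1 X1 p * partial_deriv 2 X2 x
     - partial_deriv 2 X1 x * partial_deriv 1 X2 p - partial_deriv 2 X1 p * partial_deriv 1 X2 x"

text \<open>\<open>v + s * w\<close> is the adjugate of \<open>DX x + s * DX p\<close> applied to
  \<open>f\<close>, and the determinant of that sum is nonzero by the sign conditions. The case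
  \<open>s = 0\<close> says that \<open>v\<close> itself does not vanish.\<close>

lemma v_w_nonantipodal:
  assumes "planar_jacobian X1 X2 p * planar_jacobian X1 X2 x > 0" "planar_jacobian X1 X2 p * mixed x > 0"
    and f: "f1 x \<noteq> 0 \<or> f2 x \<noteq> 0" and s: "s \<ge> 0"
  shows "v1 x \<noteq> - (s * w1 x) \<or> v2 x \<noteq> - (s * w2 x)"
proof (rule ccontr)
  let ?J = "planar_jacobian X1 X2"
  let ?Q = "?J x + s * mixed x + s * s * ?J p"
  assume "\<not> ?thesis"
  then have e: "v1 x + s * w1 x = 0" "v2 x + s * w2 x = 0" by auto
  have "?Q * f1 x = (partial_deriv 1 X1 x + s * partial_deriv 1 X1 p) * (v1 x + s * w1 x)
      + (partial_deriv 2 X1 x + s * partial_deriv 2 X1 p) * (v2 x + s * w2 x)"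
    "?Q * f2 x = (partial_deriv 1 X2 x + s * partial_deriv 1 X2 p) * (v1 x + s * w1 x)
      + (partial_deriv 2 X2 x + s * partial_deriv 2 X2 p) * (v2 x + s * w2 x)"
    unfolding planar_jacobian_def mixed_def v1_def v2_def w1_def w2_def by (simp_all add: algebra_simps)
  then have "?Q = 0" using e f by auto
  then have "?J p * ?Q = 0" by simp
  moreover have "?J p * ?Q = ?J p * ?J x + s * (?J p * mixed x) + (s * ?J p)\<^sup>2"
    by (simp add: algebra_simps power2_eq_square)
  ultimately have "?J p * ?J x + s * (?J p * mixed x) + (s * ?J p)\<^sup>2 = 0" by simp
  moreover have "0 \<le> s * (?J p * mixed x)" using assms by simp
  ultimately show False using assms(1) zero_le_power2[of "s * ?J p"] by linarith
qed

text \<open>The bound is found on the one circle where the gradient is known to turn once. Constancy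
  in the radius spreads it to all small circles, as the definition of the index demands.\<close>

lemma turning_D_nonpos:
  obtains R where "R > 0" "\<And>r. 0 < r \<Longrightarrow> r < R \<Longrightarrow> cball p r \<subseteq> U"
    "\<And>r. 0 < r \<Longrightarrow> r < R \<Longrightarrow> turning (\<lambda>t. D (circ p r t)) = turning (\<lambda>t. D (circ p (R / 2) t))"
    "turning (\<lambda>t. D (circ p (R / 2) t)) \<le> 0"
proof -
  let ?J = "planar_jacobian X1 X2"
  \<comment> \<open>All signs are taken relative to the one at \<open>p\<close>, so both
    orientations of \<open>X\<close> are covered at once.\<close>
  have Jp: "?J p * ?J p > 0" using immersion[OF U(2)] by (metis not_real_square_gt_zero)
  have contJ: "continuous_on U ?J"
    unfolding planar_jacobian_def
    by (intro continuous_intros smooth_on_continuous smooth_on_partial_deriv smooth)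
  have contM: "continuous_on U mixed"
    unfolding mixed_def
    by (intro continuous_intros smooth_on_continuous smooth_on_partial_deriv smooth)
  obtain e1 where e1: "e1 > 0" "\<And>x. x \<in> cball p e1 \<Longrightarrow> x \<in> U \<and> ?J p * ?J x > 0"
    using eventually_at_pos_within[OF U continuous_on_mult[OF continuous_on_const contJ] Jp] by blast
  have "mixed p = 2 * ?J p" by (simp add: mixed_def planar_jacobian_def)
  then have Mp: "?J p * mixed p > 0" using Jp by simp
  then obtain e2 where e2: "e2 > 0" "\<And>x. x \<in> cball p e2 \<Longrightarrow> x \<in> U \<and> ?J p * mixed x > 0"
    using eventually_at_pos_within[OF U continuous_on_mult[OF continuous_on_const contM] Mp] by blast
  define R where "R = min e1 e2"
  have R: "R > 0" using e1 e2 by (simp add: R_def)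
  have near: "x \<in> U" "?J p * ?J x > 0" "?J p * mixed x > 0" if "x \<in> cball p R" for x
    using e1(2)[of x] e2(2)[of x] that by (auto simp: R_def)
  have jacF: "?J p * planar_jacobian F1 F2 x < 0" if "x \<in> cball p R" "x \<noteq> p" for x
  proof -
    have "?J x * planar_jacobian F1 F2 x < 0" using det_b indef near(1) that by simp
    then show ?thesis using near(2)[OF that(1)]
      by (metis linorder_neqE_linordered_idom mult_less_0_iff zero_less_mult_iff less_asym)
  qed
  \<comment> \<open>Conjugating \<open>w\<close> makes it preserve orientation: its Jacobian is
    minus the product of that of \<open>X\<close> at \<open>p\<close> and that of
    \<open>F\<close>.\<close>
  interpret op: orientation_preserving_off_center U p R w1 "\<lambda>x. - w2 x"
  proof
    show "ball p R \<subseteq> U" using near(1) ball_subset_cball by blast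
    show "smooth_on U (\<lambda>x. - w2 x)" using smooth_on_uminus[OF U(1) smooth_w(2)] .
    show "planar_jacobian w1 (\<lambda>x. - w2 x) x > 0" if x: "x \<in> ball p R" "x \<noteq> p" for x
    proof -
      have xU: "x \<in> U" and xc: "x \<in> cball p R" using x near(1) by auto
      have df: "f1 differentiable (at x)" "f2 differentiable (at x)"
        using smooth_f xU smooth_on_differentiable by blast+
      have lin: "partial_deriv i (\<lambda>x. c * f1 x + d * f2 x) x = c * partial_deriv i F1 x + d * partial_deriv i F2 x" for c d i
        using df by (simp add: partial_deriv_add partial_deriv_mult partial_f[OF xU])
      have "w1 = (\<lambda>x. partial_deriv 2 X2 p * f1 x + (- partial_deriv 2 X1 p) * f2 x)"
        "(\<lambda>x. - w2 x) = (\<lambda>x. partial_deriv 1 X2 p * f1 x + (- partial_deriv 1 X1 p) * f2 x)"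
        by (auto simp: w1_def w2_def)
      then have "planar_jacobian w1 (\<lambda>x. - w2 x) x = - (?J p * planar_jacobian F1 F2 x)"
        unfolding planar_jacobian_def[of w1] lin planar_jacobian_def by (simp only: lin) (simp add: algebra_simps)
      then show ?thesis using jacF[OF xc x(2)] by simp
    qed
  qed (use U smooth_w R in \<open>auto simp: w1_def w2_def\<close>)
  obtain r1 where r1: "0 < r1" "r1 < R" "\<And>x. dist x p \<le> r1 \<Longrightarrow> x \<noteq> p \<Longrightarrow> w1 x \<noteq> 0 \<or> - w2 x \<noteq> 0"
    using op.center_isolated_zero by metis
  have fnz: "f1 x \<noteq> 0 \<or> f2 x \<noteq> 0" if "x \<in> cball p r1" "x \<noteq> p" for x
    using r1(3)[of x] that by (auto simp: w1_def w2_def dist_commute)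
  have r1U: "x \<in> U" "x \<in> cball p R" if "x \<in> cball p r1" for x using that r1 near(1)[of x] by auto
  obtain L1 L2 where L: "L1-lipschitz_on (cball p r1) (\<lambda>x. grad x $ 1)" "L2-lipschitz_on (cball p r1) (\<lambda>x. grad x $ 2)"
    using smooth_on_lipschitz[OF smooth_grad] r1U by (metis subsetI)
  interpret m: strict_minimum p r1 "L1 + L2" "\<lambda>x. ((f1 x)\<^sup>2 + (f2 x)\<^sup>2) / 2" grad
  proof
    show "(L1 + L2)-lipschitz_on (cball p r1) grad" using lipschitz_on_vec2[OF L] .
    show "grad p = 0" by (simp add: grad_def vec_eq_iff)
    fix x assume x: "x \<in> cball p r1"
    have df: "(f1 has_derivative (\<lambda>v. v $ 1 * partial_deriv 1 F1 x + v $ 2 * partial_deriv 2 F1 x)) (at x)"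
      "(f2 has_derivative (\<lambda>v. v $ 1 * partial_deriv 1 F2 x + v $ 2 * partial_deriv 2 F2 x)) (at x)"
      using has_derivative_partials2[OF smooth_on_differentiable[OF smooth_f(1)]]
        has_derivative_partials2[OF smooth_on_differentiable[OF smooth_f(2)]] r1U(1)[OF x]
      by (simp_all add: partial_f)
    show "((\<lambda>x. ((f1 x)\<^sup>2 + (f2 x)\<^sup>2) / 2) has_derivative (\<lambda>v. grad x \<bullet> v)) (at x)"
      by (rule derivative_eq_intros df refl)+
        (auto simp: grad_def inner_vec_def sum_2 field_simps)
    assume xp: "x \<noteq> p"
    show "0 < ((f1 x)\<^sup>2 + (f2 x)\<^sup>2) / 2" using fnz[OF x xp] by (simp add: sum_power2_gt_zero_iff)
    show "grad x \<noteq> 0"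
    proof
      assume "grad x = 0"
      then have z: "grad x $ 1 = 0" "grad x $ 2 = 0" by simp_all
      have "planar_jacobian F1 F2 x * f1 x = partial_deriv 2 F2 x * grad x $ 1 - partial_deriv 1 F2 x * grad x $ 2"
        "planar_jacobian F1 F2 x * f2 x = partial_deriv 1 F1 x * grad x $ 2 - partial_deriv 2 F1 x * grad x $ 1"
        unfolding planar_jacobian_def grad_def by (simp_all add: algebra_simps)
      then have "planar_jacobian F1 F2 x = 0" using z fnz[OF x xp] by auto
      then show False using jacF[OF r1U(2)[OF x] xp] by simp
    qed
  qed (use r1 in auto)
  obtain r where r: "0 < r" "r < r1" and tg: "turning (\<lambda>t. cpx (grad (circ p r t))) = 1"
    using m.gradient_turning by metis
  have c: "circ p r t \<in> cball p r1" "circ p r t \<noteq> p" for t using r circ_neq by auto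
  note cU = r1U(1)[OF c(1)] and cR = r1U(2)[OF c(1)]
  have good: "op.good r" unfolding op.good_def
    using r r1 r1(3)[OF _ c(2)] by simp
  have cont: "continuous_on {0..2 * pi} (\<lambda>t. q (circ p r t))" if "continuous_on U q" for q :: "real^2 \<Rightarrow> real"
    by (rule continuous_on_compose2[OF that]) (use cU in \<open>auto intro!: continuous_intros\<close>)
  let ?vl = "circ_loop v1 v2 p r" and ?wl = "circ_loop w1 w2 p r"
  have lv: "loop ?vl"
  proof (rule loop_circ_loop)
    show "v1 (circ p r t) \<noteq> 0 \<or> v2 (circ p r t) \<noteq> 0" for t
      using v_w_nonantipodal[OF near(2,3)[OF cR] fnz[OF c], of 0 t] by simp
  qed (use smooth_v smooth_on_continuous cU in blast)+
  have lw: "loop ?wl"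
  proof (rule loop_circ_loop)
    show "w1 (circ p r t) \<noteq> 0 \<or> w2 (circ p r t) \<noteq> 0" for t
      using r1(3)[OF _ c(2)] r by auto
  qed (use smooth_w smooth_on_continuous cU in blast)+
  have "turning ?vl = turning ?wl"
  proof (rule turning_nonantipodal[OF lv lw])
    fix t s :: real assume "s > 0"
    then show "?vl t \<noteq> - (of_real s * ?wl t)"
      using v_w_nonantipodal[OF near(2,3)[OF cR] fnz[OF c], of s t] by (auto simp: circ_loop_def complex_eq_iff)
  qed
  also have "turning ?wl = - turning (\<lambda>t. cnj (?wl t))" using turning_cnj[OF lw] by simp
  also have "(\<lambda>t. cnj (?wl t)) = circ_loop w1 (\<lambda>x. - w2 x) p r"
    by (auto simp: circ_loop_def complex_eq_iff)
  finally have tv: "turning ?vl \<le> - 1" using op.turning_good_pos[OF good] by simp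
  have lD: "loop (\<lambda>t. D (circ p r t))"
    using r r1 near(1) by (intro loop_D) auto
  have lg: "loop (\<lambda>t. cpx (grad (circ p r t)))"
  proof -
    have "continuous_on {0..2 * pi} (\<lambda>t. cpx (grad (circ p r t)))"
      unfolding cpx_def Complex_eq
      by (intro continuous_on_add continuous_on_mult continuous_on_const continuous_on_of_real
          cont[OF smooth_on_continuous[OF smooth_grad]])
    then show ?thesis unfolding loop_def using m.nz[OF c] by simp
  qed
  have "turning (\<lambda>t. of_real (?J (circ p r t)) * cpx (grad (circ p r t))) = turning (\<lambda>t. D (circ p r t) * cnj (?vl t))"
  proof (rule turning_nonantipodal)
    show "loop (\<lambda>t. of_real (?J (circ p r t)) * cpx (grad (circ p r t)))"
      by (rule turning_real_mult(2)[OF _ _ _ lg]) (use cont[OF contJ] immersion cU in auto)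
    show "loop (\<lambda>t. D (circ p r t) * cnj (?vl t))" using lD lv loop_cnj loop_mult by blast
    fix t s :: real assume s: "s > 0"
    let ?x = "circ p r t"
    have "of_real (?J ?x) * cpx (grad ?x) = Complex (b 1 1 ?x * v1 ?x + b 1 2 ?x * v2 ?x) (b 1 2 ?x * v1 ?x + b 2 2 ?x * v2 ?x)"
      unfolding b_v[OF cU, symmetric] by (simp add: cpx_def complex_eq_iff)
    moreover have "v1 ?x \<noteq> 0 \<or> v2 ?x \<noteq> 0"
      using v_w_nonantipodal[OF near(2,3)[OF cR] fnz[OF c], of 0 t] by simp
    ultimately show "of_real (?J ?x) * cpx (grad ?x) \<noteq> - (of_real s * (D ?x * cnj (?vl t)))"
      using indefinite_form_nonantipodal[OF indef[OF cU c(2)] _ s] unfolding D_def circ_loop_def by simp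
  qed
  moreover have "turning (\<lambda>t. of_real (?J (circ p r t)) * cpx (grad (circ p r t))) = 1"
    using turning_real_mult(1)[OF cont[OF contJ] _ _ lg] immersion cU tg by simp
  \<comment> \<open>So \<open>1\<close> is the turning number of \<open>D\<close> minus that of
    \<open>v\<close>, and the latter is at most \<open>- 1\<close>.\<close>
  ultimately have nonpos: "turning (\<lambda>t. D (circ p r t)) \<le> 0"
    using turning_mult[OF lD loop_cnj[OF lv]] turning_cnj[OF lv] tv by simp
  have sub: "cball p s \<subseteq> U" if "s < R" for s using near(1) that by auto
  have eq: "turning (\<lambda>t. D (circ p s t)) = turning (\<lambda>t. D (circ p (R / 2) t))" if s: "0 < s" "s < R" for s
  proof (cases "s \<le> R / 2")
    case True
    show ?thesis by (rule turning_D_radius[OF s(1) True sub]) (use R in simp)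
  next
    case False
    show ?thesis by (rule turning_D_radius[OF _ _ sub[OF s(2)], symmetric]) (use R False in simp_all)
  qed
  have "turning (\<lambda>t. D (circ p (R / 2) t)) \<le> 0" using nonpos eq[of r] r r1 by linarith
  with R sub eq show ?thesis by (rule that)
qed

end

subsection \<open>Space-like surfaces and the Gauss equation\<close>

lemma lorentz_simps:
  "lorentz (x + y) z = lorentz x z + lorentz y z" "lorentz z (x + y) = lorentz z x + lorentz z y"
  "lorentz (x - y) z = lorentz x z - lorentz y z" "lorentz z (x - y) = lorentz z x - lorentz z y"
  "lorentz (a *\<^sub>R x) z = a * lorentz x z" "lorentz z (a *\<^sub>R x) = a * lorentz z x"
  by (simp_all add: lorentz_def algebra_simps)

lemma lorentz_commute: "lorentz x y = lorentz y x"
  by (simp add: lorentz_def mult.commute)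

lemma partial_deriv_lorentz:
  fixes a b :: "real^'n::finite \<Rightarrow> real^3"
  assumes "a differentiable (at p)" "b differentiable (at p)"
  shows "partial_deriv i (\<lambda>q. lorentz (a q) (b q)) p =
    lorentz (partial_deriv i a p) (b p) + lorentz (a p) (partial_deriv i b p)"
proof -
  have D: "(a has_derivative frechet_derivative a (at p)) (at p)"
    "(b has_derivative frechet_derivative b (at p)) (at p)"
    using assms frechet_derivative_works by blast+
  note C = bounded_linear.has_derivative[OF bounded_linear_vec_nth D(1)]
    bounded_linear.has_derivative[OF bounded_linear_vec_nth D(2)]
  have "((\<lambda>q. lorentz (a q) (b q)) has_derivative
    (\<lambda>v. lorentz (frechet_derivative a (at p) v) (b p) + lorentz (a p) (frechet_derivative b (at p) v))) (at p)"
    unfolding lorentz_def by (rule derivative_eq_intros C refl)+ (simp add: fun_eq_iff algebra_simps)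
  from partial_deriv_eqI[OF this] show ?thesis by (simp add: partial_deriv_def)
qed

lemma smooth_on_lorentz:
  "open U \<Longrightarrow> smooth_on U a \<Longrightarrow> smooth_on U b \<Longrightarrow> smooth_on U (\<lambda>q. lorentz (a q) (b q))"
  unfolding lorentz_def
  by (intro smooth_on_diff smooth_on_add smooth_on_mult smooth_on_component)

lemma matrix_inv_2:
  fixes A :: "real^2^2"
  assumes "det A \<noteq> 0"
  shows "matrix_inv A $ 1 $ 1 = A $ 2 $ 2 / det A" "matrix_inv A $ 1 $ 2 = - A $ 1 $ 2 / det A"
    "matrix_inv A $ 2 $ 1 = - A $ 2 $ 1 / det A" "matrix_inv A $ 2 $ 2 = A $ 1 $ 1 / det A"
proof -
  define B :: "real^2^2" where
    "B = vector [vector [A $ 2 $ 2 / det A, - A $ 1 $ 2 / det A], vector [- A $ 2 $ 1 / det A, A $ 1 $ 1 / det A]]"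
  have AB: "A ** B = mat 1" "B ** A = mat 1"
    using assms by (simp_all add: B_def matrix_matrix_mult_def mat_def vec_eq_iff forall_2 sum_2 det_2
        diff_divide_distrib[symmetric] add_divide_distrib[symmetric] mult.commute)
  have inv: "A ** matrix_inv A = mat 1 \<and> matrix_inv A ** A = mat 1"
    unfolding matrix_inv_def by (rule someI[of _ B]) (simp add: AB)
  have "matrix_inv A = matrix_inv A ** (A ** B)" by (simp add: AB)
  also have "\<dots> = B" by (simp add: matrix_mul_assoc inv)
  finally have "matrix_inv A = B" .
  then show "matrix_inv A $ 1 $ 1 = A $ 2 $ 2 / det A" "matrix_inv A $ 1 $ 2 = - A $ 1 $ 2 / det A"
    "matrix_inv A $ 2 $ 1 = - A $ 2 $ 1 / det A" "matrix_inv A $ 2 $ 2 = A $ 1 $ 1 / det A"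
    by (simp_all add: B_def)
qed

lemma planar_independent:
  fixes a1 a2 b1 b2 x y :: real
  assumes "a1 * b2 - a2 * b1 \<noteq> 0" "x * a1 + y * a2 = 0" "x * b1 + y * b2 = 0"
  shows "x = 0 \<and> y = 0"
proof -
  have "(a1 * b2 - a2 * b1) * x = b2 * (x * a1 + y * a2) - a2 * (x * b1 + y * b2)"
    "(a1 * b2 - a2 * b1) * y = a1 * (x * b1 + y * b2) - b1 * (x * a1 + y * a2)"
    by (simp_all add: algebra_simps)
  then have "(a1 * b2 - a2 * b1) * x = 0" "(a1 * b2 - a2 * b1) * y = 0"
    unfolding assms(2,3) by simp_all
  then show ?thesis using assms(1) by simp
qed

locale lorentz_frame =
  fixes a b n :: "real^3"
  assumes spacelike: "\<And>s t. s \<noteq> 0 \<or> t \<noteq> 0 \<Longrightarrow> lorentz (s *\<^sub>R a + t *\<^sub>R b) (s *\<^sub>R a + t *\<^sub>R b) > 0"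
    and orth: "lorentz n a = 0" "lorentz n b = 0"
    and unit: "\<bar>lorentz n n\<bar> = 1"
begin

text \<open>A tangent vector without horizontal part is vertical, so its Lorentz square is not
  positive. This makes the projection \<open>X\<close> an immersion.\<close>

lemma projection_regular: "a $ 1 * b $ 2 - a $ 2 * b $ 1 \<noteq> 0"
proof
  assume J: "a $ 1 * b $ 2 - a $ 2 * b $ 1 = 0"
  have no: "\<not> (s * a $ 1 + t * b $ 1 = 0 \<and> s * a $ 2 + t * b $ 2 = 0)" if "s \<noteq> 0 \<or> t \<noteq> 0" for s t
  proof
    assume "s * a $ 1 + t * b $ 1 = 0 \<and> s * a $ 2 + t * b $ 2 = 0"
    then have "lorentz (s *\<^sub>R a + t *\<^sub>R b) (s *\<^sub>R a + t *\<^sub>R b) = - ((s * a $ 3 + t * b $ 3) * (s * a $ 3 + t * b $ 3))"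
      by (simp add: lorentz_def)
    then show False using spacelike[OF that] by (simp add: not_sum_power2_lt_zero flip: power2_eq_square)
  qed
  \<comment> \<open>These coefficients cancel one horizontal coordinate identically and the other by
    \<open>J\<close>.\<close>
  have "b $ 1 = 0 \<and> a $ 1 = 0" using no[of "b $ 1" "- a $ 1"] J by (auto simp: algebra_simps)
  moreover have "b $ 2 = 0 \<and> a $ 2 = 0" using no[of "b $ 2" "- a $ 2"] J by (auto simp: algebra_simps)
  ultimately show False using no[of 1 0] by simp
qed

lemma n3_nonzero: "n $ 3 \<noteq> 0"
proof
  assume n3: "n $ 3 = 0"
  have "n $ 1 = 0 \<and> n $ 2 = 0"
    by (rule planar_independent[OF projection_regular]) (use orth n3 in \<open>simp_all add: lorentz_def\<close>)
  then show False using unit n3 by (simp add: lorentz_def)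
qed

lemma timelike: "lorentz n n = - 1"
proof -
  let ?J = "a $ 1 * b $ 2 - a $ 2 * b $ 1" and ?m = "n $ 1 * n $ 1 + n $ 2 * n $ 2"
  have "?m < n $ 3 * n $ 3"
  proof (cases "n $ 1 = 0 \<and> n $ 2 = 0")
    case True
    have "n $ 3 * n $ 3 > 0" using n3_nonzero by (metis not_real_square_gt_zero)
    then show ?thesis using True by simp
  next
    case False
    \<comment> \<open>By Cramer's rule, the tangent vector with the horizontal part of
      \<open>n\<close>; its height is \<open>w\<close>. Space-likeness gives
      \<open>w * w < ?m\<close>, orthogonality gives \<open>?m = n $ 3 * w\<close>, and together
      they force \<open>?m < n $ 3 * n $ 3\<close>.\<close>
    define s where "s = (n $ 1 * b $ 2 - n $ 2 * b $ 1) / ?J"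
    define t where "t = (a $ 1 * n $ 2 - a $ 2 * n $ 1) / ?J"
    define w where "w = s * a $ 3 + t * b $ 3"
    have "s * a $ 1 + t * b $ 1 = (n $ 1 * ?J) / ?J" "s * a $ 2 + t * b $ 2 = (n $ 2 * ?J) / ?J"
      unfolding s_def t_def by (simp_all add: add_divide_distrib[symmetric] algebra_simps)
    then have st: "s * a $ 1 + t * b $ 1 = n $ 1" "s * a $ 2 + t * b $ 2 = n $ 2"
      using projection_regular by simp_all
    have "s \<noteq> 0 \<or> t \<noteq> 0" using st False by auto
    from spacelike[OF this] have pos: "w * w < ?m" unfolding lorentz_def
      by (simp add: st w_def)
    have "lorentz n (s *\<^sub>R a + t *\<^sub>R b) = 0" by (simp add: lorentz_simps orth)
    then have "?m = n $ 3 * w" unfolding lorentz_def by (simp add: st w_def)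
    then have mm: "?m * ?m = (n $ 3 * n $ 3) * (w * w)" by simp
    have "n $ 3 * n $ 3 > 0" using n3_nonzero by (metis not_real_square_gt_zero)
    then have "?m * ?m < (n $ 3 * n $ 3) * ?m" unfolding mm using pos by (intro mult_strict_left_mono)
    moreover have "?m > 0" using pos zero_le_square[of w] by linarith
    ultimately show ?thesis by (simp add: mult_less_cancel_right)
  qed
  then have "lorentz n n < 0" by (simp add: lorentz_def)
  then show ?thesis using unit by linarith
qed

text \<open>Subtracting the multiple of \<open>n\<close> with the same third coordinate leaves a
  horizontal vector orthogonal to \<open>a\<close> and \<open>b\<close>, hence 0; and
  \<open>n\<close> is not null.\<close>

lemma nondegenerate:
  assumes "lorentz d a = 0" "lorentz d b = 0" "lorentz d n = 0"
  shows "d = 0"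
proof -
  let ?k = "d $ 3 / n $ 3"
  have "d $ 3 = ?k * n $ 3" using n3_nonzero by simp
  have "d $ 1 - ?k * n $ 1 = 0 \<and> d $ 2 - ?k * n $ 2 = 0"
  proof (rule planar_independent[OF projection_regular])
    have "lorentz (d - ?k *\<^sub>R n) a = 0" "lorentz (d - ?k *\<^sub>R n) b = 0"
      using assms orth by (simp_all add: lorentz_simps)
    then show "(d $ 1 - ?k * n $ 1) * a $ 1 + (d $ 2 - ?k * n $ 2) * a $ 2 = 0"
      "(d $ 1 - ?k * n $ 1) * b $ 1 + (d $ 2 - ?k * n $ 2) * b $ 2 = 0"
      unfolding lorentz_def using n3_nonzero by simp_all
  qed
  then have d: "d = ?k *\<^sub>R n" using n3_nonzero by (simp add: vec_eq_iff forall_3)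
  then have "lorentz d n = ?k * lorentz n n" by (metis lorentz_simps(5))
  then have "?k = 0" using assms(3) timelike by simp
  then show ?thesis using d by (metis scaleR_zero_left)
qed

end

section \<open>Fundamental forms, Christoffel symbols and the Gauss equation\<close>

locale spacelike_surface =
  fixes U :: "(real^2) set" and g \<nu> :: "real^2 \<Rightarrow> real^3"
  assumes U: "open U" and g: "spacelike_immersion_on U g" and \<nu>: "unit_normal_field U g \<nu>"
begin

abbreviation "G \<equiv> induced_metric g"
abbreviation "dg \<equiv> \<lambda>i. partial_deriv i g"
abbreviation "ddg \<equiv> \<lambda>i j. partial_deriv i (partial_deriv j g)"
abbreviation "\<Gamma> \<equiv> christoffel G"

definition h :: "2 \<Rightarrow> 2 \<Rightarrow> real^2 \<Rightarrow> real" where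
  "h i j p = lorentz (ddg i j p) (\<nu> p)"

lemma smooth_g: "smooth_on U g" using g by (simp add: spacelike_immersion_on_def)
lemma smooth_\<nu>: "smooth_on U \<nu>" using \<nu> by (simp add: unit_normal_field_def)
lemma smooth_dg: "smooth_on U (dg i)" using smooth_g smooth_on_partial_deriv by blast
lemma smooth_ddg: "smooth_on U (ddg i j)" using smooth_dg smooth_on_partial_deriv by blast

lemma frechet_g: "p \<in> U \<Longrightarrow> frechet_derivative g (at p) v = v $ 1 *\<^sub>R dg 1 p + v $ 2 *\<^sub>R dg 2 p"
  using frechet_derivative_partials2 smooth_on_differentiable[OF smooth_g] by blast

lemma frechet_\<nu>: "p \<in> U \<Longrightarrow> frechet_derivative \<nu> (at p) v = v $ 1 *\<^sub>R partial_deriv 1 \<nu> p + v $ 2 *\<^sub>R partial_deriv 2 \<nu> p"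
  using frechet_derivative_partials2 smooth_on_differentiable[OF smooth_\<nu>] by blast

lemma normal: "p \<in> U \<Longrightarrow> lorentz (\<nu> p) (dg i p) = 0"
  using \<nu> by (simp add: unit_normal_field_def partial_deriv_def)

lemma frame: "p \<in> U \<Longrightarrow> lorentz_frame (dg 1 p) (dg 2 p) (\<nu> p)"
proof
  fix s t :: real assume p: "p \<in> U" and st: "s \<noteq> 0 \<or> t \<noteq> 0"
  let ?v = "vector [s, t] :: real^2"
  have "?v \<noteq> 0" using st by (auto simp: vec_eq_iff forall_2)
  then have "lorentz (frechet_derivative g (at p) ?v) (frechet_derivative g (at p) ?v) > 0"
    using g p by (simp add: spacelike_immersion_on_def)
  then show "0 < lorentz (s *\<^sub>R dg 1 p + t *\<^sub>R dg 2 p) (s *\<^sub>R dg 1 p + t *\<^sub>R dg 2 p)"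
    by (simp add: frechet_g[OF p])
next
  assume p: "p \<in> U"
  then show "\<bar>lorentz (\<nu> p) (\<nu> p)\<bar> = 1" using \<nu> by (simp add: unit_normal_field_def)
qed (simp_all add: normal)

lemma G_entry: "G p $ i $ j = lorentz (dg i p) (dg j p)"
  by (simp add: induced_metric_def)

lemma G_sym: "G p $ 2 $ 1 = G p $ 1 $ 2"
  by (simp add: G_entry lorentz_commute)

lemma smooth_G: "smooth_on U (\<lambda>q. G q $ i $ j)"
  unfolding G_entry by (intro smooth_on_lorentz U smooth_dg)

lemma G_pos:
  assumes "p \<in> U" "s \<noteq> 0 \<or> t \<noteq> 0"
  shows "0 < G p $ 1 $ 1 * s * s + 2 * G p $ 1 $ 2 * s * t + G p $ 2 $ 2 * t * t"
proof -
  interpret lorentz_frame "dg 1 p" "dg 2 p" "\<nu> p" using frame[OF assms(1)] .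
  show ?thesis using spacelike[OF assms(2)]
    by (simp add: lorentz_simps G_entry lorentz_commute[of "dg 2 p" "dg 1 p"] algebra_simps)
qed

lemma det_G: "det (G p) = G p $ 1 $ 1 * G p $ 2 $ 2 - G p $ 1 $ 2 * G p $ 1 $ 2"
  by (simp add: det_2 G_sym)

lemma G11_pos: "p \<in> U \<Longrightarrow> G p $ 1 $ 1 > 0"
  using G_pos[of p 1 0] by simp

lemma det_G_pos:
  assumes "p \<in> U"
  shows "det (G p) > 0"
proof -
  have "0 < G p $ 1 $ 1 * det (G p)"
    using G_pos[OF assms, of "- G p $ 1 $ 2" "G p $ 1 $ 1"] G11_pos[OF assms]
    by (simp add: det_G algebra_simps)
  then show ?thesis using G11_pos[OF assms] by (simp add: zero_less_mult_iff)
qed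

lemma ddg_commute: "p \<in> U \<Longrightarrow> ddg i j p = ddg j i p"
  using partial_deriv_commute[OF U smooth_g] .

lemma partial_G:
  assumes "p \<in> U"
  shows "partial_deriv k (\<lambda>q. G q $ i $ j) p = lorentz (ddg k i p) (dg j p) + lorentz (dg i p) (ddg k j p)"
  unfolding G_entry
  by (rule partial_deriv_lorentz) (use assms smooth_dg smooth_on_differentiable in blast)+

text \<open>By symmetry of second derivatives the three derivatives of the metric collapse to
  \<open>2 * lorentz (ddg i j p) (dg m p)\<close>.\<close>

lemma christoffel_eq:
  assumes "p \<in> U"
  shows "\<Gamma> l i j p = (\<Sum>m\<in>UNIV. matrix_inv (G p) $ l $ m * lorentz (ddg i j p) (dg m p))"
proof -
  have "partial_deriv i (\<lambda>q. G q $ j $ m) p + partial_deriv j (\<lambda>q. G q $ i $ m) p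
      - partial_deriv m (\<lambda>q. G q $ i $ j) p = 2 * lorentz (ddg i j p) (dg m p)" for m
    using ddg_commute[OF assms, of i j] ddg_commute[OF assms, of i m] ddg_commute[OF assms, of j m]
    by (simp add: partial_G[OF assms] lorentz_commute)
  then show ?thesis by (simp add: christoffel_def sum_distrib_left)
qed

lemma christoffel_explicit:
  assumes "p \<in> U"
  shows "\<Gamma> 1 i j p = (G p $ 2 $ 2 * lorentz (ddg i j p) (dg 1 p) - G p $ 1 $ 2 * lorentz (ddg i j p) (dg 2 p)) / det (G p)"
    "\<Gamma> 2 i j p = (G p $ 1 $ 1 * lorentz (ddg i j p) (dg 2 p) - G p $ 1 $ 2 * lorentz (ddg i j p) (dg 1 p)) / det (G p)"
proof -
  have "det (G p) \<noteq> 0" using det_G_pos[OF assms] by simp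
  note matrix_inv_2[OF this]
  then show "\<Gamma> 1 i j p = (G p $ 2 $ 2 * lorentz (ddg i j p) (dg 1 p) - G p $ 1 $ 2 * lorentz (ddg i j p) (dg 2 p)) / det (G p)"
    "\<Gamma> 2 i j p = (G p $ 1 $ 1 * lorentz (ddg i j p) (dg 2 p) - G p $ 1 $ 2 * lorentz (ddg i j p) (dg 1 p)) / det (G p)"
    by (simp_all add: christoffel_eq[OF assms] sum_2 G_sym diff_divide_distrib)
qed

lemma smooth_\<Gamma>: "smooth_on U (\<Gamma> l i j)"
proof -
  have "smooth_on U (\<lambda>p. det (G p))"
    unfolding det_G by (intro smooth_on_diff smooth_on_mult smooth_G U)
  moreover have "det (G p) \<noteq> 0" if "p \<in> U" for p using det_G_pos[OF that] by simp
  ultimately have A: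
    "smooth_on U (\<lambda>p. (G p $ 2 $ 2 * lorentz (ddg i j p) (dg 1 p) - G p $ 1 $ 2 * lorentz (ddg i j p) (dg 2 p)) / det (G p))"
    "smooth_on U (\<lambda>p. (G p $ 1 $ 1 * lorentz (ddg i j p) (dg 2 p) - G p $ 1 $ 2 * lorentz (ddg i j p) (dg 1 p)) / det (G p))"
    by (intro smooth_on_divide smooth_on_diff smooth_on_mult smooth_on_lorentz smooth_G smooth_dg smooth_ddg U; simp)+
  have "smooth_on U (\<Gamma> 1 i j)"
    by (rule smooth_on_cong[OF U, THEN iffD2, OF _ A(1)]) (rule christoffel_explicit)
  moreover have "smooth_on U (\<Gamma> 2 i j)"
    by (rule smooth_on_cong[OF U, THEN iffD2, OF _ A(2)]) (rule christoffel_explicit)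
  ultimately show ?thesis using exhaust_2[of l] by auto
qed

lemma christoffel_lower:
  assumes "p \<in> U"
  shows "G p $ m $ 1 * \<Gamma> 1 i j p + G p $ m $ 2 * \<Gamma> 2 i j p = lorentz (ddg i j p) (dg m p)"
proof -
  have d: "det (G p) \<noteq> 0" using det_G_pos[OF assms] by simp
  have "G p $ 1 $ 1 * \<Gamma> 1 i j p + G p $ 1 $ 2 * \<Gamma> 2 i j p = lorentz (ddg i j p) (dg 1 p) * det (G p) / det (G p)"
    "G p $ 2 $ 1 * \<Gamma> 1 i j p + G p $ 2 $ 2 * \<Gamma> 2 i j p = lorentz (ddg i j p) (dg 2 p) * det (G p) / det (G p)"
    unfolding christoffel_explicit[OF assms] times_divide_eq_right add_divide_distrib[symmetric]
    unfolding det_G G_sym by (simp_all add: algebra_simps)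
  then show ?thesis using d exhaust_2[of m] by auto
qed

text \<open>Differentiating the lowered identity reaches the derivatives of \<open>\<Gamma>\<close>
  without differentiating the inverse metric.\<close>

lemma christoffel_lower_partial:
  assumes "p \<in> U"
  shows "G p $ m $ 1 * partial_deriv k (\<Gamma> 1 i j) p + G p $ m $ 2 * partial_deriv k (\<Gamma> 2 i j) p
    = lorentz (partial_deriv k (ddg i j) p) (dg m p) + lorentz (ddg i j p) (ddg k m p)
      - (lorentz (ddg k m p) (dg 1 p) + lorentz (dg m p) (ddg k 1 p)) * \<Gamma> 1 i j p
      - (lorentz (ddg k m p) (dg 2 p) + lorentz (dg m p) (ddg k 2 p)) * \<Gamma> 2 i j p"
proof -
  note D = smooth_on_differentiable[OF smooth_\<Gamma> assms] smooth_on_differentiable[OF smooth_G assms]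
    smooth_on_differentiable[OF smooth_on_mult[OF U smooth_G smooth_\<Gamma>] assms]
  have "partial_deriv k (\<lambda>q. G q $ m $ 1 * \<Gamma> 1 i j q + G q $ m $ 2 * \<Gamma> 2 i j q) p
     = partial_deriv k (\<lambda>q. lorentz (ddg i j q) (dg m q)) p"
    by (rule partial_deriv_cong[OF U assms]) (rule christoffel_lower)
  moreover have "partial_deriv k (\<lambda>q. lorentz (ddg i j q) (dg m q)) p =
     lorentz (partial_deriv k (ddg i j) p) (dg m p) + lorentz (ddg i j p) (ddg k m p)"
    by (rule partial_deriv_lorentz) (use assms smooth_dg smooth_ddg smooth_on_differentiable in blast)+
  moreover have "partial_deriv k (\<lambda>q. G q $ m $ 1 * \<Gamma> 1 i j q + G q $ m $ 2 * \<Gamma> 2 i j q) p =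
     (G p $ m $ 1 * partial_deriv k (\<Gamma> 1 i j) p + (lorentz (ddg k m p) (dg 1 p) + lorentz (dg m p) (ddg k 1 p)) * \<Gamma> 1 i j p)
     + (G p $ m $ 2 * partial_deriv k (\<Gamma> 2 i j) p + (lorentz (ddg k m p) (dg 2 p) + lorentz (dg m p) (ddg k 2 p)) * \<Gamma> 2 i j p)"
    unfolding partial_deriv_add[OF D(3) D(3)] partial_deriv_mult[OF D(2) D(1)] partial_G[OF assms] ..
  ultimately show ?thesis by linarith
qed

text \<open>Both sides have the same products with the frame. The minus sign before \<open>h\<close>
  reflects that \<open>\<nu>\<close> has Lorentz square \<open>- 1\<close>.\<close>

lemma gauss_formula:
  assumes "p \<in> U"
  shows "ddg i j p = \<Gamma> 1 i j p *\<^sub>R dg 1 p + \<Gamma> 2 i j p *\<^sub>R dg 2 p - h i j p *\<^sub>R \<nu> p"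
proof -
  interpret lorentz_frame "dg 1 p" "dg 2 p" "\<nu> p" using frame[OF assms] .
  let ?d = "ddg i j p - (\<Gamma> 1 i j p *\<^sub>R dg 1 p + \<Gamma> 2 i j p *\<^sub>R dg 2 p - h i j p *\<^sub>R \<nu> p)"
  have "lorentz ?d (dg m p) = 0" for m
    using christoffel_lower[OF assms, of m i j]
    by (simp add: lorentz_simps normal[OF assms] G_entry lorentz_commute mult.commute)
  moreover have "lorentz ?d (\<nu> p) = 0"
    using orth timelike by (simp add: lorentz_simps h_def lorentz_commute)
  ultimately have "?d = 0" by (intro nondegenerate)
  then show ?thesis by simp
qed

text \<open>The third derivatives cancel, and the Christoffel terms remove the tangential parts of
  the second ones. The time-like normal produces the minus sign, by which positive curvature means
  indefinite \<open>h\<close>.\<close>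

lemma gauss_equation:
  assumes p: "p \<in> U"
  shows "gaussian_curvature g p * det (G p) = - (h 1 1 p * h 2 2 p - h 1 2 p * h 1 2 p)"
proof -
  have third: "partial_deriv 1 (ddg 2 2) p = partial_deriv 2 (ddg 1 2) p"
  proof -
    have "partial_deriv 2 (ddg 1 2) p = partial_deriv 1 (ddg 2 2) p"
      using partial_deriv_commute[OF U smooth_dg[of 2] p] .
    then show ?thesis ..
  qed
  note s = ddg_commute[OF p, of 2 1]
  have L: "lorentz (ddg i j p) (dg m p) = G p $ m $ 1 * \<Gamma> 1 i j p + G p $ m $ 2 * \<Gamma> 2 i j p" for i j m
    using christoffel_lower[OF p] ..
  have "(\<Sum>l\<in>UNIV. riemann_curvature G l 2 1 2 p * G p $ l $ 1) =
     (G p $ 1 $ 1 * partial_deriv 1 (\<Gamma> 1 2 2) p + G p $ 1 $ 2 * partial_deriv 1 (\<Gamma> 2 2 2) p)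
     - (G p $ 1 $ 1 * partial_deriv 2 (\<Gamma> 1 1 2) p + G p $ 1 $ 2 * partial_deriv 2 (\<Gamma> 2 1 2) p)
     + (G p $ 1 $ 1 * \<Gamma> 1 1 1 p + G p $ 1 $ 2 * \<Gamma> 2 1 1 p) * \<Gamma> 1 2 2 p
     + (G p $ 1 $ 1 * \<Gamma> 1 1 2 p + G p $ 1 $ 2 * \<Gamma> 2 1 2 p) * \<Gamma> 2 2 2 p
     - (G p $ 1 $ 1 * \<Gamma> 1 2 1 p + G p $ 1 $ 2 * \<Gamma> 2 2 1 p) * \<Gamma> 1 1 2 p
     - (G p $ 1 $ 1 * \<Gamma> 1 2 2 p + G p $ 1 $ 2 * \<Gamma> 2 2 2 p) * \<Gamma> 2 1 2 p"
    by (simp add: riemann_curvature_def sum_2 G_sym algebra_simps)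
  also have "\<dots> = lorentz (ddg 2 2 p) (ddg 1 1 p) - lorentz (ddg 1 2 p) (ddg 1 2 p)
     - lorentz (ddg 1 1 p) (dg 1 p) * \<Gamma> 1 2 2 p - lorentz (ddg 1 1 p) (dg 2 p) * \<Gamma> 2 2 2 p
     + lorentz (ddg 1 2 p) (dg 1 p) * \<Gamma> 1 1 2 p + lorentz (ddg 1 2 p) (dg 2 p) * \<Gamma> 2 1 2 p"
    unfolding christoffel_lower_partial[OF p] christoffel_lower[OF p] third s
    by (simp add: lorentz_commute algebra_simps)
  also have "\<dots> = lorentz (ddg 1 1 p) (ddg 2 2 p - (\<Gamma> 1 2 2 p *\<^sub>R dg 1 p + \<Gamma> 2 2 2 p *\<^sub>R dg 2 p))
     - lorentz (ddg 1 2 p) (ddg 1 2 p - (\<Gamma> 1 1 2 p *\<^sub>R dg 1 p + \<Gamma> 2 1 2 p *\<^sub>R dg 2 p))"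
    by (simp add: lorentz_simps lorentz_commute algebra_simps)
  also have "\<dots> = lorentz (ddg 1 1 p) (- h 2 2 p *\<^sub>R \<nu> p) - lorentz (ddg 1 2 p) (- h 1 2 p *\<^sub>R \<nu> p)"
  proof -
    have e: "ddg i j p - (\<Gamma> 1 i j p *\<^sub>R dg 1 p + \<Gamma> 2 i j p *\<^sub>R dg 2 p) = - h i j p *\<^sub>R \<nu> p" for i j
      by (simp add: gauss_formula[OF p])
    show ?thesis unfolding e ..
  qed
  also have "\<dots> = - (h 1 1 p * h 2 2 p - h 1 2 p * h 1 2 p)"
    unfolding lorentz_simps by (simp add: h_def)
  finally show ?thesis
    using det_G_pos[OF p] by (simp add: gaussian_curvature_def metric_gaussian_curvature_def)
qed

lemma det_h_neg:
  assumes "p \<in> U" "gaussian_curvature g p > 0"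
  shows "h 1 1 p * h 2 2 p - h 1 2 p * h 1 2 p < 0"
proof -
  have "0 < gaussian_curvature g p * det (G p)" using assms det_G_pos by simp
  then show ?thesis unfolding gauss_equation[OF assms(1)] by linarith
qed

lemma h_sym: "p \<in> U \<Longrightarrow> h i j p = h j i p"
  by (simp add: h_def ddg_commute)

lemma smooth_h: "smooth_on U (h i j)"
  unfolding h_def by (intro smooth_on_lorentz U smooth_ddg smooth_\<nu>)

text \<open>Obtained by differentiating the orthogonality of \<open>\<nu>\<close> and
  \<open>dg i\<close>.\<close>

lemma h_eq_weingarten:
  assumes "p \<in> U"
  shows "h i j p = - lorentz (dg i p) (partial_deriv j \<nu> p)"
proof -
  have "partial_deriv j (\<lambda>q. lorentz (\<nu> q) (dg i q)) p = partial_deriv j (\<lambda>q. 0) p"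
    by (rule partial_deriv_cong[OF U assms]) (rule normal)
  moreover have "partial_deriv j (\<lambda>q. lorentz (\<nu> q) (dg i q)) p =
      lorentz (partial_deriv j \<nu> p) (dg i p) + lorentz (\<nu> p) (ddg j i p)"
    by (rule partial_deriv_lorentz) (use assms smooth_dg smooth_\<nu> smooth_on_differentiable in blast)+
  ultimately show ?thesis
    by (simp add: h_def ddg_commute[OF assms, of i j] lorentz_commute)
qed

lemma \<nu>_unit: "p \<in> U \<Longrightarrow> lorentz (\<nu> p) (\<nu> p) = - 1"
  using frame lorentz_frame.timelike by blast

lemma partial_\<nu>_tangential:
  assumes "p \<in> U"
  shows "lorentz (partial_deriv j \<nu> p) (\<nu> p) = 0"
proof -
  have d: "\<nu> differentiable (at p)" using assms smooth_\<nu> smooth_on_differentiable by blast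
  have "partial_deriv j (\<lambda>q. lorentz (\<nu> q) (\<nu> q)) p = partial_deriv j (\<lambda>q. - 1) p"
    by (rule partial_deriv_cong[OF U assms]) (rule \<nu>_unit)
  then show ?thesis unfolding partial_deriv_lorentz[OF d d] by (simp add: lorentz_commute)
qed

end

subsection \<open>Curvature line flows\<close>

lemma planar_kernel:
  fixes a b c :: real
  shows "(\<exists>v::real^2. v \<noteq> 0 \<and> a * v $ 1 + b * v $ 2 = 0 \<and> b * v $ 1 + c * v $ 2 = 0) \<longleftrightarrow> a * c - b * b = 0"
proof
  assume "\<exists>v::real^2. v \<noteq> 0 \<and> a * v $ 1 + b * v $ 2 = 0 \<and> b * v $ 1 + c * v $ 2 = 0"
  then obtain v :: "real^2" where v: "v \<noteq> 0" "v $ 1 * a + v $ 2 * b = 0" "v $ 1 * b + v $ 2 * c = 0"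
    by (auto simp: mult.commute)
  show "a * c - b * b = 0"
  proof (rule ccontr)
    assume "a * c - b * b \<noteq> 0"
    from planar_independent[OF this v(2,3)] v(1) show False by (simp add: vec_eq_iff forall_2)
  qed
next
  assume d: "a * c - b * b = 0"
  show "\<exists>v::real^2. v \<noteq> 0 \<and> a * v $ 1 + b * v $ 2 = 0 \<and> b * v $ 1 + c * v $ 2 = 0"
  proof (cases "a = 0 \<and> b = 0")
    case True
    then show ?thesis by (intro exI[of _ "vector [1, 0]"]) (auto simp: vec_eq_iff forall_2)
  next
    case False
    then show ?thesis using d
      by (intro exI[of _ "vector [b, - a]"]) (auto simp: vec_eq_iff forall_2 algebra_simps)
  qed
qed

text \<open>A singular symmetric matrix of trace \<open>\<tau>\<close> is \<open>\<tau>\<close>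
  times the projection onto the line orthogonal to its kernel: \<open>a = \<tau> * (S * S)\<close>,
  \<open>b = - (\<tau> * (S * C))\<close>, \<open>c = \<tau> * (C * C)\<close>. In terms of the
  doubled angle this is a single equation, insensitive to the sign of the kernel vector.\<close>

lemma kernel_angle:
  fixes a b c \<theta> :: real
  assumes det: "a * c = b * b" and tr: "a + c \<noteq> 0"
  shows "a * cos \<theta> + b * sin \<theta> = 0 \<and> b * cos \<theta> + c * sin \<theta> = 0 \<longleftrightarrow>
    cis (2 * \<theta>) = Complex ((c - a) / (a + c)) (- 2 * b / (a + c))"
proof -
  define C S \<tau> where "C = cos \<theta>" and "S = sin \<theta>" and "\<tau> = a + c"
  have CS: "C * C + S * S = 1" by (simp add: C_def S_def)
  have "cis (2 * \<theta>) = Complex (C * C - S * S) (2 * S * C)"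
    by (simp add: complex_eq_iff cos_double sin_double C_def S_def power2_eq_square)
  then have rhs: "cis (2 * \<theta>) = Complex ((c - a) / (a + c)) (- 2 * b / (a + c)) \<longleftrightarrow>
      c - a = \<tau> * (C * C - S * S) \<and> - b = \<tau> * (S * C)"
    using tr by (auto simp: \<tau>_def field_simps)
  have "a * C + b * S = 0 \<and> b * C + c * S = 0 \<longleftrightarrow> c - a = \<tau> * (C * C - S * S) \<and> - b = \<tau> * (S * C)"
  proof
    assume "a * C + b * S = 0 \<and> b * C + c * S = 0"
    then have e: "a * C = - (b * S)" "b * C = - (c * S)" by auto
    have "a * C * C = - (b * C) * S" unfolding e(1) by simp
    then have "a * C * C = c * S * S" unfolding e(2) by simp
    moreover have "a * (C * C + S * S) = a" "c * (C * C + S * S) = c" by (simp_all add: CS)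
    ultimately have "a = \<tau> * (S * S)" "c = \<tau> * (C * C)" by (auto simp: \<tau>_def algebra_simps)
    moreover have "\<tau> * (S * C) = (a * C) * S + (c * S) * C" by (simp add: \<tau>_def algebra_simps)
    moreover have "\<dots> = - b * (C * C + S * S)" using e by (simp add: algebra_simps)
    ultimately show "c - a = \<tau> * (C * C - S * S) \<and> - b = \<tau> * (S * C)"
      by (simp add: CS algebra_simps)
  next
    assume A: "c - a = \<tau> * (C * C - S * S) \<and> - b = \<tau> * (S * C)"
    have "a + c = \<tau> * (C * C + S * S)" by (simp add: CS \<tau>_def)
    then have "a = \<tau> * (S * S)" "c = \<tau> * (C * C)" "b = - (\<tau> * (S * C))"
      using A by (auto simp: algebra_simps)
    then show "a * C + b * S = 0 \<and> b * C + c * S = 0" by (simp add: algebra_simps)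
  qed
  then show ?thesis unfolding rhs by (simp add: C_def S_def)
qed

text \<open>A line is coded by its doubled angle, so a continuous angle along a circle is half a
  continuous argument of \<open>u\<close>. An equivalence is proved because the \<open>THE\<close>
  in \<open>umbilic_index\<close> requires uniqueness.\<close>

lemma has_flow_index_iff:
  assumes R: "R > 0" and cont: "continuous_on (ball p R - {p}) u"
    and unit: "\<And>q. q \<in> ball p R - {p} \<Longrightarrow> norm (u q) = 1"
    and L: "\<And>q \<theta>. q \<in> ball p R - {p} \<Longrightarrow> polar_vec \<theta> \<in> L q \<longleftrightarrow> cis (2 * \<theta>) = u q"
    and w: "\<And>r. 0 < r \<Longrightarrow> r < R \<Longrightarrow> turning (\<lambda>t. u (circ p r t)) = w"
  shows "has_flow_index L p i \<longleftrightarrow> i = w / 2"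
proof
  have c: "circ p r t \<in> ball p R - {p}" if "0 < r" "r < R" for r t
    using that circ_neq by auto
  {
    assume "has_flow_index L p i"
    then obtain b where b: "b > 0" "\<And>r. 0 < r \<Longrightarrow> r < b \<Longrightarrow> \<exists>\<theta>. continuous_on {0..2 * pi} \<theta> \<and>
        (\<forall>t\<in>{0..2 * pi}. polar_vec (\<theta> t) \<in> L (circ p r t)) \<and> i = (\<theta> (2 * pi) - \<theta> 0) / (2 * pi)"
      unfolding has_flow_index_def eventually_at_right_field circ_def by auto
    define r where "r = min b R / 2"
    have r: "0 < r" "r < b" "r < R" using b(1) R by (auto simp: r_def)
    obtain \<theta> where \<theta>: "continuous_on {0..2 * pi} \<theta>"
      "\<And>t. t \<in> {0..2 * pi} \<Longrightarrow> polar_vec (\<theta> t) \<in> L (circ p r t)" "i = (\<theta> (2 * pi) - \<theta> 0) / (2 * pi)"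
      using b(2)[OF r(1,2)] by blast
    let ?q = "\<lambda>t. \<i> * of_real (2 * \<theta> t)"
    have "turning (\<lambda>t. u (circ p r t)) = (Im (?q (2 * pi)) - Im (?q 0)) / (2 * pi)"
    proof (rule turning_eqI)
      show "continuous_on {0..2 * pi} ?q" using \<theta>(1) by (intro continuous_intros)
      show "u (circ p r t) = exp (?q t)" if "t \<in> {0..2 * pi}" for t
        using \<theta>(2)[OF that] L[OF c[OF r(1,3)]] by (simp add: cis_conv_exp)
    qed
    then have "w = (2 * \<theta> (2 * pi) - 2 * \<theta> 0) / (2 * pi)" unfolding w[OF r(1,3)] by simp
    also have "\<dots> = 2 * i" unfolding \<theta>(3) by (simp add: diff_divide_distrib)
    finally show "i = w / 2" by simp
  }
  assume i: "i = w / 2"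
  have "\<exists>\<theta>. continuous_on {0..2 * pi} \<theta> \<and> (\<forall>t\<in>{0..2 * pi}. polar_vec (\<theta> t) \<in> L (circ p r t)) \<and>
      i = (\<theta> (2 * pi) - \<theta> 0) / (2 * pi)" if r: "0 < r" "r < R" for r
  proof -
    have "continuous_on {0..2 * pi} (\<lambda>t. u (circ p r t))"
      by (rule continuous_on_compose2[OF cont]) (use c[OF r] in \<open>auto intro!: continuous_intros simp del: Diff_iff\<close>)
    moreover have "u (circ p r t) \<noteq> 0" for t using unit[OF c[OF r], of t] by auto
    ultimately have "loop (\<lambda>t. u (circ p r t))" by (simp add: loop_def)
    then obtain q where q: "continuous_on {0..2 * pi} q" "\<And>t. t \<in> {0..2 * pi} \<Longrightarrow> u (circ p r t) = exp (q t)"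
      using loop_log by blast
    let ?\<theta> = "\<lambda>t. Im (q t) / 2"
    have "polar_vec (?\<theta> t) \<in> L (circ p r t)" if t: "t \<in> {0..2 * pi}" for t
    proof -
      have "norm (exp (q t)) = 1" using unit[OF c[OF r]] q(2)[OF t] by metis
      then have "Re (q t) = 0" by (simp add: norm_exp_eq_Re)
      then have "exp (q t) = cis (Im (q t))" by (simp add: exp_eq_polar)
      then show ?thesis using L[OF c[OF r]] q(2)[OF t] by simp
    qed
    moreover have "w = (Im (q (2 * pi)) - Im (q 0)) / (2 * pi)"
      unfolding w[OF r, symmetric] by (rule turning_eqI[OF q])
    then have "i = (?\<theta> (2 * pi) - ?\<theta> 0) / (2 * pi)"
      unfolding i by (simp add: diff_divide_distrib)
    moreover have "continuous_on {0..2 * pi} ?\<theta>" using q(1) by (intro continuous_intros) auto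
    ultimately show ?thesis by blast
  qed
  then show "has_flow_index L p i"
    unfolding has_flow_index_def eventually_at_right_field circ_def using R by blast
qed

text \<open>An eigenline of an indefinite symmetric form \<open>h\<close>, relative to any positive definite form, on
  which \<open>h\<close> has sign \<open>\<sigma>\<close> stays away from the Euclidean eigenline with the opposite sign.\<close>

lemma eigenline_nonantipodal:
  fixes h11 h12 h22 \<sigma> \<theta> s :: real
  assumes det: "h11 * h22 - h12 * h12 < 0" and \<sigma>: "\<sigma> * \<sigma> = 1" and s: "s > 0"
    and pos: "\<sigma> * (h11 * cos \<theta> * cos \<theta> + 2 * h12 * cos \<theta> * sin \<theta> + h22 * sin \<theta> * sin \<theta>) > 0"
  shows "cis (2 * \<theta>) \<noteq> - (of_real s * (of_real \<sigma> * Complex (h11 - h22) (2 * h12)))"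
proof
  define C S where "C = cos (2 * \<theta>)" and "S = sin (2 * \<theta>)"
  have CS: "C * C + S * S = 1" by (simp add: C_def S_def)
  let ?t = "h11 + h22" and ?k = "s * \<sigma>"
  \<comment> \<open>Now \<open>?k\<close> times the pair \<open>(h11 - h22, 2 * h12)\<close> is a
    unit vector, and positivity on the line gives \<open>?k * ?t > 1\<close>. But for indefinite
    \<open>h\<close> the pair is longer than the trace \<open>?t\<close>.\<close>
  assume "cis (2 * \<theta>) = - (of_real s * (of_real \<sigma> * Complex (h11 - h22) (2 * h12)))"
  then have e: "C = - (?k * (h11 - h22))" "S = - (?k * (2 * h12))"
    by (simp_all add: complex_eq_iff C_def S_def)
  have e': "?k * (h11 - h22) = - C" "?k * (2 * h12) = - S" using e by simp_all
  have kk: "?k * ?k = s * s" using \<sigma> by (simp add: algebra_simps)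
  have dbl: "2 * (cos \<theta> * cos \<theta>) = 1 + C" "2 * (sin \<theta> * sin \<theta>) = 1 - C" "2 * (cos \<theta> * sin \<theta>) = S"
    using cos_double_cos[of \<theta>] cos_double_sin[of \<theta>] sin_double[of \<theta>]
    by (auto simp: C_def S_def power2_eq_square)
  let ?Q = "h11 * cos \<theta> * cos \<theta> + 2 * h12 * cos \<theta> * sin \<theta> + h22 * sin \<theta> * sin \<theta>"
  have "2 * ?Q = h11 * (2 * (cos \<theta> * cos \<theta>)) + 2 * h12 * (2 * (cos \<theta> * sin \<theta>)) + h22 * (2 * (sin \<theta> * sin \<theta>))"
    by (simp add: algebra_simps)
  also have "\<dots> = ?t + (h11 - h22) * C + 2 * h12 * S" unfolding dbl by (simp add: algebra_simps)
  finally have Q: "2 * ?Q = ?t + (h11 - h22) * C + 2 * h12 * S" .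
  have "0 < 2 * (\<sigma> * ?Q)" using pos by simp
  also have "\<dots> = \<sigma> * (2 * ?Q)" by (rule mult.left_commute)
  finally have "0 < \<sigma> * (?t + (h11 - h22) * C + 2 * h12 * S)" unfolding Q .
  then have "0 < s * (\<sigma> * (?t + (h11 - h22) * C + 2 * h12 * S))" using s by simp
  also have "\<dots> = ?k * ?t + (?k * (h11 - h22)) * C + (?k * (2 * h12)) * S" by (simp add: algebra_simps)
  also have "\<dots> = ?k * ?t - (C * C + S * S)" unfolding e' by simp
  finally have "1 < ?k * ?t" unfolding CS by simp
  then have "1 < (?k * ?t) * (?k * ?t)" using less_1_mult by blast
  also have "\<dots> = (s * s) * (?t * ?t)" using kk by (metis mult.assoc mult.left_commute)
  also have "\<dots> < (s * s) * ((h11 - h22) * (h11 - h22) + (2 * h12) * (2 * h12))"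
    using det s by (intro mult_strict_left_mono) (auto simp: algebra_simps)
  also have "\<dots> = (?k * (h11 - h22)) * (?k * (h11 - h22)) + (?k * (2 * h12)) * (?k * (2 * h12))"
    unfolding kk[symmetric] by (simp add: algebra_simps)
  also have "\<dots> = C * C + S * S" unfolding e' by simp
  finally show False using CS by simp
qed

section \<open>Principal directions in coordinates\<close>

context spacelike_surface
begin

text \<open>Evaluates the \<open>THE\<close> in \<open>shape_operator\<close>: existence by the
  inverse of \<open>G\<close> times \<open>h\<close>, uniqueness by injectivity of the derivative of
  \<open>g\<close>.\<close>

lemma shape_operator_ex1:
  assumes p: "p \<in> U"
  shows "\<exists>!A. linear A \<and> (\<forall>v. frechet_derivative \<nu> (at p) v = - frechet_derivative g (at p) (A v))"
proof -
  interpret lorentz_frame "dg 1 p" "dg 2 p" "\<nu> p" using frame[OF p] .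
  have dG: "det (G p) \<noteq> 0" using det_G_pos[OF p] by simp
  define S1 where "S1 j = (G p $ 2 $ 2 * h 1 j p - G p $ 1 $ 2 * h 2 j p) / det (G p)" for j
  define S2 where "S2 j = (G p $ 1 $ 1 * h 2 j p - G p $ 1 $ 2 * h 1 j p) / det (G p)" for j
  have GS: "G p $ 1 $ 1 * S1 j + G p $ 1 $ 2 * S2 j = h 1 j p" "G p $ 2 $ 1 * S1 j + G p $ 2 $ 2 * S2 j = h 2 j p" for j
  proof -
    have "G p $ 1 $ 1 * S1 j + G p $ 1 $ 2 * S2 j = h 1 j p * det (G p) / det (G p)"
      "G p $ 2 $ 1 * S1 j + G p $ 2 $ 2 * S2 j = h 2 j p * det (G p) / det (G p)"
      unfolding S1_def S2_def times_divide_eq_right add_divide_distrib[symmetric]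
      unfolding det_G G_sym by (simp_all add: algebra_simps)
    then show "G p $ 1 $ 1 * S1 j + G p $ 1 $ 2 * S2 j = h 1 j p" "G p $ 2 $ 1 * S1 j + G p $ 2 $ 2 * S2 j = h 2 j p"
      using dG by simp_all
  qed
  define A :: "real^2 \<Rightarrow> real^2" where
    "A v = vector [S1 1 * v $ 1 + S1 2 * v $ 2, S2 1 * v $ 1 + S2 2 * v $ 2]" for v
  have "linear A"
    by (rule linearI) (simp_all add: A_def vec_eq_iff forall_2 algebra_simps)
  moreover have "frechet_derivative \<nu> (at p) v = - frechet_derivative g (at p) (A v)" for v
  proof -
    let ?d = "frechet_derivative \<nu> (at p) v + frechet_derivative g (at p) (A v)"
    have "lorentz ?d (dg m p) = (G p $ m $ 1 * S1 1 + G p $ m $ 2 * S2 1 - h m 1 p) * v $ 1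
        + (G p $ m $ 1 * S1 2 + G p $ m $ 2 * S2 2 - h m 2 p) * v $ 2" for m
      unfolding frechet_\<nu>[OF p] frechet_g[OF p] h_eq_weingarten[OF p]
      by (simp add: lorentz_simps A_def G_entry lorentz_commute algebra_simps)
    then have "lorentz ?d (dg 1 p) = 0" "lorentz ?d (dg 2 p) = 0" by (simp_all add: GS)
    moreover have "lorentz ?d (\<nu> p) = 0"
      unfolding frechet_\<nu>[OF p] frechet_g[OF p]
      using partial_\<nu>_tangential[OF p] orth by (simp add: lorentz_simps lorentz_commute)
    ultimately have "?d = 0" by (intro nondegenerate)
    then show ?thesis by (simp add: eq_neg_iff_add_eq_0)
  qed
  ultimately have "linear A \<and> (\<forall>v. frechet_derivative \<nu> (at p) v = - frechet_derivative g (at p) (A v))" by blast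
  moreover have "inj (frechet_derivative g (at p))"
    using g p by (simp add: spacelike_immersion_on_def)
  ultimately show ?thesis by (metis (no_types, lifting) ext injD neg_equal_iff_equal)
qed

lemma G_shape_operator:
  assumes p: "p \<in> U"
  shows "G p $ m $ 1 * shape_operator g \<nu> p v $ 1 + G p $ m $ 2 * shape_operator g \<nu> p v $ 2 = h m 1 p * v $ 1 + h m 2 p * v $ 2"
proof -
  have "frechet_derivative \<nu> (at p) v = - frechet_derivative g (at p) (shape_operator g \<nu> p v)"
    using theI'[OF shape_operator_ex1[OF p]] unfolding shape_operator_def by blast
  then have "lorentz (frechet_derivative \<nu> (at p) v) (dg m p) = - lorentz (frechet_derivative g (at p) (shape_operator g \<nu> p v)) (dg m p)"
    by (simp add: lorentz_def)
  then show ?thesis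
    unfolding frechet_\<nu>[OF p] frechet_g[OF p] h_eq_weingarten[OF p]
    by (simp add: lorentz_simps G_entry lorentz_commute algebra_simps)
qed

text \<open>The pencil \<open>h - k G\<close>. It trades eigenvectors of the shape operator, whose
  matrix need not be symmetric, for kernel vectors of a symmetric matrix, to which
  \<open>kernel_angle\<close> applies.\<close>

definition N :: "real \<Rightarrow> 2 \<Rightarrow> 2 \<Rightarrow> real^2 \<Rightarrow> real" where
  "N k i j p = h i j p - k * G p $ i $ j"

lemma eigenvector_iff:
  assumes p: "p \<in> U"
  shows "shape_operator g \<nu> p v = k *\<^sub>R v \<longleftrightarrow>
    N k 1 1 p * v $ 1 + N k 1 2 p * v $ 2 = 0 \<and> N k 1 2 p * v $ 1 + N k 2 2 p * v $ 2 = 0"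
proof -
  let ?d = "shape_operator g \<nu> p v - k *\<^sub>R v"
  have G: "G p $ m $ 1 * ?d $ 1 + G p $ m $ 2 * ?d $ 2 = N k m 1 p * v $ 1 + N k m 2 p * v $ 2" for m
    using G_shape_operator[OF p, of m v] by (simp add: N_def algebra_simps)
  have N21: "N k 2 1 p = N k 1 2 p" by (simp add: N_def G_sym h_sym[OF p, of 2 1])
  have "?d = 0 \<longleftrightarrow> N k 1 1 p * v $ 1 + N k 1 2 p * v $ 2 = 0 \<and> N k 1 2 p * v $ 1 + N k 2 2 p * v $ 2 = 0"
  proof
    assume "?d = 0"
    then have "?d $ 1 = 0" "?d $ 2 = 0" by (simp_all del: vector_minus_component)
    then show "N k 1 1 p * v $ 1 + N k 1 2 p * v $ 2 = 0 \<and> N k 1 2 p * v $ 1 + N k 2 2 p * v $ 2 = 0"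
      using G[of 1] G[of 2] N21 by simp
  next
    assume n: "N k 1 1 p * v $ 1 + N k 1 2 p * v $ 2 = 0 \<and> N k 1 2 p * v $ 1 + N k 2 2 p * v $ 2 = 0"
    have "?d $ 1 = 0 \<and> ?d $ 2 = 0"
    proof (rule planar_independent)
      show "G p $ 1 $ 1 * G p $ 2 $ 2 - G p $ 1 $ 2 * G p $ 2 $ 1 \<noteq> 0"
        using det_G_pos[OF p] by (simp add: det_2)
      show "?d $ 1 * G p $ 1 $ 1 + ?d $ 2 * G p $ 1 $ 2 = 0" "?d $ 1 * G p $ 2 $ 1 + ?d $ 2 * G p $ 2 $ 2 = 0"
        using G[of 1] G[of 2] n N21 by (simp_all add: mult.commute)
    qed
    then show "?d = 0" by (intro vec2_eqI) simp_all
  qed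
  then show ?thesis by simp
qed

text \<open>Minus the coefficient of \<open>k\<close> in \<open>det (h - k G)\<close>; see
  \<open>curvature_equation\<close>.\<close>

definition bb :: "real^2 \<Rightarrow> real" where
  "bb p = G p $ 1 $ 1 * h 2 2 p + G p $ 2 $ 2 * h 1 1 p - 2 * G p $ 1 $ 2 * h 1 2 p"

definition det_h :: "real^2 \<Rightarrow> real" where
  "det_h p = h 1 1 p * h 2 2 p - h 1 2 p * h 1 2 p"

definition curv :: "real \<Rightarrow> real^2 \<Rightarrow> real" where
  "curv \<sigma> p = (bb p + \<sigma> * sqrt (bb p * bb p - 4 * det (G p) * det_h p)) / (2 * det (G p))"

lemma curvature_equation:
  "N k 1 1 p * N k 2 2 p - N k 1 2 p * N k 1 2 p = det (G p) * (k * k) - bb p * k + det_h p"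
  by (simp add: N_def det_G bb_def det_h_def algebra_simps)

lemma discriminant:
  assumes "p \<in> U" "det_h p < 0"
  shows "bb p * bb p < bb p * bb p - 4 * det (G p) * det_h p"
  using mult_pos_neg[OF det_G_pos[OF assms(1)] assms(2)] by simp

lemma curvature_equation_factors:
  assumes "p \<in> U" "det_h p < 0"
  shows "det (G p) * (k * k) - bb p * k + det_h p = det (G p) * ((k - curv 1 p) * (k - curv (- 1) p))"
proof -
  let ?r = "sqrt (bb p * bb p - 4 * det (G p) * det_h p)" and ?a = "det (G p)"
  have a: "?a > 0" using det_G_pos[OF assms(1)] .
  have r: "?r * ?r = bb p * bb p - 4 * ?a * det_h p"
  proof -
    have "0 \<le> bb p * bb p - 4 * ?a * det_h p"
      using discriminant[OF assms] zero_le_square[of "bb p"] by linarith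
    then show ?thesis by (simp only: real_sqrt_mult_self abs_of_nonneg)
  qed
  have s: "curv 1 p + curv (- 1) p = bb p / ?a"
    using a by (simp add: curv_def add_divide_distrib[symmetric])
  have "curv 1 p * curv (- 1) p = (bb p * bb p - ?r * ?r) / (4 * ?a * ?a)"
    by (simp add: curv_def algebra_simps)
  also have "\<dots> = det_h p / ?a" unfolding r using a by simp
  finally have m: "curv 1 p * curv (- 1) p = det_h p / ?a" .
  have "?a * ((k - curv 1 p) * (k - curv (- 1) p)) = ?a * (k * k) - ?a * (curv 1 p + curv (- 1) p) * k + ?a * (curv 1 p * curv (- 1) p)"
    by (simp add: algebra_simps)
  then show ?thesis unfolding s m using a by simp
qed

text \<open>For indefinite \<open>h\<close> the square root exceeds the absolute value of
  \<open>bb p\<close>. So \<open>Max\<close> and \<open>Min\<close> select the principal curvatures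
  by their signs.\<close>

lemma curv_sign:
  assumes "p \<in> U" "det_h p < 0"
  shows "curv 1 p > 0" "curv (- 1) p < 0"
proof -
  have "\<bar>bb p\<bar> < sqrt (bb p * bb p - 4 * det (G p) * det_h p)"
    using real_sqrt_less_mono[OF discriminant[OF assms]] by simp
  then show "curv 1 p > 0" "curv (- 1) p < 0"
    using det_G_pos[OF assms(1)] by (auto simp: curv_def intro!: divide_pos_pos divide_neg_pos)
qed

lemma principal_curvatures_eq:
  assumes "p \<in> U" "det_h p < 0"
  shows "principal_curvatures g \<nu> p = {curv 1 p, curv (- 1) p}"
  using det_G_pos[OF assms(1)]
  by (auto simp: principal_curvatures_def eigenvector_iff[OF assms(1)] planar_kernel curvature_equation
      curvature_equation_factors[OF assms])

lemma curvature_flows: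
  assumes "p \<in> U" "det_h p < 0"
  shows "max_curvature_flow g \<nu> p = {v. shape_operator g \<nu> p v = curv 1 p *\<^sub>R v}"
    "min_curvature_flow g \<nu> p = {v. shape_operator g \<nu> p v = curv (- 1) p *\<^sub>R v}"
  using curv_sign[OF assms]
  by (simp_all add: max_curvature_flow_def min_curvature_flow_def principal_curvatures_eq[OF assms])

lemma continuous_curv: "continuous_on U (curv \<sigma>)"
proof -
  have "continuous_on U (\<lambda>p. det (G p))" "continuous_on U bb" "continuous_on U det_h"
    unfolding det_G bb_def det_h_def
    by (intro continuous_intros smooth_on_continuous smooth_G smooth_h)+
  then show ?thesis unfolding curv_def using det_G_pos by (intro continuous_intros) force+
qed

text \<open>The traceless part of \<open>h\<close> for the Euclidean metric of the parameter plane,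
  not for \<open>G\<close>. The two kinds of eigenlines differ in general but turn alike.\<close>

definition hopf :: "real^2 \<Rightarrow> complex" where
  "hopf p = Complex (h 1 1 p - h 2 2 p) (2 * h 1 2 p)"

text \<open>On the eigenline \<open>h\<close> is \<open>curv \<sigma>\<close> times
  \<open>G\<close>, hence has sign \<open>\<sigma>\<close>, so \<open>eigenline_nonantipodal\<close>
  compares its doubled angle \<open>u\<close> with \<open>\<sigma>\<close> times
  \<open>hopf\<close>. The constant \<open>\<sigma>\<close> does not affect turning, so both flows
  get the same index.\<close>

lemma eigenline_index:
  assumes R: "R > 0" "ball p R \<subseteq> U" and neg: "\<And>q. q \<in> ball p R - {p} \<Longrightarrow> det_h q < 0"
    and w: "\<And>r. 0 < r \<Longrightarrow> r < R \<Longrightarrow> turning (\<lambda>t. hopf (circ p r t)) = w"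
    and \<sigma>: "\<sigma> = 1 \<or> \<sigma> = - 1"
    and L: "\<And>q. q \<in> ball p R - {p} \<Longrightarrow> L q = {v. shape_operator g \<nu> q v = curv \<sigma> q *\<^sub>R v}"
  shows "has_flow_index L p i \<longleftrightarrow> i = w / 2"
proof -
  let ?B = "ball p R - {p}"
  have inU: "q \<in> U" if "q \<in> ?B" for q using that R by blast
  define n where "n i j q = N (curv \<sigma> q) i j q" for i j q
  define u where "u q = Complex ((n 2 2 q - n 1 1 q) / (n 1 1 q + n 2 2 q)) (- 2 * n 1 2 q / (n 1 1 q + n 2 2 q))" for q
  have det_n: "n 1 1 q * n 2 2 q = n 1 2 q * n 1 2 q" if q: "q \<in> ?B" for q
  proof -
    have "n 1 1 q * n 2 2 q - n 1 2 q * n 1 2 q = 0"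
      unfolding n_def curvature_equation curvature_equation_factors[OF inU[OF q] neg[OF q]] using \<sigma> by auto
    then show ?thesis by simp
  qed
  \<comment> \<open>A singular symmetric matrix of trace 0 vanishes; then \<open>h\<close> would be
    a multiple of \<open>G\<close>, and \<open>det_h\<close> would not be negative.\<close>
  have tr_n: "n 1 1 q + n 2 2 q \<noteq> 0" if q: "q \<in> ?B" for q
  proof
    assume t: "n 1 1 q + n 2 2 q = 0"
    then have "n 2 2 q = - n 1 1 q" by simp
    then have "n 1 1 q * - n 1 1 q = n 1 2 q * n 1 2 q" using det_n[OF q] by metis
    then have "n 1 1 q * n 1 1 q + n 1 2 q * n 1 2 q = 0" by linarith
    then have "n 1 1 q = 0 \<and> n 1 2 q = 0" unfolding sum_squares_eq_zero_iff .
    then have "h 1 1 q = curv \<sigma> q * G q $ 1 $ 1" "h 1 2 q = curv \<sigma> q * G q $ 1 $ 2" "h 2 2 q = curv \<sigma> q * G q $ 2 $ 2"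
      using t by (simp_all add: n_def N_def)
    then have "det_h q = curv \<sigma> q * curv \<sigma> q * det (G q)"
      by (simp add: det_h_def det_G algebra_simps)
    moreover have "0 \<le> curv \<sigma> q * curv \<sigma> q * det (G q)" using det_G_pos[OF inU[OF q]] by simp
    ultimately show False using neg[OF q] by simp
  qed
  have line: "polar_vec \<theta> \<in> L q \<longleftrightarrow> cis (2 * \<theta>) = u q" if q: "q \<in> ?B" for q \<theta>
    using kernel_angle[OF det_n[OF q] tr_n[OF q]] eigenvector_iff[OF inU[OF q]]
    by (simp add: L[OF q] u_def n_def)
  have unit: "norm (u q) = 1" if q: "q \<in> ?B" for q
  proof -
    let ?t = "n 1 1 q + n 2 2 q"
    have "(n 2 2 q - n 1 1 q)\<^sup>2 + (- 2 * n 1 2 q)\<^sup>2 = ?t\<^sup>2"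
      using det_n[OF q] by (simp add: power2_eq_square algebra_simps)
    then have "((n 2 2 q - n 1 1 q) / ?t)\<^sup>2 + (- 2 * n 1 2 q / ?t)\<^sup>2 = 1"
      using tr_n[OF q] by (simp add: power_divide add_divide_distrib[symmetric])
    then show ?thesis by (simp add: u_def cmod_def)
  qed
  have cont_n: "continuous_on ?B (n i j)" for i j
    unfolding n_def N_def
  proof -
    have "?B \<subseteq> U" using inU by blast
    then show "continuous_on ?B (\<lambda>q. h i j q - curv \<sigma> q * G q $ i $ j)"
      by (intro continuous_on_diff continuous_on_mult continuous_on_subset[OF continuous_curv]
        continuous_on_subset[OF smooth_on_continuous[OF smooth_h]]
        continuous_on_subset[OF smooth_on_continuous[OF smooth_G]])
  qed
  have cont_u: "continuous_on ?B u"
    unfolding u_def Complex_eq using tr_n by (intro continuous_intros cont_n) auto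
  have cont_hopf: "continuous_on U hopf"
    unfolding hopf_def Complex_eq by (intro continuous_intros smooth_on_continuous smooth_h)
  have hopf_nz: "hopf q \<noteq> 0" if "q \<in> ?B" for q
  proof
    assume "hopf q = 0"
    then have "h 1 1 q = h 2 2 q" "h 1 2 q = 0" by (auto simp: hopf_def complex_eq_iff)
    then show False using neg[OF that] by (simp add: det_h_def not_less)
  qed
  have "turning (\<lambda>t. u (circ p r t)) = w" if r: "0 < r" "r < R" for r
  proof -
    have c: "circ p r t \<in> ?B" for t using r circ_neq by auto
    have lu: "loop (\<lambda>t. u (circ p r t))"
    proof -
      have "continuous_on {0..2 * pi} (\<lambda>t. u (circ p r t))"
        by (rule continuous_on_compose2[OF cont_u]) (use c in \<open>auto intro!: continuous_intros simp del: Diff_iff\<close>)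
      moreover have "u (circ p r t) \<noteq> 0" for t using unit[OF c, of t] by auto
      ultimately show ?thesis by (simp add: loop_def)
    qed
    have lh: "loop (\<lambda>t. hopf (circ p r t))"
    proof -
      have "continuous_on {0..2 * pi} (\<lambda>t. hopf (circ p r t))"
        by (rule continuous_on_compose2[OF cont_hopf]) (use inU[OF c] in \<open>auto intro!: continuous_intros\<close>)
      then show ?thesis using hopf_nz[OF c] by (simp add: loop_def)
    qed
    have ls: "loop (\<lambda>t. of_real \<sigma> * hopf (circ p r t))"
      "turning (\<lambda>t. of_real \<sigma> * hopf (circ p r t)) = turning (\<lambda>t. hopf (circ p r t))"
      using turning_real_mult[of "\<lambda>t. \<sigma>", OF _ _ _ lh] \<sigma> by auto
    have "turning (\<lambda>t. u (circ p r t)) = turning (\<lambda>t. of_real \<sigma> * hopf (circ p r t))"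
    proof (rule turning_nonantipodal[OF lu ls(1)])
      fix t s :: real assume s: "s > 0"
      let ?q = "circ p r t"
      define \<theta> where "\<theta> = Arg (u ?q) / 2"
      have "u ?q \<noteq> 0" using unit[OF c, of t] by auto
      then have cis: "cis (2 * \<theta>) = u ?q"
        using unit[OF c, of t] by (simp add: \<theta>_def cis_Arg sgn_div_norm)
      let ?C = "cos \<theta>" and ?S = "sin \<theta>" and ?k = "curv \<sigma> ?q"
      have "n 1 1 ?q * ?C + n 1 2 ?q * ?S = 0 \<and> n 1 2 ?q * ?C + n 2 2 ?q * ?S = 0"
        using kernel_angle[OF det_n[OF c] tr_n[OF c]] cis unfolding u_def by blast
      then have e: "h 1 1 ?q * ?C + h 1 2 ?q * ?S = ?k * (G ?q $ 1 $ 1 * ?C + G ?q $ 1 $ 2 * ?S)"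
        "h 1 2 ?q * ?C + h 2 2 ?q * ?S = ?k * (G ?q $ 1 $ 2 * ?C + G ?q $ 2 $ 2 * ?S)"
        by (simp_all add: n_def N_def algebra_simps)
      have "h 1 1 ?q * ?C * ?C + 2 * h 1 2 ?q * ?C * ?S + h 2 2 ?q * ?S * ?S
         = (h 1 1 ?q * ?C + h 1 2 ?q * ?S) * ?C + (h 1 2 ?q * ?C + h 2 2 ?q * ?S) * ?S"
        by (simp add: algebra_simps)
      also have "\<dots> = ?k * (G ?q $ 1 $ 1 * ?C * ?C + 2 * G ?q $ 1 $ 2 * ?C * ?S + G ?q $ 2 $ 2 * ?S * ?S)"
        unfolding e by (simp add: algebra_simps)
      finally have hk: "h 1 1 ?q * ?C * ?C + 2 * h 1 2 ?q * ?C * ?S + h 2 2 ?q * ?S * ?S = \<dots>" .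
      have "?C \<noteq> 0 \<or> ?S \<noteq> 0" using sin_cos_squared_add3[of \<theta>] by (metis add_0 mult_zero_left zero_neq_one)
      from G_pos[OF inU[OF c] this]
      have Gp: "0 < G ?q $ 1 $ 1 * ?C * ?C + 2 * G ?q $ 1 $ 2 * ?C * ?S + G ?q $ 2 $ 2 * ?S * ?S" .
      have "0 < \<sigma> * ?k" using curv_sign[OF inU[OF c] neg[OF c]] \<sigma> by auto
      from mult_pos_pos[OF this Gp]
      have "0 < \<sigma> * (h 1 1 ?q * ?C * ?C + 2 * h 1 2 ?q * ?C * ?S + h 2 2 ?q * ?S * ?S)"
        unfolding hk by (simp only: mult.assoc)
      from eigenline_nonantipodal[OF _ _ s this] neg[OF c, of t] \<sigma>
      show "u ?q \<noteq> - (of_real s * (of_real \<sigma> * hopf ?q))"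
        unfolding cis[symmetric] hopf_def det_h_def by auto
    qed
    then show ?thesis using ls(2) w[OF r] by simp
  qed
  from has_flow_index_iff[OF R(1) cont_u unit line this] show ?thesis .
qed

end

theorem propositionB:
  fixes U :: "(real^2) set" and p\<^sub>0 :: "real^2" and g \<nu> :: "real^2 \<Rightarrow> real^3"
  assumes "open U" and "p\<^sub>0 \<in> U"
    and "spacelike_immersion_on U g"
    and "unit_normal_field U g \<nu>"
    and "isolated_umbilic g \<nu> p\<^sub>0"
    and "\<And>p. p \<in> U - {p\<^sub>0} \<Longrightarrow> gaussian_curvature g p > 0"
  shows "umbilic_index g \<nu> p\<^sub>0 \<le> 0"
proof -
  interpret spacelike_surface U g \<nu> by unfold_locales (use assms in auto)
  have neg: "det_h p < 0" if "p \<in> U" "p \<noteq> p\<^sub>0" for p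
    using det_h_neg[OF that(1)] assms(6) that by (simp add: det_h_def)
  have n3: "\<nu> p $ 3 \<noteq> 0" if "p \<in> U" for p
    using lorentz_frame.n3_nonzero[OF frame[OF that]] .
  have smooth: "smooth_on U (\<lambda>q. g q $ k)" "smooth_on U (\<lambda>q. \<nu> q $ k / \<nu> q $ 3)" for k
    using n3 by (auto intro!: smooth_on_divide smooth_on_component smooth_g smooth_\<nu> U)
  interpret m: smooth_map_pair U p\<^sub>0 "\<lambda>q. g q $ 1" "\<lambda>q. g q $ 2" "\<lambda>q. \<nu> q $ 1 / \<nu> q $ 3" "\<lambda>q. \<nu> q $ 2 / \<nu> q $ 3"
    by unfold_locales (use assms smooth in auto)
  have X: "partial_deriv i (\<lambda>q. g q $ k) p = dg i p $ k" if "p \<in> U" for i k p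
    using partial_deriv_component smooth_on_differentiable[OF smooth_g that] by blast
  \<comment> \<open>Write \<open>\<nu> = \<nu>\<^sub>3 (F, 1)\<close>. The derivative of the factor
    contributes a multiple of \<open>\<nu>\<close>, orthogonal to \<open>dg i p\<close>, so only
    \<open>\<nu>\<^sub>3\<close> times the derivative of \<open>F\<close> meets the tangent
    vector.\<close>
  have hb: "h i j p = - \<nu> p $ 3 * m.b i j p" if p: "p \<in> U" for i j p
  proof -
    let ?F = "\<lambda>k q. \<nu> q $ k / \<nu> q $ 3"
    have F: "partial_deriv j \<nu> p $ k = ?F k p * partial_deriv j \<nu> p $ 3 + \<nu> p $ 3 * partial_deriv j (?F k) p" for k
    proof -
      have "partial_deriv j \<nu> p $ k = partial_deriv j (\<lambda>q. \<nu> q $ k) p" for k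
        using partial_deriv_component smooth_on_differentiable[OF smooth_\<nu> p] by metis
      moreover have "partial_deriv j (\<lambda>q. \<nu> q $ k) p = partial_deriv j (\<lambda>q. \<nu> q $ 3 * ?F k q) p"
        by (rule partial_deriv_cong[OF U p]) (use n3 in simp)
      moreover have "partial_deriv j (\<lambda>q. \<nu> q $ 3 * ?F k q) p
          = \<nu> p $ 3 * partial_deriv j (?F k) p + partial_deriv j (\<lambda>q. \<nu> q $ 3) p * ?F k p"
        by (rule partial_deriv_mult)
          (use smooth(2) smooth_on_component[OF U smooth_\<nu>] p smooth_on_differentiable in blast)+
      ultimately show ?thesis by (simp add: mult.commute)
    qed
    have "dg i p $ 1 * \<nu> p $ 1 + dg i p $ 2 * \<nu> p $ 2 = dg i p $ 3 * \<nu> p $ 3"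
      using normal[OF p, of i] by (simp add: lorentz_def mult.commute)
    then have z: "dg i p $ 3 = dg i p $ 1 * ?F 1 p + dg i p $ 2 * ?F 2 p"
      using n3[OF p] by (simp add: field_simps)
    show ?thesis
      unfolding h_eq_weingarten[OF p] lorentz_def m.b_def X[OF p] F[of 1] F[of 2] z
      by (simp add: algebra_simps)
  qed
  interpret m: indefinite_map_pair U p\<^sub>0 "\<lambda>q. g q $ 1" "\<lambda>q. g q $ 2" "\<lambda>q. \<nu> q $ 1 / \<nu> q $ 3" "\<lambda>q. \<nu> q $ 2 / \<nu> q $ 3"
  proof
    fix p assume p: "p \<in> U"
    show "m.b 1 2 p = m.b 2 1 p" using hb[OF p] h_sym[OF p, of 1 2] n3[OF p] by simp
    show "planar_jacobian (\<lambda>q. g q $ 1) (\<lambda>q. g q $ 2) p \<noteq> 0"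
      using lorentz_frame.projection_regular[OF frame[OF p]]
      by (simp add: planar_jacobian_def X[OF p] mult.commute)
    assume "p \<noteq> p\<^sub>0"
    from neg[OF p this] have "(\<nu> p $ 3 * \<nu> p $ 3) * (m.b 1 1 p * m.b 2 2 p - m.b 1 2 p * m.b 1 2 p) < 0"
      by (simp add: det_h_def hb[OF p] algebra_simps)
    moreover have "\<nu> p $ 3 * \<nu> p $ 3 > 0" using n3[OF p] by (metis not_real_square_gt_zero)
    ultimately show "m.b 1 1 p * m.b 2 2 p - m.b 1 2 p * m.b 1 2 p < 0"
      by (simp add: mult_less_0_iff)
  qed
  obtain R where R: "R > 0" "\<And>r. 0 < r \<Longrightarrow> r < R \<Longrightarrow> cball p\<^sub>0 r \<subseteq> U"
    "\<And>r. 0 < r \<Longrightarrow> r < R \<Longrightarrow> turning (\<lambda>t. m.D (circ p\<^sub>0 r t)) = turning (\<lambda>t. m.D (circ p\<^sub>0 (R / 2) t))"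
    "turning (\<lambda>t. m.D (circ p\<^sub>0 (R / 2) t)) \<le> 0"
    using m.turning_D_nonpos by blast
  define w where "w = turning (\<lambda>t. m.D (circ p\<^sub>0 (R / 2) t))"
  have ball: "ball p\<^sub>0 R \<subseteq> U"
  proof
    fix q assume "q \<in> ball p\<^sub>0 R"
    then have "q \<in> cball p\<^sub>0 ((dist p\<^sub>0 q + R) / 2)" "0 < (dist p\<^sub>0 q + R) / 2" "(dist p\<^sub>0 q + R) / 2 < R"
      using R(1) by (auto intro: add_nonneg_pos)
    then show "q \<in> U" using R(2) by blast
  qed
  have hopf: "turning (\<lambda>t. hopf (circ p\<^sub>0 r t)) = w" if r: "0 < r" "r < R" for r
  proof -
    have c: "circ p\<^sub>0 r t \<in> U" for t using ball r by (auto simp: subset_iff)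
    \<comment> \<open>The real factor \<open>- \<nu>\<^sub>3\<close> has no zero, so it leaves the
      turning number unchanged.\<close>
    have "hopf (circ p\<^sub>0 r t) = of_real (- \<nu> (circ p\<^sub>0 r t) $ 3) * m.D (circ p\<^sub>0 r t)" for t
      unfolding hopf_def m.D_def hb[OF c] by (simp add: complex_eq_iff algebra_simps)
    moreover have "turning (\<lambda>t. of_real (- \<nu> (circ p\<^sub>0 r t) $ 3) * m.D (circ p\<^sub>0 r t)) = turning (\<lambda>t. m.D (circ p\<^sub>0 r t))"
    proof (rule turning_real_mult(1))
      show "continuous_on {0..2 * pi} (\<lambda>t. - \<nu> (circ p\<^sub>0 r t) $ 3)"
        by (intro continuous_intros continuous_on_compose2[OF smooth_on_continuous[OF smooth_\<nu>]]) (use c in auto)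
      show "loop (\<lambda>t. m.D (circ p\<^sub>0 r t))" using m.loop_D R(2) r by blast
    qed (use n3[OF c] in auto)
    ultimately show ?thesis using R(3)[OF r] by (simp add: w_def)
  qed
  have neg': "det_h q < 0" if "q \<in> ball p\<^sub>0 R - {p\<^sub>0}" for q using neg ball that by blast
  have max: "has_flow_index (max_curvature_flow g \<nu>) p\<^sub>0 i \<longleftrightarrow> i = w / 2" for i
    by (rule eigenline_index[OF R(1) ball neg' hopf, where \<sigma> = 1]) (use curvature_flows(1) neg' ball in auto)
  have min: "has_flow_index (min_curvature_flow g \<nu>) p\<^sub>0 i \<longleftrightarrow> i = w / 2" for i
    by (rule eigenline_index[OF R(1) ball neg' hopf, where \<sigma> = "- 1"]) (use curvature_flows(2) neg' ball in auto)
  have "umbilic_index g \<nu> p\<^sub>0 = w / 2"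
    by (simp only: umbilic_index_def max min conj_absorb the_eq_trivial)
  then show ?thesis using R(4) by (simp add: w_def)
qed

end
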